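(* Let $f\colon\varnothing\to W\cup X\cup Y\cup U$ be a $\mathbb{C}_\theta$-kernel with $W,X,Y,U$ mutually disjoint finite sets of variables. (1) $f$ displays Markov CI of $X$ and $Y$ given $W$ if and only if $f \models_{\mathcal{V}} (\varnothing \triangleright W) \mathbin{⨟} \big( (W \triangleright X) * (W \triangleright Y) \big)$ (DIBI CI). (2) If $f$ displays superset CI of $X$ and $Y$ given $W$, then $f \models_{\mathcal{V}} (\varnothing \triangleright W) \mathbin{⨟} \big( (W \triangleright X) * (W \triangleright Y) \big)$.
   Context: Fix a countably infinite set of variables $\mathrm{Var}$ with a linear order $\prec$; finite sets of variables are represented as $\prec$-ordered duplicate-free lists. Fix a Markov category $(\mathbb{C},\otimes,\mathsf{I})$ (symmetric monoidal with commutative comonoids $\mathsf{copy}$, $\mathsf{del}$ compatible with $\otimes$, $\mathsf{del}$ natural) and $\theta\colon\mathrm{Var}\to\mathrm{ob}(\mathbb{C})$. $\mathbb{C}_\theta$ has finite lists of variables as objects and, as morphisms $[x_1..x_m]\to[y_1..y_n]$, $\mathbb{C}$-morphisms $\theta(x_1)\otimes\cdots\otimes\theta(x_m)\to\theta(y_1)\otimes\cdots\otimes\theta(y_n)$; it is a Markov category. A $\mathbb{C}_\theta$-kernel $f\colon X\to Y$ is a morphism $\sigma\circ(\mathit{id}_X\otimes f')\circ\mathsf{copy}_X$ with $f'\colon X\to Y\setminus X$ and $\sigma$ a rewiring (input preserved in output). $f\odot g=g\circ f$ when $\mathrm{cod} f=\mathrm{dom} g$; $f\oplus g$ (for $f\colon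 X\to Y$, $g\colon U\to V$) is defined iff $X\cap U=Y\cap V$ and copies the shared inputs $X\cap U$ into the nontrivial parts of both kernels, keeping inputs, giving $X\cup U\to Y\cup V$. $f\sqsubseteq g$ iff $g=(f\oplus\mathit{id}_Z)\odot h$ for some variables $Z$ and kernel $h$. Satisfaction: $f\models(S\triangleright T)$ iff some subkernel $f'\colon S\to Y'$ of $f$ has $T\subseteq Y'$; $a\models P*Q$ iff $\exists b_1,b_2$, $b_1\oplus b_2\sqsubseteq a$, $b_1\models P$, $b_2\models Q$; $a\models P\mathbin{⨟}Q$ iff $\exists b_1,b_2$, $b_1\odot b_2=a$, $b_1\models P$, $b_2\models Q$ ($\mathbin{⨟}$ is DIBI's non-commutative sequential conjunction). For $s\colon\mathsf{I}\to\mathsf{W}\otimes\mathsf{X}\otimes\mathsf{Y}\otimes\mathsf{U}$ in a Markov category: $s$ displays Markov CI of $\mathsf{X},\mathsf{Y}$ given $\mathsf{W}$ if there exist $s_\mathsf{W}\colon\mathsf{I}\to\mathsf{W}$, $g_\mathsf{X}\colon\mathsf{W}\to\mathsf{X}$, $g_\mathsf{Y}\colon\mathsf{W}\to\mathsf{Y}$ with $(\mathit{id}_{\mathsf{W}\otimes\mathsf{X}\otimes\mathsf{Y}}\otimes\mathsf{del}_\mathsf{U})\circ s = (\mathit{id}_\mathsf{W}\otimes g_\mathsf{X}\otimes g_\mathsf{Y})\circ\mathsf{copy}^{(3)}_\mathsf{W}\circ s_\mathsf{W}$. $s$ displays superset CI if there exist morphisms $s_0$, $g_1$, $g_2$ such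 that $s$ equals (up to rewiring) the composite in which $s_0$ produces $\mathsf{W}$ together with part of $\mathsf{U}$, $\mathsf{W}$ is copied three times, one copy is output and the others are fed to $g_1$ (producing $\mathsf{X}$ and part of $\mathsf{U}$) and $g_2$ (producing $\mathsf{Y}$ and part of $\mathsf{U}$), i.e. the extra object $\mathsf{U}$ is kept and passed along through $s_0,g_1,g_2$ rather than discarded.
   Formalization: In (1), the direction from Markov CI to DIBI CI is proved only when every state I→A⊗B of the Markov category has a conditional A→B; without this it fails (e.g. finite stochastic matrices with dyadic entries). The converse and (2) hold in every Markov category. *)

theory Defs
  imports "HOL-Library.Countable" "HOL-Library.Infinite_Typeclass"
begin

text \<open>
  Markov categories: symmetric monoidal categories (not assumed strict) with a compatible
  commutative comonoid on each object and natural discarding. The associator is oriented as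
  \<open>(A \<otimes> B) \<otimes> C \<rightarrow> A \<otimes> (B \<otimes> C)\<close>, the unitors as \<open>I \<otimes> A \<rightarrow> A\<close> and \<open>A \<otimes> I \<rightarrow> A\<close>.
\<close>

record ('o, 'a) mcat =
  obj :: "'o set"
  arr :: "'a set"
  src :: "'a \<Rightarrow> 'o"
  tgt :: "'a \<Rightarrow> 'o"
  ident :: "'o \<Rightarrow> 'a"
  cmp :: "'a \<Rightarrow> 'a \<Rightarrow> 'a"  (infixr "\<cdot>\<index>" 60)
  tunit :: "'o"
  tobj :: "'o \<Rightarrow> 'o \<Rightarrow> 'o"  (infixr "\<otimes>\<^sub>o\<index>" 70)
  tarr :: "'a \<Rightarrow> 'a \<Rightarrow> 'a"  (infixr "\<otimes>\<index>" 70)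
  assoc :: "'o \<Rightarrow> 'o \<Rightarrow> 'o \<Rightarrow> 'a"
  lunit :: "'o \<Rightarrow> 'a"
  runit :: "'o \<Rightarrow> 'a"
  swap :: "'o \<Rightarrow> 'o \<Rightarrow> 'a"
  copy :: "'o \<Rightarrow> 'a"
  del :: "'o \<Rightarrow> 'a"

definition hom :: "('o, 'a, 'z) mcat_scheme \<Rightarrow> 'o \<Rightarrow> 'o \<Rightarrow> 'a set" where
  "hom C A B = {f \<in> arr C. src C f = A \<and> tgt C f = B}"

definition inverse_arrows :: "('o, 'a, 'z) mcat_scheme \<Rightarrow> 'a \<Rightarrow> 'a \<Rightarrow> bool" where
  "inverse_arrows C f g \<longleftrightarrow> f \<in> arr C \<and> g \<in> hom C (tgt C f) (src C f) \<and>
     g \<cdot>\<^bsub>C\<^esub> f = ident C (src C f) \<and> f \<cdot>\<^bsub>C\<^esub> g = ident C (tgt C f)"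

definition iso :: "('o, 'a, 'z) mcat_scheme \<Rightarrow> 'a \<Rightarrow> bool" where
  "iso C f \<longleftrightarrow> (\<exists>g. inverse_arrows C f g)"

definition inv_arr :: "('o, 'a, 'z) mcat_scheme \<Rightarrow> 'a \<Rightarrow> 'a" where
  "inv_arr C f = (THE g. inverse_arrows C f g)"

locale category =
  fixes C :: "('o, 'a, 'z) mcat_scheme" (structure)
  assumes src_obj: "f \<in> arr C \<Longrightarrow> src C f \<in> obj C"
    and tgt_obj: "f \<in> arr C \<Longrightarrow> tgt C f \<in> obj C"
    and ident_hom: "A \<in> obj C \<Longrightarrow> ident C A \<in> hom C A A"
    and cmp_hom: "f \<in> hom C A B \<Longrightarrow> g \<in> hom C B D \<Longrightarrow> g \<cdot> f \<in> hom C A D"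
    and cmp_ident_right: "f \<in> hom C A B \<Longrightarrow> f \<cdot> ident C A = f"
    and cmp_ident_left: "f \<in> hom C A B \<Longrightarrow> ident C B \<cdot> f = f"
    and cmp_assoc: "f \<in> hom C A B \<Longrightarrow> g \<in> hom C B D \<Longrightarrow> h \<in> hom C D E \<Longrightarrow>
      (h \<cdot> g) \<cdot> f = h \<cdot> (g \<cdot> f)"

locale monoidal_category = category +
  assumes tunit_obj: "tunit C \<in> obj C"
    and tobj_obj: "A \<in> obj C \<Longrightarrow> B \<in> obj C \<Longrightarrow> A \<otimes>\<^sub>o B \<in> obj C"
    and tarr_hom: "f \<in> hom C A A' \<Longrightarrow> g \<in> hom C B B' \<Longrightarrow> f \<otimes> g \<in> hom C (A \<otimes>\<^sub>o B) (A' \<otimes>\<^sub>o B')"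
    and tarr_ident: "A \<in> obj C \<Longrightarrow> B \<in> obj C \<Longrightarrow> ident C A \<otimes> ident C B = ident C (A \<otimes>\<^sub>o B)"
    and tarr_cmp: "f \<in> hom C A A' \<Longrightarrow> f' \<in> hom C A' A'' \<Longrightarrow> g \<in> hom C B B' \<Longrightarrow> g' \<in> hom C B' B'' \<Longrightarrow>
      (f' \<cdot> f) \<otimes> (g' \<cdot> g) = (f' \<otimes> g') \<cdot> (f \<otimes> g)"
    and assoc_hom: "A \<in> obj C \<Longrightarrow> B \<in> obj C \<Longrightarrow> D \<in> obj C \<Longrightarrow>
      assoc C A B D \<in> hom C ((A \<otimes>\<^sub>o B) \<otimes>\<^sub>o D) (A \<otimes>\<^sub>o (B \<otimes>\<^sub>o D))"
    and assoc_iso: "A \<in> obj C \<Longrightarrow> B \<in> obj C \<Longrightarrow> D \<in> obj C \<Longrightarrow> iso C (assoc C A B D)"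
    and assoc_natural: "f \<in> hom C A A' \<Longrightarrow> g \<in> hom C B B' \<Longrightarrow> h \<in> hom C D D' \<Longrightarrow>
      assoc C A' B' D' \<cdot> ((f \<otimes> g) \<otimes> h) = (f \<otimes> (g \<otimes> h)) \<cdot> assoc C A B D"
    and lunit_hom: "A \<in> obj C \<Longrightarrow> lunit C A \<in> hom C (tunit C \<otimes>\<^sub>o A) A"
    and lunit_iso: "A \<in> obj C \<Longrightarrow> iso C (lunit C A)"
    and lunit_natural: "f \<in> hom C A B \<Longrightarrow> lunit C B \<cdot> (ident C (tunit C) \<otimes> f) = f \<cdot> lunit C A"
    and runit_hom: "A \<in> obj C \<Longrightarrow> runit C A \<in> hom C (A \<otimes>\<^sub>o tunit C) A"
    and runit_iso: "A \<in> obj C \<Longrightarrow> iso C (runit C A)"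
    and runit_natural: "f \<in> hom C A B \<Longrightarrow> runit C B \<cdot> (f \<otimes> ident C (tunit C)) = f \<cdot> runit C A"
    and pentagon: "A \<in> obj C \<Longrightarrow> B \<in> obj C \<Longrightarrow> D \<in> obj C \<Longrightarrow> E \<in> obj C \<Longrightarrow>
      (ident C A \<otimes> assoc C B D E) \<cdot> assoc C A (B \<otimes>\<^sub>o D) E \<cdot> (assoc C A B D \<otimes> ident C E)
        = assoc C A B (D \<otimes>\<^sub>o E) \<cdot> assoc C (A \<otimes>\<^sub>o B) D E"
    and triangle: "A \<in> obj C \<Longrightarrow> B \<in> obj C \<Longrightarrow>
      (ident C A \<otimes> lunit C B) \<cdot> assoc C A (tunit C) B = runit C A \<otimes> ident C B"

locale symmetric_monoidal_category = monoidal_category +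
  assumes swap_hom: "A \<in> obj C \<Longrightarrow> B \<in> obj C \<Longrightarrow> swap C A B \<in> hom C (A \<otimes>\<^sub>o B) (B \<otimes>\<^sub>o A)"
    and swap_swap: "A \<in> obj C \<Longrightarrow> B \<in> obj C \<Longrightarrow> swap C B A \<cdot> swap C A B = ident C (A \<otimes>\<^sub>o B)"
    and swap_natural: "f \<in> hom C A A' \<Longrightarrow> g \<in> hom C B B' \<Longrightarrow>
      swap C A' B' \<cdot> (f \<otimes> g) = (g \<otimes> f) \<cdot> swap C A B"
    and hexagon: "A \<in> obj C \<Longrightarrow> B \<in> obj C \<Longrightarrow> D \<in> obj C \<Longrightarrow>
      assoc C B D A \<cdot> swap C A (B \<otimes>\<^sub>o D) \<cdot> assoc C A B D
        = (ident C B \<otimes> swap C A D) \<cdot> assoc C B A D \<cdot> (swap C A B \<otimes> ident C D)"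

text \<open>The middle-four interchange \<open>(A \<otimes> B) \<otimes> (D \<otimes> E) \<rightarrow> (A \<otimes> D) \<otimes> (B \<otimes> E)\<close>.\<close>

definition interchange :: "('o, 'a, 'z) mcat_scheme \<Rightarrow> 'o \<Rightarrow> 'o \<Rightarrow> 'o \<Rightarrow> 'o \<Rightarrow> 'a" where
  "interchange C A B D E =
     inv_arr C (assoc C A D (B \<otimes>\<^sub>o\<^bsub>C\<^esub> E))
       \<cdot>\<^bsub>C\<^esub> (ident C A \<otimes>\<^bsub>C\<^esub> (assoc C D B E \<cdot>\<^bsub>C\<^esub> (swap C B D \<otimes>\<^bsub>C\<^esub> ident C E)
                \<cdot>\<^bsub>C\<^esub> inv_arr C (assoc C B D E)))
       \<cdot>\<^bsub>C\<^esub> assoc C A B (D \<otimes>\<^sub>o\<^bsub>C\<^esub> E)"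

locale markov_category = symmetric_monoidal_category +
  assumes copy_hom: "A \<in> obj C \<Longrightarrow> copy C A \<in> hom C A (A \<otimes>\<^sub>o A)"
    and del_hom: "A \<in> obj C \<Longrightarrow> del C A \<in> hom C A (tunit C)"
    and copy_coassoc: "A \<in> obj C \<Longrightarrow>
      assoc C A A A \<cdot> (copy C A \<otimes> ident C A) \<cdot> copy C A = (ident C A \<otimes> copy C A) \<cdot> copy C A"
    and copy_counit_left: "A \<in> obj C \<Longrightarrow> lunit C A \<cdot> (del C A \<otimes> ident C A) \<cdot> copy C A = ident C A"
    and copy_counit_right: "A \<in> obj C \<Longrightarrow> runit C A \<cdot> (ident C A \<otimes> del C A) \<cdot> copy C A = ident C A"
    and copy_comm: "A \<in> obj C \<Longrightarrow> swap C A A \<cdot> copy C A = copy C A"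
    and copy_tobj: "A \<in> obj C \<Longrightarrow> B \<in> obj C \<Longrightarrow>
      copy C (A \<otimes>\<^sub>o B) = interchange C A A B B \<cdot> (copy C A \<otimes> copy C B)"
    and del_tobj: "A \<in> obj C \<Longrightarrow> B \<in> obj C \<Longrightarrow>
      del C (A \<otimes>\<^sub>o B) = lunit C (tunit C) \<cdot> (del C A \<otimes> del C B)"
    and copy_tunit: "copy C (tunit C) = inv_arr C (lunit C (tunit C))"
    and del_tunit: "del C (tunit C) = ident C (tunit C)"
    and del_natural: "f \<in> hom C A B \<Longrightarrow> del C B \<cdot> f = del C A"

text \<open>
  Existence of conditional distributions (disintegrations): every state \<open>s : I \<rightarrow> A \<otimes> B\<close> arises
  from its marginal on \<open>A\<close> and some morphism \<open>k : A \<rightarrow> B\<close>. This is the case of a trivial domain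
  of the usual requirement that a Markov category have conditionals.
\<close>

definition has_conditional_distributions :: "('o, 'a, 'z) mcat_scheme \<Rightarrow> bool" where
  "has_conditional_distributions C \<longleftrightarrow>
     (\<forall>A \<in> obj C. \<forall>B \<in> obj C. \<forall>s \<in> hom C (tunit C) (A \<otimes>\<^sub>o\<^bsub>C\<^esub> B). \<exists>k \<in> hom C A B.
        s = (ident C A \<otimes>\<^bsub>C\<^esub> k) \<cdot>\<^bsub>C\<^esub> copy C A
              \<cdot>\<^bsub>C\<^esub> (runit C A \<cdot>\<^bsub>C\<^esub> (ident C A \<otimes>\<^bsub>C\<^esub> del C B)) \<cdot>\<^bsub>C\<^esub> s)"


text \<open>
  The category of lists of variables. A list denotes the right-nested product of the \<open>\<theta> x\<close>
  ending in the unit object. As \<open>C\<close> need not be strict, the monoidal structure on lists, which is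
  concatenation on objects, is transported along the canonical isomorphisms \<open>tprod_append\<close>.
\<close>

fun tprod :: "('o, 'a, 'z) mcat_scheme \<Rightarrow> ('v \<Rightarrow> 'o) \<Rightarrow> 'v list \<Rightarrow> 'o" where
  "tprod C \<theta> [] = tunit C"
| "tprod C \<theta> (x # xs) = \<theta> x \<otimes>\<^sub>o\<^bsub>C\<^esub> tprod C \<theta> xs"

fun tprod_append :: "('o, 'a, 'z) mcat_scheme \<Rightarrow> ('v \<Rightarrow> 'o) \<Rightarrow> 'v list \<Rightarrow> 'v list \<Rightarrow> 'a" where
  "tprod_append C \<theta> [] ys = lunit C (tprod C \<theta> ys)"
| "tprod_append C \<theta> (x # xs) ys =
     (ident C (\<theta> x) \<otimes>\<^bsub>C\<^esub> tprod_append C \<theta> xs ys)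
       \<cdot>\<^bsub>C\<^esub> assoc C (\<theta> x) (tprod C \<theta> xs) (tprod C \<theta> ys)"

text \<open>Arrows carry their endpoints since different lists may denote the same object of \<open>C\<close>.\<close>

definition list_cat ::
  "('o, 'a, 'z) mcat_scheme \<Rightarrow> ('v \<Rightarrow> 'o) \<Rightarrow> ('v list, 'v list \<times> 'a \<times> 'v list) mcat" where
  "list_cat C \<theta> = \<lparr>
     obj = UNIV,
     arr = {(xs, f, ys). f \<in> hom C (tprod C \<theta> xs) (tprod C \<theta> ys)},
     src = (\<lambda>(xs, f, ys). xs),
     tgt = (\<lambda>(xs, f, ys). ys),
     ident = (\<lambda>xs. (xs, ident C (tprod C \<theta> xs), xs)),
     cmp = (\<lambda>(ys, g, zs) (xs, f, ys'). (xs, g \<cdot>\<^bsub>C\<^esub> f, zs)),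
     tunit = [],
     tobj = (@),
     tarr = (\<lambda>(xs, f, ys) (us, g, vs).
       (xs @ us,
        tprod_append C \<theta> ys vs \<cdot>\<^bsub>C\<^esub> (f \<otimes>\<^bsub>C\<^esub> g) \<cdot>\<^bsub>C\<^esub> inv_arr C (tprod_append C \<theta> xs us),
        ys @ vs)),
     assoc = (\<lambda>xs ys zs. (xs @ ys @ zs, ident C (tprod C \<theta> (xs @ ys @ zs)), xs @ ys @ zs)),
     lunit = (\<lambda>xs. (xs, ident C (tprod C \<theta> xs), xs)),
     runit = (\<lambda>xs. (xs, ident C (tprod C \<theta> xs), xs)),
     swap = (\<lambda>xs ys.
       (xs @ ys,
        tprod_append C \<theta> ys xs \<cdot>\<^bsub>C\<^esub> swap C (tprod C \<theta> xs) (tprod C \<theta> ys)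
          \<cdot>\<^bsub>C\<^esub> inv_arr C (tprod_append C \<theta> xs ys),
        ys @ xs)),
     copy = (\<lambda>xs. (xs, tprod_append C \<theta> xs xs \<cdot>\<^bsub>C\<^esub> copy C (tprod C \<theta> xs), xs @ xs)),
     del = (\<lambda>xs. (xs, del C (tprod C \<theta> xs), [])) \<rparr>"


text \<open>
  In what follows \<open>D\<close> stands for a category \<open>list_cat C \<theta>\<close>, which is strict monoidal; its associators
  and unitors are therefore omitted.
\<close>

abbreviation sorted_vars :: "'v::linorder set \<Rightarrow> 'v list"  ("\<lfloor>_\<rfloor>\<^sub>v") where
  "\<lfloor>X\<rfloor>\<^sub>v \<equiv> sorted_list_of_set X"

text \<open>
  The rewiring \<open>xs \<rightarrow> ys\<close> built from identities and symmetries, for duplicate-free lists with the same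
  elements: move the first element of \<open>ys\<close> to the front, then continue with the others. By coherence
  it is the only rewiring between these lists.
\<close>

fun rewire :: "('v list, 'b) mcat \<Rightarrow> 'v list \<Rightarrow> 'v list \<Rightarrow> 'b" where
  "rewire D xs [] = ident D xs"
| "rewire D xs (y # ys) =
     (let as = takeWhile (\<lambda>x. x \<noteq> y) xs; bs = tl (dropWhile (\<lambda>x. x \<noteq> y) xs)
      in (ident D [y] \<otimes>\<^bsub>D\<^esub> rewire D (as @ bs) ys) \<cdot>\<^bsub>D\<^esub> (swap D as [y] \<otimes>\<^bsub>D\<^esub> ident D bs))"

definition mk_kernel :: "('v::linorder list, 'b) mcat \<Rightarrow> 'v set \<Rightarrow> 'v set \<Rightarrow> 'b \<Rightarrow> 'b" where
  "mk_kernel D X Y k =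
     rewire D (\<lfloor>X\<rfloor>\<^sub>v @ \<lfloor>Y - X\<rfloor>\<^sub>v) \<lfloor>Y\<rfloor>\<^sub>v \<cdot>\<^bsub>D\<^esub> (ident D \<lfloor>X\<rfloor>\<^sub>v \<otimes>\<^bsub>D\<^esub> k) \<cdot>\<^bsub>D\<^esub> copy D \<lfloor>X\<rfloor>\<^sub>v"

definition kernel :: "('v::linorder list, 'b) mcat \<Rightarrow> 'v set \<Rightarrow> 'v set \<Rightarrow> 'b \<Rightarrow> bool" where
  "kernel D X Y f \<longleftrightarrow> finite X \<and> finite Y \<and> X \<subseteq> Y \<and>
     (\<exists>k \<in> hom D \<lfloor>X\<rfloor>\<^sub>v \<lfloor>Y - X\<rfloor>\<^sub>v. f = mk_kernel D X Y k)"

definition kdom :: "('v list, 'b) mcat \<Rightarrow> 'b \<Rightarrow> 'v set" where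
  "kdom D f = set (src D f)"

definition kcod :: "('v list, 'b) mcat \<Rightarrow> 'b \<Rightarrow> 'v set" where
  "kcod D f = set (tgt D f)"

definition is_kernel :: "('v::linorder list, 'b) mcat \<Rightarrow> 'b \<Rightarrow> bool" where
  "is_kernel D f \<longleftrightarrow> kernel D (kdom D f) (kcod D f) f"

text \<open>The morphism \<open>k\<close> in the shape of a kernel is unique: it is the marginal on the new outputs.\<close>

definition nontrivial_part :: "('v::linorder list, 'b) mcat \<Rightarrow> 'b \<Rightarrow> 'b" where
  "nontrivial_part D f =
     (THE k. k \<in> hom D \<lfloor>kdom D f\<rfloor>\<^sub>v \<lfloor>kcod D f - kdom D f\<rfloor>\<^sub>v \<and> f = mk_kernel D (kdom D f) (kcod D f) k)"

text \<open>The wiring \<open>X \<union> U \<rightarrow> X \<otimes> U\<close> that copies the shared variables \<open>X \<inter> U\<close>.\<close>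

definition copy_shared :: "('v::linorder list, 'b) mcat \<Rightarrow> 'v set \<Rightarrow> 'v set \<Rightarrow> 'b" where
  "copy_shared D X U =
     (rewire D (\<lfloor>X - U\<rfloor>\<^sub>v @ \<lfloor>X \<inter> U\<rfloor>\<^sub>v) \<lfloor>X\<rfloor>\<^sub>v \<otimes>\<^bsub>D\<^esub> rewire D (\<lfloor>X \<inter> U\<rfloor>\<^sub>v @ \<lfloor>U - X\<rfloor>\<^sub>v) \<lfloor>U\<rfloor>\<^sub>v)
       \<cdot>\<^bsub>D\<^esub> (ident D \<lfloor>X - U\<rfloor>\<^sub>v \<otimes>\<^bsub>D\<^esub> copy D \<lfloor>X \<inter> U\<rfloor>\<^sub>v \<otimes>\<^bsub>D\<^esub> ident D \<lfloor>U - X\<rfloor>\<^sub>v)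
       \<cdot>\<^bsub>D\<^esub> rewire D \<lfloor>X \<union> U\<rfloor>\<^sub>v (\<lfloor>X - U\<rfloor>\<^sub>v @ \<lfloor>X \<inter> U\<rfloor>\<^sub>v @ \<lfloor>U - X\<rfloor>\<^sub>v)"

definition par_defined :: "('v list, 'b) mcat \<Rightarrow> 'b \<Rightarrow> 'b \<Rightarrow> bool" where
  "par_defined D f g \<longleftrightarrow> kdom D f \<inter> kdom D g = kcod D f \<inter> kcod D g"

definition par :: "('v::linorder list, 'b) mcat \<Rightarrow> 'b \<Rightarrow> 'b \<Rightarrow> 'b" where
  "par D f g =
     (let X = kdom D f; Y = kcod D f; U = kdom D g; V = kcod D g
      in mk_kernel D (X \<union> U) (Y \<union> V)
           (rewire D (\<lfloor>Y - X\<rfloor>\<^sub>v @ \<lfloor>V - U\<rfloor>\<^sub>v) \<lfloor>(Y \<union> V) - (X \<union> U)\<rfloor>\<^sub>v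
              \<cdot>\<^bsub>D\<^esub> (nontrivial_part D f \<otimes>\<^bsub>D\<^esub> nontrivial_part D g) \<cdot>\<^bsub>D\<^esub> copy_shared D X U))"

definition seq_defined :: "('v list, 'b) mcat \<Rightarrow> 'b \<Rightarrow> 'b \<Rightarrow> bool" where
  "seq_defined D f g \<longleftrightarrow> tgt D f = src D g"

definition seq :: "('v list, 'b) mcat \<Rightarrow> 'b \<Rightarrow> 'b \<Rightarrow> 'b" where
  "seq D f g = g \<cdot>\<^bsub>D\<^esub> f"

definition subkernel :: "('v::linorder list, 'b) mcat \<Rightarrow> 'b \<Rightarrow> 'b \<Rightarrow> bool" where
  "subkernel D f g \<longleftrightarrow>
     (\<exists>Z h. finite Z \<and> is_kernel D h \<and> par_defined D f (ident D \<lfloor>Z\<rfloor>\<^sub>v) \<and>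
        seq_defined D (par D f (ident D \<lfloor>Z\<rfloor>\<^sub>v)) h \<and> g = seq D (par D f (ident D \<lfloor>Z\<rfloor>\<^sub>v)) h)"

datatype 'v dibi =
    Dep "'v set" "'v set"  (infix "\<triangleright>" 75)
  | Star "'v dibi" "'v dibi"  (infixr "\<^bold>*" 70)
  | Seq "'v dibi" "'v dibi"  (infixr "\<^bold>;" 65)

fun sat :: "('v::linorder list, 'b) mcat \<Rightarrow> 'b \<Rightarrow> 'v dibi \<Rightarrow> bool" where
  "sat D a (S \<triangleright> T) \<longleftrightarrow> (\<exists>b. is_kernel D b \<and> subkernel D b a \<and> kdom D b = S \<and> T \<subseteq> kcod D b)"
| "sat D a (P \<^bold>* Q) \<longleftrightarrow>
     (\<exists>b1 b2. is_kernel D b1 \<and> is_kernel D b2 \<and> par_defined D b1 b2 \<and> subkernel D (par D b1 b2) a \<and>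
        sat D b1 P \<and> sat D b2 Q)"
| "sat D a (P \<^bold>; Q) \<longleftrightarrow>
     (\<exists>b1 b2. is_kernel D b1 \<and> is_kernel D b2 \<and> seq_defined D b1 b2 \<and> seq D b1 b2 = a \<and>
        sat D b1 P \<and> sat D b2 Q)"

definition copy3 :: "('v list, 'b) mcat \<Rightarrow> 'v list \<Rightarrow> 'b" where
  "copy3 D ws = (ident D ws \<otimes>\<^bsub>D\<^esub> copy D ws) \<cdot>\<^bsub>D\<^esub> copy D ws"

definition markov_ci :: "('v list, 'b) mcat \<Rightarrow> 'v list \<Rightarrow> 'v list \<Rightarrow> 'v list \<Rightarrow> 'v list \<Rightarrow> 'b \<Rightarrow> bool" where
  "markov_ci D ws xs ys us s \<longleftrightarrow> s \<in> hom D [] (ws @ xs @ ys @ us) \<and>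
     (\<exists>s0 \<in> hom D [] ws. \<exists>g1 \<in> hom D ws xs. \<exists>g2 \<in> hom D ws ys.
        (ident D (ws @ xs @ ys) \<otimes>\<^bsub>D\<^esub> del D us) \<cdot>\<^bsub>D\<^esub> s
          = (ident D ws \<otimes>\<^bsub>D\<^esub> g1 \<otimes>\<^bsub>D\<^esub> g2) \<cdot>\<^bsub>D\<^esub> copy3 D ws \<cdot>\<^bsub>D\<^esub> s0)"

text \<open>The parts of \<open>us\<close> produced by \<open>s0\<close>, \<open>g1\<close> and \<open>g2\<close> are \<open>us0\<close>, \<open>us1\<close> and \<open>us2\<close>.\<close>

definition superset_ci :: "('v list, 'b) mcat \<Rightarrow> 'v list \<Rightarrow> 'v list \<Rightarrow> 'v list \<Rightarrow> 'v list \<Rightarrow> 'b \<Rightarrow> bool" where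
  "superset_ci D ws xs ys us s \<longleftrightarrow> s \<in> hom D [] (ws @ xs @ ys @ us) \<and>
     (\<exists>us0 us1 us2. distinct (us0 @ us1 @ us2) \<and> set (us0 @ us1 @ us2) = set us \<and>
       (\<exists>s0 \<in> hom D [] (ws @ us0). \<exists>g1 \<in> hom D ws (xs @ us1). \<exists>g2 \<in> hom D ws (ys @ us2).
          s = rewire D (ws @ (xs @ us1) @ (ys @ us2) @ us0) (ws @ xs @ ys @ us)
                \<cdot>\<^bsub>D\<^esub> ((ident D ws \<otimes>\<^bsub>D\<^esub> g1 \<otimes>\<^bsub>D\<^esub> g2) \<otimes>\<^bsub>D\<^esub> ident D us0)
                \<cdot>\<^bsub>D\<^esub> (copy3 D ws \<otimes>\<^bsub>D\<^esub> ident D us0) \<cdot>\<^bsub>D\<^esub> s0))"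

text \<open>
  The codomain of a kernel is a sorted list, hence it is rewired to \<open>W \<otimes> X \<otimes> Y \<otimes> U\<close> before the
  notions above apply.
\<close>

definition arrange :: "('v::linorder list, 'b) mcat \<Rightarrow> 'v set \<Rightarrow> 'v set \<Rightarrow> 'v set \<Rightarrow> 'v set \<Rightarrow> 'b \<Rightarrow> 'b" where
  "arrange D W X Y U f =
     rewire D \<lfloor>W \<union> X \<union> Y \<union> U\<rfloor>\<^sub>v (\<lfloor>W\<rfloor>\<^sub>v @ \<lfloor>X\<rfloor>\<^sub>v @ \<lfloor>Y\<rfloor>\<^sub>v @ \<lfloor>U\<rfloor>\<^sub>v) \<cdot>\<^bsub>D\<^esub> f"

definition displays_markov_ci ::
  "('v::linorder list, 'b) mcat \<Rightarrow> 'v set \<Rightarrow> 'v set \<Rightarrow> 'v set \<Rightarrow> 'v set \<Rightarrow> 'b \<Rightarrow> bool" where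
  "displays_markov_ci D W X Y U f \<longleftrightarrow>
     markov_ci D \<lfloor>W\<rfloor>\<^sub>v \<lfloor>X\<rfloor>\<^sub>v \<lfloor>Y\<rfloor>\<^sub>v \<lfloor>U\<rfloor>\<^sub>v (arrange D W X Y U f)"

definition displays_superset_ci ::
  "('v::linorder list, 'b) mcat \<Rightarrow> 'v set \<Rightarrow> 'v set \<Rightarrow> 'v set \<Rightarrow> 'v set \<Rightarrow> 'b \<Rightarrow> bool" where
  "displays_superset_ci D W X Y U f \<longleftrightarrow>
     superset_ci D \<lfloor>W\<rfloor>\<^sub>v \<lfloor>X\<rfloor>\<^sub>v \<lfloor>Y\<rfloor>\<^sub>v \<lfloor>U\<rfloor>\<^sub>v (arrange D W X Y U f)"

end

theory Submission
  imports Defs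
begin

text \<open>
  Everything is computed with pairings \<open>(f \<otimes> g) \<circ> copy\<close>. Copying is not natural, but deterministic
  morphisms, those that commute with it, distribute over pairings, and all structural isomorphisms are
  deterministic; an equation between wirings can therefore be checked on projections. In this way the
  canonical isomorphisms between products of lists are handled without the coherence theorem, and a
  composite of wirings of duplicate-free lists depends only on which variables it selects.

  If \<open>d\<close> is a subkernel of \<open>c\<close>, then marginalising \<open>c\<close> to the outputs of \<open>d\<close> amounts to restricting the
  inputs and applying \<open>d\<close>; applied along the formula this yields Markov conditional independence.
  Conversely, both forms of conditional independence write \<open>f\<close> as a state on \<open>W\<close> and further variables,
  followed by the parallel sum of two kernels out of \<open>W\<close>, followed by a kernel that is the identity
  for superset independence and is obtained from a conditional distribution of \<open>U\<close> given
  \<open>W\<close>, \<open>X\<close>, \<open>Y\<close> for Markov independence.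
\<close>

section \<open>Equational reasoning with sources and targets\<close>

text \<open>Two features of the statement shape the proof. Marginals forget correlations, so an
  arrow into a product cannot be identified by its marginals alone. Every claim about a composite of
  kernels must therefore be an equation between pairings, and the fact that a kernel copies its
  inputs through unchanged has to be carried along explicitly. Moreover, \<open>subkernel\<close>
  demands that the parallel sum be extended by an actual kernel to all of the outputs. Markov
  independence says nothing about how U arises, and U may depend on W, X and Y jointly; to satisfy
  the formula, U has to be regenerated from the other three. This is why that implication is stated
  under \<open>has_conditional_distributions\<close>, whereas the passage from the formula to Markov
  independence only discards variables.\<close>

context category
begin

lemma hom_iff: "f \<in> hom C A B \<longleftrightarrow> f \<in> arr C \<and> src C f = A \<and> tgt C f = B"
  by (auto simp: hom_def)

lemma src_in_obj [simp]: "f \<in> arr C \<Longrightarrow> src C f \<in> obj C"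
  and tgt_in_obj [simp]: "f \<in> arr C \<Longrightarrow> tgt C f \<in> obj C"
  by (simp_all add: src_obj tgt_obj)

lemma ident_simps [simp]:
  assumes "A \<in> obj C"
  shows "ident C A \<in> arr C" "src C (ident C A) = A" "tgt C (ident C A) = A"
  using ident_hom[OF assms] by (auto simp: hom_iff)

lemma cmp_simps [simp]:
  assumes "f \<in> arr C" "g \<in> arr C" "src C g = tgt C f"
  shows "g \<cdot> f \<in> arr C" "src C (g \<cdot> f) = src C f" "tgt C (g \<cdot> f) = tgt C g"
  using cmp_hom[of f "src C f" "tgt C f" g "tgt C g"] assms by (auto simp: hom_iff)

lemma cmp_ident_simps [simp]:
  assumes "f \<in> arr C"
  shows "src C f = A \<Longrightarrow> f \<cdot> ident C A = f" "tgt C f = A \<Longrightarrow> ident C A \<cdot> f = f"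
  using cmp_ident_right[of f "src C f" "tgt C f"] cmp_ident_left[of f "src C f" "tgt C f"] assms
  by (auto simp: hom_iff)

lemma cmp_assoc_simp [simp]:
  assumes "f \<in> arr C" "g \<in> arr C" "h \<in> arr C" "src C g = tgt C f" "src C h = tgt C g"
  shows "(h \<cdot> g) \<cdot> f = h \<cdot> g \<cdot> f"
  using cmp_assoc[of f "src C f" "tgt C f" g "tgt C g" h "tgt C h"] assms by (auto simp: hom_iff)

text \<open>\<open>inv_arr\<close> is a definite description, so uniqueness of two-sided inverses
  comes before any other fact about it: g' = (g f) g' = g (f g') = g.\<close>

lemma inv_arr_eqI:
  assumes "inverse_arrows C f g"
  shows "inv_arr C f = g"
  unfolding inv_arr_def
proof (rule the_equality, rule assms)
  fix g' assume g': "inverse_arrows C f g'"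
  have "g' = ident C (src C f) \<cdot> g'"
    using g' by (auto simp: inverse_arrows_def hom_iff)
  also have "\<dots> = (g \<cdot> f) \<cdot> g'"
    using assms by (simp only: inverse_arrows_def)
  also have "\<dots> = g \<cdot> f \<cdot> g'"
    by (rule cmp_assoc_simp) (use assms g' in \<open>auto simp: inverse_arrows_def hom_iff\<close>)
  also have "\<dots> = g"
    using assms g' by (auto simp: inverse_arrows_def hom_iff)
  finally show "g' = g" .
qed

lemma inverse_arrows_inv_arr: "iso C f \<Longrightarrow> inverse_arrows C f (inv_arr C f)"
  using inv_arr_eqI unfolding iso_def by metis

lemma inv_arr_simps:
  assumes "iso C f"
  shows "inv_arr C f \<in> arr C" "src C (inv_arr C f) = tgt C f" "tgt C (inv_arr C f) = src C f"
    "inv_arr C f \<cdot> f = ident C (src C f)" "f \<cdot> inv_arr C f = ident C (tgt C f)"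
  using inverse_arrows_inv_arr[OF assms] by (auto simp: inverse_arrows_def hom_iff)

lemma iso_arr: "iso C f \<Longrightarrow> f \<in> arr C"
  by (auto simp: iso_def inverse_arrows_def)

text \<open>Composites are normalised to the right, so an inverse pair inside a longer composite is
  followed by a tail \<open>h\<close>; these forms cancel it there.\<close>

lemma inv_arr_cancel:
  assumes "iso C f" "h \<in> arr C"
  shows "tgt C h = src C f \<Longrightarrow> inv_arr C f \<cdot> f \<cdot> h = h"
    "tgt C h = tgt C f \<Longrightarrow> f \<cdot> inv_arr C f \<cdot> h = h"
proof -
  note [simp] = inv_arr_simps[OF assms(1)] iso_arr[OF assms(1)] assms(2)
  { assume "tgt C h = src C f"
    then have "inv_arr C f \<cdot> f \<cdot> h = (inv_arr C f \<cdot> f) \<cdot> h"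
      by (intro cmp_assoc_simp[symmetric]) simp_all
    with \<open>tgt C h = src C f\<close> show "inv_arr C f \<cdot> f \<cdot> h = h" by (simp del: cmp_assoc_simp) }
  { assume "tgt C h = tgt C f"
    then have "f \<cdot> inv_arr C f \<cdot> h = (f \<cdot> inv_arr C f) \<cdot> h"
      by (intro cmp_assoc_simp[symmetric]) simp_all
    with \<open>tgt C h = tgt C f\<close> show "f \<cdot> inv_arr C f \<cdot> h = h" by (simp del: cmp_assoc_simp) }
qed

lemma iso_cmp:
  assumes "iso C f" "iso C g" "src C g = tgt C f"
  shows "iso C (g \<cdot> f)"
proof -
  note [simp] = inv_arr_simps[OF assms(1)] inv_arr_simps[OF assms(2)] assms(3)
    iso_arr[OF assms(1)] iso_arr[OF assms(2)] inv_arr_cancel[OF assms(1)] inv_arr_cancel[OF assms(2)]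
  have "inverse_arrows C (g \<cdot> f) (inv_arr C f \<cdot> inv_arr C g)"
    by (simp add: inverse_arrows_def hom_iff)
  then show ?thesis unfolding iso_def by blast
qed

lemma iso_ident [simp]: "A \<in> obj C \<Longrightarrow> iso C (ident C A)"
  unfolding iso_def by (rule exI[of _ "ident C A"]) (simp add: inverse_arrows_def hom_iff)

lemma iso_right_cancel:
  assumes "iso C e" "f \<in> arr C" "g \<in> arr C" "src C f = tgt C e" "src C g = tgt C e"
    "f \<cdot> e = g \<cdot> e"
  shows "f = g"
proof -
  have "(f \<cdot> e) \<cdot> inv_arr C e = (g \<cdot> e) \<cdot> inv_arr C e" using assms(6) by simp
  then show ?thesis
    using assms(2-5) inv_arr_simps[OF assms(1)] iso_arr[OF assms(1)] by simp
qed

end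

context monoidal_category
begin

lemma tunit_in_obj [simp]: "tunit C \<in> obj C"
  by (rule tunit_obj)

lemma tobj_in_obj [simp]: "A \<in> obj C \<Longrightarrow> B \<in> obj C \<Longrightarrow> A \<otimes>\<^sub>o B \<in> obj C"
  by (rule tobj_obj)

lemma tarr_simps [simp]:
  assumes "f \<in> arr C" "g \<in> arr C"
  shows "f \<otimes> g \<in> arr C" "src C (f \<otimes> g) = src C f \<otimes>\<^sub>o src C g"
    "tgt C (f \<otimes> g) = tgt C f \<otimes>\<^sub>o tgt C g"
  using tarr_hom[of f "src C f" "tgt C f" g "src C g" "tgt C g"] assms by (auto simp: hom_iff)

lemma tarr_ident_simp [simp]:
  "A \<in> obj C \<Longrightarrow> B \<in> obj C \<Longrightarrow> ident C A \<otimes> ident C B = ident C (A \<otimes>\<^sub>o B)"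
  by (rule tarr_ident)

lemma tarr_cmp_simp:
  assumes "f \<in> arr C" "f' \<in> arr C" "g \<in> arr C" "g' \<in> arr C" "src C f' = tgt C f" "src C g' = tgt C g"
  shows "(f' \<otimes> g') \<cdot> (f \<otimes> g) = (f' \<cdot> f) \<otimes> (g' \<cdot> g)"
  using tarr_cmp[of f "src C f" "tgt C f" f' "tgt C f'" g "src C g" "tgt C g" g' "tgt C g'"] assms
  by (auto simp: hom_iff)

lemma tarr_cmp_cmp:
  assumes "f \<in> arr C" "f' \<in> arr C" "g \<in> arr C" "g' \<in> arr C" "src C f' = tgt C f" "src C g' = tgt C g"
    "h \<in> arr C" "tgt C h = src C f \<otimes>\<^sub>o src C g"
  shows "(f' \<otimes> g') \<cdot> (f \<otimes> g) \<cdot> h = ((f' \<cdot> f) \<otimes> (g' \<cdot> g)) \<cdot> h"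
proof -
  have "(f' \<otimes> g') \<cdot> (f \<otimes> g) \<cdot> h = ((f' \<otimes> g') \<cdot> (f \<otimes> g)) \<cdot> h"
    by (rule cmp_assoc_simp[symmetric]) (use assms in auto)
  then show ?thesis by (simp only: tarr_cmp_simp[OF assms(1-6)])
qed

lemma iso_tarr:
  assumes "iso C f" "iso C g"
  shows "iso C (f \<otimes> g)"
proof -
  note [simp] = inv_arr_simps[OF assms(1)] inv_arr_simps[OF assms(2)]
    iso_arr[OF assms(1)] iso_arr[OF assms(2)]
  have "inverse_arrows C (f \<otimes> g) (inv_arr C f \<otimes> inv_arr C g)"
    by (simp add: inverse_arrows_def hom_iff tarr_cmp_simp)
  then show ?thesis unfolding iso_def by blast
qed

lemma assoc_simps [simp]:
  assumes "A \<in> obj C" "B \<in> obj C" "D \<in> obj C"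
  shows "assoc C A B D \<in> arr C" "src C (assoc C A B D) = (A \<otimes>\<^sub>o B) \<otimes>\<^sub>o D"
    "tgt C (assoc C A B D) = A \<otimes>\<^sub>o (B \<otimes>\<^sub>o D)" "iso C (assoc C A B D)"
  using assoc_hom[OF assms] assoc_iso[OF assms] by (auto simp: hom_iff)

abbreviation "assoc' A B D \<equiv> inv_arr C (assoc C A B D)"

lemma assoc'_simps [simp]:
  assumes "A \<in> obj C" "B \<in> obj C" "D \<in> obj C"
  shows "assoc' A B D \<in> arr C" "tgt C (assoc' A B D) = (A \<otimes>\<^sub>o B) \<otimes>\<^sub>o D"
    "src C (assoc' A B D) = A \<otimes>\<^sub>o (B \<otimes>\<^sub>o D)"
    "assoc' A B D \<cdot> assoc C A B D = ident C ((A \<otimes>\<^sub>o B) \<otimes>\<^sub>o D)"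
    "assoc C A B D \<cdot> assoc' A B D = ident C (A \<otimes>\<^sub>o (B \<otimes>\<^sub>o D))"
  using inv_arr_simps[of "assoc C A B D"] assms by auto

lemma lunit_simps [simp]:
  assumes "A \<in> obj C"
  shows "lunit C A \<in> arr C" "src C (lunit C A) = tunit C \<otimes>\<^sub>o A" "tgt C (lunit C A) = A"
    "iso C (lunit C A)"
  using lunit_hom[OF assms] lunit_iso[OF assms] by (auto simp: hom_iff)

lemma runit_simps [simp]:
  assumes "A \<in> obj C"
  shows "runit C A \<in> arr C" "src C (runit C A) = A \<otimes>\<^sub>o tunit C" "tgt C (runit C A) = A"
    "iso C (runit C A)"
  using runit_hom[OF assms] runit_iso[OF assms] by (auto simp: hom_iff)

lemma assoc_nat:
  assumes "f \<in> arr C" "g \<in> arr C" "h \<in> arr C"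
  shows "assoc C (tgt C f) (tgt C g) (tgt C h) \<cdot> ((f \<otimes> g) \<otimes> h)
      = (f \<otimes> (g \<otimes> h)) \<cdot> assoc C (src C f) (src C g) (src C h)"
  by (rule assoc_natural) (use assms in \<open>auto simp: hom_iff\<close>)

lemma assoc'_nat:
  assumes "f \<in> arr C" "g \<in> arr C" "h \<in> arr C"
  shows "assoc' (tgt C f) (tgt C g) (tgt C h) \<cdot> (f \<otimes> (g \<otimes> h))
      = ((f \<otimes> g) \<otimes> h) \<cdot> assoc' (src C f) (src C g) (src C h)"
proof (rule iso_right_cancel[of "assoc C (src C f) (src C g) (src C h)"])
  show "(assoc' (tgt C f) (tgt C g) (tgt C h) \<cdot> (f \<otimes> (g \<otimes> h))) \<cdot> assoc C (src C f) (src C g) (src C h)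
     = (((f \<otimes> g) \<otimes> h) \<cdot> assoc' (src C f) (src C g) (src C h)) \<cdot> assoc C (src C f) (src C g) (src C h)"
    using assms by (simp add: assoc_nat[symmetric] inv_arr_cancel)
qed (use assms in auto)

lemma lunit_nat:
  assumes "f \<in> arr C"
  shows "lunit C (tgt C f) \<cdot> (ident C (tunit C) \<otimes> f) = f \<cdot> lunit C (src C f)"
  by (rule lunit_natural) (use assms in \<open>auto simp: hom_iff\<close>)

lemma runit_nat:
  assumes "f \<in> arr C"
  shows "runit C (tgt C f) \<cdot> (f \<otimes> ident C (tunit C)) = f \<cdot> runit C (src C f)"
  by (rule runit_natural) (use assms in \<open>auto simp: hom_iff\<close>)

end

context symmetric_monoidal_category
begin

lemma swap_simps [simp]:
  assumes "A \<in> obj C" "B \<in> obj C"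
  shows "swap C A B \<in> arr C" "src C (swap C A B) = A \<otimes>\<^sub>o B" "tgt C (swap C A B) = B \<otimes>\<^sub>o A"
  using swap_hom[OF assms] by (auto simp: hom_iff)

lemma swap_nat:
  assumes "f \<in> arr C" "g \<in> arr C"
  shows "swap C (tgt C f) (tgt C g) \<cdot> (f \<otimes> g) = (g \<otimes> f) \<cdot> swap C (src C f) (src C g)"
  by (rule swap_natural) (use assms in \<open>auto simp: hom_iff\<close>)

lemma interchange_simps [simp]:
  assumes "A \<in> obj C" "B \<in> obj C" "D \<in> obj C" "E \<in> obj C"
  shows "interchange C A B D E \<in> arr C"
    "src C (interchange C A B D E) = (A \<otimes>\<^sub>o B) \<otimes>\<^sub>o (D \<otimes>\<^sub>o E)"
    "tgt C (interchange C A B D E) = (A \<otimes>\<^sub>o D) \<otimes>\<^sub>o (B \<otimes>\<^sub>o E)"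
  using assms by (simp_all add: interchange_def)

lemma interchange_nat:
  assumes [simp]: "f \<in> arr C" "g \<in> arr C" "h \<in> arr C" "k \<in> arr C"
  shows "interchange C (tgt C f) (tgt C g) (tgt C h) (tgt C k) \<cdot> ((f \<otimes> g) \<otimes> (h \<otimes> k))
      = ((f \<otimes> h) \<otimes> (g \<otimes> k)) \<cdot> interchange C (src C f) (src C g) (src C h) (src C k)"
proof -
  \<comment> \<open>\<open>?mid\<close> is the inner part of \<open>interchange\<close>, acting on
    the last three of the four factors; its naturality is shown apart because it sits under a tensor
    with an identity.\<close>
  let ?mid = "\<lambda>B D E. assoc C D B E \<cdot> (swap C B D \<otimes> ident C E) \<cdot> assoc' B D E"
  have mid: "?mid (tgt C g) (tgt C h) (tgt C k) \<cdot> (g \<otimes> (h \<otimes> k))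
      = (h \<otimes> (g \<otimes> k)) \<cdot> ?mid (src C g) (src C h) (src C k)"
  proof -
    have "?mid (tgt C g) (tgt C h) (tgt C k) \<cdot> (g \<otimes> (h \<otimes> k))
      = assoc C (tgt C h) (tgt C g) (tgt C k) \<cdot> (swap C (tgt C g) (tgt C h) \<otimes> ident C (tgt C k))
         \<cdot> ((g \<otimes> h) \<otimes> k) \<cdot> assoc' (src C g) (src C h) (src C k)"
      by (simp add: assoc'_nat)
    also have "\<dots> = assoc C (tgt C h) (tgt C g) (tgt C k) \<cdot> ((h \<otimes> g) \<otimes> k)
         \<cdot> (swap C (src C g) (src C h) \<otimes> ident C (src C k)) \<cdot> assoc' (src C g) (src C h) (src C k)"
      by (simp add: tarr_cmp_cmp swap_nat)
    also have "\<dots> = (assoc C (tgt C h) (tgt C g) (tgt C k) \<cdot> ((h \<otimes> g) \<otimes> k))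
         \<cdot> (swap C (src C g) (src C h) \<otimes> ident C (src C k)) \<cdot> assoc' (src C g) (src C h) (src C k)"
      by simp
    also have "\<dots> = (h \<otimes> (g \<otimes> k)) \<cdot> ?mid (src C g) (src C h) (src C k)"
      by (simp add: assoc_nat)
    finally show ?thesis .
  qed
  have "interchange C (tgt C f) (tgt C g) (tgt C h) (tgt C k) \<cdot> ((f \<otimes> g) \<otimes> (h \<otimes> k))
     = assoc' (tgt C f) (tgt C h) (tgt C g \<otimes>\<^sub>o tgt C k)
       \<cdot> (ident C (tgt C f) \<otimes> ?mid (tgt C g) (tgt C h) (tgt C k))
       \<cdot> (assoc C (tgt C f) (tgt C g) (tgt C (h \<otimes> k)) \<cdot> ((f \<otimes> g) \<otimes> (h \<otimes> k)))"
    by (simp add: interchange_def)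
  also have "\<dots> = assoc' (tgt C f) (tgt C h) (tgt C g \<otimes>\<^sub>o tgt C k)
       \<cdot> (ident C (tgt C f) \<otimes> ?mid (tgt C g) (tgt C h) (tgt C k)) \<cdot> (f \<otimes> (g \<otimes> (h \<otimes> k)))
       \<cdot> assoc C (src C f) (src C g) (src C (h \<otimes> k))"
    by (subst assoc_nat) simp_all
  also have "\<dots> = assoc' (tgt C f) (tgt C h) (tgt C g \<otimes>\<^sub>o tgt C k)
       \<cdot> (f \<otimes> (?mid (tgt C g) (tgt C h) (tgt C k) \<cdot> (g \<otimes> (h \<otimes> k))))
       \<cdot> assoc C (src C f) (src C g) (src C (h \<otimes> k))"
    by (subst tarr_cmp_cmp) simp_all
  also have "\<dots> = assoc' (tgt C f) (tgt C h) (tgt C g \<otimes>\<^sub>o tgt C k)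
       \<cdot> (f \<otimes> ((h \<otimes> (g \<otimes> k)) \<cdot> ?mid (src C g) (src C h) (src C k)))
       \<cdot> assoc C (src C f) (src C g) (src C (h \<otimes> k))"
    by (simp only: mid)
  also have "\<dots> = (assoc' (tgt C f) (tgt C h) (tgt C (g \<otimes> k))
       \<cdot> (f \<otimes> (h \<otimes> (g \<otimes> k)))) \<cdot> (ident C (src C f) \<otimes> ?mid (src C g) (src C h) (src C k))
       \<cdot> assoc C (src C f) (src C g) (src C (h \<otimes> k))"
    by (simp add: tarr_cmp_cmp)
  also have "\<dots> = ((f \<otimes> h) \<otimes> (g \<otimes> k)) \<cdot> interchange C (src C f) (src C g) (src C h) (src C k)"
    by (subst assoc'_nat) (simp_all add: interchange_def)
  finally show ?thesis .
qed

end

section \<open>Pairings and deterministic morphisms\<close>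

context markov_category
begin

lemma copy_simps [simp]:
  assumes "A \<in> obj C"
  shows "copy C A \<in> arr C" "src C (copy C A) = A" "tgt C (copy C A) = A \<otimes>\<^sub>o A"
  using copy_hom[OF assms] by (auto simp: hom_iff)

lemma del_simps [simp]:
  assumes "A \<in> obj C"
  shows "del C A \<in> arr C" "src C (del C A) = A" "tgt C (del C A) = tunit C"
  using del_hom[OF assms] by (auto simp: hom_iff)

text \<open>The unit object is terminal: discarding is natural along f, and on the unit it is the
  identity.\<close>

lemma to_tunit_eq_del:
  assumes "f \<in> arr C" "tgt C f = tunit C"
  shows "f = del C (src C f)"
proof -
  have "del C (tunit C) \<cdot> f = del C (src C f)"
    by (rule del_natural) (use assms in \<open>auto simp: hom_iff\<close>)
  then show ?thesis using assms by (simp add: del_tunit)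
qed

lemma del_cmp [simp]:
  assumes "f \<in> arr C" "tgt C f = A"
  shows "del C A \<cdot> f = del C (src C f)"
  by (rule del_natural) (use assms in \<open>auto simp: hom_iff\<close>)

text \<open>The product of two units is isomorphic to the unit, hence terminal as well. This gives
  determinism of \<open>del\<close> and makes the symmetry of the unit with itself trivial.\<close>

lemma to_tunit_tunit_eq:
  assumes "f \<in> arr C" "tgt C f = tunit C \<otimes>\<^sub>o tunit C" "g \<in> arr C" "tgt C g = tunit C \<otimes>\<^sub>o tunit C"
    "src C f = src C g"
  shows "f = g"
proof -
  let ?l = "lunit C (tunit C)"
  have "?l \<cdot> f = ?l \<cdot> g"
    using assms to_tunit_eq_del[of "?l \<cdot> f"] to_tunit_eq_del[of "?l \<cdot> g"] by simp
  then have "inv_arr C ?l \<cdot> ?l \<cdot> f = inv_arr C ?l \<cdot> ?l \<cdot> g" by simp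
  then show ?thesis using assms by (simp add: inv_arr_cancel)
qed

text \<open>The pairing of cartesian categories in form only: f and g act independently on two
  copies of the input, and an arrow into a product is in general not the pairing of its
  marginals.\<close>

definition pair :: "'b \<Rightarrow> 'b \<Rightarrow> 'b" where
  "pair f g = (f \<otimes> g) \<cdot> copy C (src C f)"

lemma pair_simps [simp]:
  assumes "f \<in> arr C" "g \<in> arr C" "src C f = src C g"
  shows "pair f g \<in> arr C" "src C (pair f g) = src C g" "tgt C (pair f g) = tgt C f \<otimes>\<^sub>o tgt C g"
  using assms by (simp_all add: pair_def)

lemma tarr_pair [simp]:
  assumes "f \<in> arr C" "g \<in> arr C" "src C f = src C g" "h \<in> arr C" "k \<in> arr C"
    "src C h = tgt C f" "src C k = tgt C g"
  shows "(h \<otimes> k) \<cdot> pair f g = pair (h \<cdot> f) (k \<cdot> g)"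
  using assms by (simp add: pair_def tarr_cmp_cmp)

lemma copy_eq_pair: "A \<in> obj C \<Longrightarrow> copy C A = pair (ident C A) (ident C A)"
  by (simp add: pair_def)

text \<open>Coassociativity, and below it cocommutativity and the counit laws, become rules by which
  structural maps rearrange pairings. The components are arbitrary: besides the comonoid law, only
  naturality of the structural map in the components enters.\<close>

lemma assoc_pair [simp]:
  assumes "f \<in> arr C" "g \<in> arr C" "h \<in> arr C" "src C f = src C h" "src C g = src C h"
    "tgt C f = A" "tgt C g = B" "tgt C h = D"
  shows "assoc C A B D \<cdot> pair (pair f g) h = pair f (pair g h)"
proof -
  let ?S = "src C h"
  have [simp]: "A \<in> obj C" "B \<in> obj C" "D \<in> obj C" using assms by auto
  have "pair (pair f g) h = ((f \<otimes> g) \<otimes> h) \<cdot> (copy C ?S \<otimes> ident C ?S) \<cdot> copy C ?S"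
    using assms by (simp add: pair_def tarr_cmp_cmp)
  then have "assoc C A B D \<cdot> pair (pair f g) h
      = (assoc C (tgt C f) (tgt C g) (tgt C h) \<cdot> ((f \<otimes> g) \<otimes> h))
          \<cdot> (copy C ?S \<otimes> ident C ?S) \<cdot> copy C ?S"
    using assms by simp
  also have "\<dots> = (f \<otimes> (g \<otimes> h)) \<cdot> assoc C ?S ?S ?S \<cdot> (copy C ?S \<otimes> ident C ?S) \<cdot> copy C ?S"
    by (subst assoc_nat) (use assms in simp_all)
  also have "\<dots> = (f \<otimes> (g \<otimes> h)) \<cdot> (ident C ?S \<otimes> copy C ?S) \<cdot> copy C ?S"
    using assms by (simp add: copy_coassoc)
  also have "\<dots> = pair f (pair g h)"
    using assms by (simp add: pair_def tarr_cmp_cmp)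
  finally show ?thesis .
qed

lemma assoc'_pair [simp]:
  assumes "f \<in> arr C" "g \<in> arr C" "h \<in> arr C" "src C f = src C h" "src C g = src C h"
    "tgt C f = A" "tgt C g = B" "tgt C h = D"
  shows "assoc' A B D \<cdot> pair f (pair g h) = pair (pair f g) h"
proof -
  have "assoc' A B D \<cdot> assoc C A B D \<cdot> pair (pair f g) h = pair (pair f g) h"
    by (rule inv_arr_cancel) (use assms in auto)
  then show ?thesis using assms by simp
qed

lemma swap_pair [simp]:
  assumes "f \<in> arr C" "g \<in> arr C" "src C f = src C g" "tgt C f = A" "tgt C g = B"
  shows "swap C A B \<cdot> pair f g = pair g f"
proof -
  have [simp]: "A \<in> obj C" "B \<in> obj C" using assms by auto
  have "swap C A B \<cdot> pair f g = (swap C (tgt C f) (tgt C g) \<cdot> (f \<otimes> g)) \<cdot> copy C (src C g)"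
    using assms by (simp add: pair_def)
  also have "\<dots> = pair g f"
    by (subst swap_nat) (use assms in \<open>simp_all add: pair_def copy_comm\<close>)
  finally show ?thesis .
qed

lemma interchange_pair [simp]:
  assumes "f \<in> arr C" "g \<in> arr C" "h \<in> arr C" "k \<in> arr C"
    "src C f = src C k" "src C g = src C k" "src C h = src C k"
    "tgt C f = A" "tgt C g = B" "tgt C h = D" "tgt C k = E"
  shows "interchange C A B D E \<cdot> pair (pair f g) (pair h k) = pair (pair f h) (pair g k)"
proof -
  have [simp]: "A \<in> obj C" "B \<in> obj C" "D \<in> obj C" "E \<in> obj C" using assms by auto
  show ?thesis using assms by (simp add: interchange_def)
qed

lemma copy_tobj_pair:
  assumes "f \<in> arr C" "g \<in> arr C" "src C f = src C g"
  shows "copy C (tgt C f \<otimes>\<^sub>o tgt C g) \<cdot> pair f g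
    = interchange C (tgt C f) (tgt C f) (tgt C g) (tgt C g)
        \<cdot> pair (copy C (tgt C f) \<cdot> f) (copy C (tgt C g) \<cdot> g)"
  using assms by (simp add: copy_tobj)

lemma lunit_pair_del:
  assumes "g \<in> arr C" "src C g = A" "tgt C g = B"
  shows "lunit C B \<cdot> pair (del C A) g = g"
proof -
  have [simp]: "A \<in> obj C" "B \<in> obj C" using assms by auto
  have "lunit C B \<cdot> pair (del C A) g
      = (lunit C (tgt C g) \<cdot> (ident C (tunit C) \<otimes> g)) \<cdot> (del C A \<otimes> ident C A) \<cdot> copy C A"
    using assms by (simp add: pair_def tarr_cmp_cmp)
  also have "\<dots> = g" by (subst lunit_nat) (use assms in \<open>simp_all add: copy_counit_left\<close>)
  finally show ?thesis .
qed

lemma runit_pair_del: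
  assumes "g \<in> arr C" "src C g = A" "tgt C g = B"
  shows "runit C B \<cdot> pair g (del C A) = g"
proof -
  have [simp]: "A \<in> obj C" "B \<in> obj C" using assms by auto
  have "runit C B \<cdot> pair g (del C A)
      = (runit C (tgt C g) \<cdot> (g \<otimes> ident C (tunit C))) \<cdot> (ident C A \<otimes> del C A) \<cdot> copy C A"
    using assms by (simp add: pair_def tarr_cmp_cmp)
  also have "\<dots> = g" by (subst runit_nat) (use assms in \<open>simp_all add: copy_counit_right\<close>)
  finally show ?thesis .
qed

lemma lunit_pair [simp]:
  assumes "f \<in> arr C" "g \<in> arr C" "src C f = src C g" "tgt C f = tunit C" "tgt C g = B"
  shows "lunit C B \<cdot> pair f g = g"
  by (subst to_tunit_eq_del[OF assms(1,4)], rule lunit_pair_del) (use assms in simp_all)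

lemma runit_pair [simp]:
  assumes "f \<in> arr C" "g \<in> arr C" "src C f = src C g" "tgt C g = tunit C" "tgt C f = B"
  shows "runit C B \<cdot> pair f g = f"
  by (subst to_tunit_eq_del[OF assms(2,4)], rule runit_pair_del) (use assms in simp_all)

text \<open>These are the comonoid homomorphisms; compatibility with \<open>del\<close> is automatic
  because discarding is natural.\<close>

definition det :: "'b \<Rightarrow> bool" where
  "det p \<longleftrightarrow> p \<in> arr C \<and> copy C (tgt C p) \<cdot> p = pair p p"

lemma det_arr: "det p \<Longrightarrow> p \<in> arr C"
  by (simp add: det_def)

lemma pair_cmp_det:
  assumes "det p" "f \<in> arr C" "g \<in> arr C" "src C f = tgt C p" "src C g = tgt C p"
  shows "pair f g \<cdot> p = pair (f \<cdot> p) (g \<cdot> p)"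
  using assms by (simp add: det_def pair_def[of f g])

lemma det_ident [simp]: "A \<in> obj C \<Longrightarrow> det (ident C A)"
  by (simp add: det_def copy_eq_pair)

lemma det_cmp:
  assumes "det p" "det q" "src C q = tgt C p"
  shows "det (q \<cdot> p)"
proof -
  note [simp] = det_arr[OF assms(1)] det_arr[OF assms(2)] assms(3)
  have "copy C (tgt C q) \<cdot> q \<cdot> p = (copy C (tgt C q) \<cdot> q) \<cdot> p" by simp
  also have "\<dots> = pair q q \<cdot> p" using assms(2) by (simp only: det_def)
  also have "\<dots> = pair (q \<cdot> p) (q \<cdot> p)" by (simp add: pair_cmp_det[OF assms(1)])
  finally show ?thesis by (simp add: det_def)
qed

lemma det_pair:
  assumes "det p" "det q" "src C p = src C q"
  shows "det (pair p q)"
proof -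
  note [simp] = det_arr[OF assms(1)] det_arr[OF assms(2)] assms(3)
  have "copy C (tgt C p) \<cdot> p = pair p p" "copy C (tgt C q) \<cdot> q = pair q q"
    using assms by (auto simp: det_def)
  then show ?thesis by (simp add: det_def copy_tobj_pair)
qed

lemma det_del [simp]: "A \<in> obj C \<Longrightarrow> det (del C A)"
  by (auto simp: det_def intro: to_tunit_tunit_eq)

text \<open>Obtained from \<open>copy_tobj\<close> and naturality of the interchange rather than
  from \<open>det_pair\<close>: writing a tensor as a pairing involves the projections, whose
  determinism rests on this lemma.\<close>

lemma det_tarr:
  assumes "det p" "det q"
  shows "det (p \<otimes> q)"
proof -
  note [simp] = det_arr[OF assms(1)] det_arr[OF assms(2)]
  let ?A = "src C p" and ?B = "src C q"
  have "copy C (tgt C p \<otimes>\<^sub>o tgt C q) \<cdot> (p \<otimes> q)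
      = interchange C (tgt C p) (tgt C p) (tgt C q) (tgt C q)
          \<cdot> ((copy C (tgt C p) \<cdot> p) \<otimes> (copy C (tgt C q) \<cdot> q))"
    by (simp add: copy_tobj tarr_cmp_simp)
  also have "\<dots> = interchange C (tgt C p) (tgt C p) (tgt C q) (tgt C q)
          \<cdot> (pair p p \<otimes> pair q q)"
    using assms by (simp add: det_def)
  also have "\<dots> = (interchange C (tgt C p) (tgt C p) (tgt C q) (tgt C q)
          \<cdot> ((p \<otimes> p) \<otimes> (q \<otimes> q))) \<cdot> (copy C ?A \<otimes> copy C ?B)"
    by (simp add: pair_def tarr_cmp_simp)
  also have "\<dots> = ((p \<otimes> q) \<otimes> (p \<otimes> q)) \<cdot> copy C (?A \<otimes>\<^sub>o ?B)"
    by (subst interchange_nat) (simp_all add: copy_tobj)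
  also have "\<dots> = pair (p \<otimes> q) (p \<otimes> q)"
    by (simp add: pair_def)
  finally show ?thesis by (simp add: det_def)
qed

text \<open>After precomposition with p, both copying after q and the pairing of q with itself
  become \<open>copy\<close> on the source of p; then p is cancelled on the right.\<close>

lemma det_inverse:
  assumes "det p" "inverse_arrows C p q"
  shows "det q"
proof -
  have [simp]: "p \<in> arr C" "q \<in> arr C" "src C q = tgt C p" "tgt C q = src C p"
    and qp: "q \<cdot> p = ident C (src C p)" and pq: "p \<cdot> q = ident C (tgt C p)"
    using assms by (auto simp: inverse_arrows_def hom_iff)
  have iso: "iso C p" using assms by (auto simp: iso_def)
  have "(copy C (src C p) \<cdot> q) \<cdot> p = pair q q \<cdot> p"
    by (simp add: qp pair_cmp_det[OF assms(1)] copy_eq_pair)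
  then have "copy C (src C p) \<cdot> q = pair q q"
    by (rule iso_right_cancel[OF iso, rotated -1]) simp_all
  then show ?thesis by (simp add: det_def)
qed

lemma det_inv_arr: "det p \<Longrightarrow> iso C p \<Longrightarrow> det (inv_arr C p)"
  using det_inverse inverse_arrows_inv_arr by blast

text \<open>The counit law makes the pairing of identity and discard a right inverse of the unitor;
  as the unitor is invertible, it is the inverse. The pairing is deterministic, and determinism
  passes to its inverse.\<close>

lemma det_runit [simp]:
  assumes "A \<in> obj C"
  shows "det (runit C A)"
proof (rule det_inverse)
  show "det (pair (ident C A) (del C A))" using assms by (simp add: det_pair)
  have "pair (ident C A) (del C A) \<cdot> runit C A = ident C (A \<otimes>\<^sub>o tunit C)"
  proof -
    have 1: "runit C A \<cdot> pair (ident C A) (del C A) = ident C A" using assms by simp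
    have "inv_arr C (runit C A) = inv_arr C (runit C A) \<cdot> (runit C A \<cdot> pair (ident C A) (del C A))"
      unfolding 1 using assms inv_arr_simps[of "runit C A"] by simp
    also have "\<dots> = pair (ident C A) (del C A)"
      by (rule inv_arr_cancel) (use assms in auto)
    finally show ?thesis using inv_arr_simps(4)[of "runit C A"] assms by simp
  qed
  then show "inverse_arrows C (pair (ident C A) (del C A)) (runit C A)"
    using assms by (simp add: inverse_arrows_def hom_iff)
qed

lemma det_lunit [simp]:
  assumes "A \<in> obj C"
  shows "det (lunit C A)"
proof (rule det_inverse)
  show "det (pair (del C A) (ident C A))" using assms by (simp add: det_pair)
  have "pair (del C A) (ident C A) \<cdot> lunit C A = ident C (tunit C \<otimes>\<^sub>o A)"
  proof -
    have 1: "lunit C A \<cdot> pair (del C A) (ident C A) = ident C A" using assms by simp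
    have "inv_arr C (lunit C A) = inv_arr C (lunit C A) \<cdot> (lunit C A \<cdot> pair (del C A) (ident C A))"
      unfolding 1 using assms inv_arr_simps[of "lunit C A"] by simp
    also have "\<dots> = pair (del C A) (ident C A)"
      by (rule inv_arr_cancel) (use assms in auto)
    finally show ?thesis using inv_arr_simps(4)[of "lunit C A"] assms by simp
  qed
  then show "inverse_arrows C (pair (del C A) (ident C A)) (lunit C A)"
    using assms by (simp add: inverse_arrows_def hom_iff)
qed

definition proj1 :: "'a \<Rightarrow> 'a \<Rightarrow> 'b" where
  "proj1 A B = runit C A \<cdot> (ident C A \<otimes> del C B)"

definition proj2 :: "'a \<Rightarrow> 'a \<Rightarrow> 'b" where
  "proj2 A B = lunit C B \<cdot> (del C A \<otimes> ident C B)"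

lemma proj_simps [simp]:
  assumes "A \<in> obj C" "B \<in> obj C"
  shows "proj1 A B \<in> arr C" "src C (proj1 A B) = A \<otimes>\<^sub>o B" "tgt C (proj1 A B) = A" "det (proj1 A B)"
    "proj2 A B \<in> arr C" "src C (proj2 A B) = A \<otimes>\<^sub>o B" "tgt C (proj2 A B) = B" "det (proj2 A B)"
  using assms by (auto simp: proj1_def proj2_def det_tarr intro!: det_cmp)

lemma proj_pair [simp]:
  assumes "f \<in> arr C" "g \<in> arr C" "src C f = src C g" "tgt C f = A" "tgt C g = B"
  shows "proj1 A B \<cdot> pair f g = f" "proj2 A B \<cdot> pair f g = g"
proof -
  have [simp]: "A \<in> obj C" "B \<in> obj C" using assms by auto
  show "proj1 A B \<cdot> pair f g = f" "proj2 A B \<cdot> pair f g = g"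
    using assms by (simp_all add: proj1_def proj2_def)
qed

text \<open>Copying A and B together interchanges their copies, and the projections discard one copy
  of each. Naturality of the interchange performs the discards first, where the counit laws for A
  and B apply separately. What remains is an interchange of two units, which is the
  identity.\<close>

lemma pair_proj [simp]:
  assumes [simp]: "A \<in> obj C" "B \<in> obj C"
  shows "pair (proj1 A B) (proj2 A B) = ident C (A \<otimes>\<^sub>o B)"
proof -
  let ?I = "tunit C"
  have [simp]: "swap C ?I ?I = ident C (?I \<otimes>\<^sub>o ?I)"
    by (rule to_tunit_tunit_eq) simp_all
  have int: "interchange C A ?I ?I B = ident C ((A \<otimes>\<^sub>o ?I) \<otimes>\<^sub>o (?I \<otimes>\<^sub>o B))"
    by (simp add: interchange_def)
  have "pair (proj1 A B) (proj2 A B)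
      = (runit C A \<otimes> lunit C B) \<cdot> ((ident C A \<otimes> del C B) \<otimes> (del C A \<otimes> ident C B)) \<cdot> copy C (A \<otimes>\<^sub>o B)"
    by (simp add: pair_def proj1_def proj2_def tarr_cmp_cmp)
  also have "\<dots> = (runit C A \<otimes> lunit C B) \<cdot>
      (((ident C A \<otimes> del C B) \<otimes> (del C A \<otimes> ident C B)) \<cdot> interchange C A A B B) \<cdot> (copy C A \<otimes> copy C B)"
    by (simp add: copy_tobj)
  also have "((ident C A \<otimes> del C B) \<otimes> (del C A \<otimes> ident C B)) \<cdot> interchange C A A B B
      = interchange C A ?I ?I B \<cdot> ((ident C A \<otimes> del C A) \<otimes> (del C B \<otimes> ident C B))"
    using interchange_nat[of "ident C A" "del C A" "del C B" "ident C B"] by simp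
  also have "(runit C A \<otimes> lunit C B) \<cdot> (interchange C A ?I ?I B
        \<cdot> ((ident C A \<otimes> del C A) \<otimes> (del C B \<otimes> ident C B))) \<cdot> (copy C A \<otimes> copy C B)
      = (runit C A \<cdot> (ident C A \<otimes> del C A) \<cdot> copy C A) \<otimes> (lunit C B \<cdot> (del C B \<otimes> ident C B) \<cdot> copy C B)"
    by (simp add: int tarr_cmp_simp)
  also have "\<dots> = ident C (A \<otimes>\<^sub>o B)"
    by (simp add: copy_counit_left copy_counit_right)
  finally show ?thesis .
qed

text \<open>Surjective pairing for deterministic f. For a general f the two marginals lose the
  correlation between the outputs.\<close>

lemma pair_proj_cmp:
  assumes "det f" "tgt C f = A \<otimes>\<^sub>o B" "A \<in> obj C" "B \<in> obj C"
  shows "pair (proj1 A B \<cdot> f) (proj2 A B \<cdot> f) = f"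
  using pair_cmp_det[of f "proj1 A B" "proj2 A B"] assms det_arr[OF assms(1)] by simp

lemma tarr_eq_pair:
  assumes "f \<in> arr C" "g \<in> arr C"
  shows "f \<otimes> g = pair (f \<cdot> proj1 (src C f) (src C g)) (g \<cdot> proj2 (src C f) (src C g))"
proof -
  have "pair (f \<cdot> proj1 (src C f) (src C g)) (g \<cdot> proj2 (src C f) (src C g))
      = (f \<otimes> g) \<cdot> pair (proj1 (src C f) (src C g)) (proj2 (src C f) (src C g))"
    using assms by (intro tarr_pair[symmetric]) simp_all
  then show ?thesis using assms by simp
qed

text \<open>Expressing the associator through projections yields its determinism without any
  coherence argument.\<close>

lemma assoc_eq_pair:
  assumes "A \<in> obj C" "B \<in> obj C" "D \<in> obj C"
  shows "assoc C A B D = pair (proj1 A B \<cdot> proj1 (A \<otimes>\<^sub>o B) D)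
    (pair (proj2 A B \<cdot> proj1 (A \<otimes>\<^sub>o B) D) (proj2 (A \<otimes>\<^sub>o B) D))"
proof -
  have "assoc C A B D = assoc C A B D \<cdot> pair (proj1 (A \<otimes>\<^sub>o B) D) (proj2 (A \<otimes>\<^sub>o B) D)"
    using assms by simp
  also have "proj1 (A \<otimes>\<^sub>o B) D = pair (proj1 A B \<cdot> proj1 (A \<otimes>\<^sub>o B) D) (proj2 A B \<cdot> proj1 (A \<otimes>\<^sub>o B) D)"
    using assms by (simp add: pair_proj_cmp)
  finally show ?thesis using assms by simp
qed

lemma det_assoc [simp]:
  assumes "A \<in> obj C" "B \<in> obj C" "D \<in> obj C"
  shows "det (assoc C A B D)"
  unfolding assoc_eq_pair[OF assms] using assms by (auto intro!: det_pair det_cmp)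

text \<open>The pairing distributes although k need not be deterministic: rewritten as
  \<open>copy C A \<otimes> ident C B\<close> followed by q on the right, it copies only the first
  component. That component is the deterministic p, while k is used once, inside q.\<close>

lemma pair_proj1_cmp_pair:
  assumes "det p" "k \<in> arr C" "src C p = src C k" "q \<in> arr C" "tgt C p = A" "tgt C k = B"
    "src C q = A \<otimes>\<^sub>o B"
  shows "pair (proj1 A B) q \<cdot> pair p k = pair p (q \<cdot> pair p k)"
proof -
  have [simp]: "p \<in> arr C" "A \<in> obj C" "B \<in> obj C" "src C p = src C k" "tgt C p = A" "tgt C k = B" "k \<in> arr C"
    using assms det_arr by auto
  have "copy C A \<otimes> ident C B = pair (copy C A \<cdot> proj1 A B) (proj2 A B)"
    by (simp add: tarr_eq_pair)
  also have "copy C A \<cdot> proj1 A B = pair (proj1 A B) (proj1 A B)"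
    by (simp add: copy_eq_pair pair_cmp_det)
  finally have "assoc C A A B \<cdot> (copy C A \<otimes> ident C B) = pair (proj1 A B) (ident C (A \<otimes>\<^sub>o B))"
    by simp
  then have "pair (proj1 A B) q = (ident C A \<otimes> q) \<cdot> assoc C A A B \<cdot> (copy C A \<otimes> ident C B)"
    using assms by simp
  then have "pair (proj1 A B) q \<cdot> pair p k
      = (ident C A \<otimes> q) \<cdot> assoc C A A B \<cdot> (copy C A \<otimes> ident C B) \<cdot> pair p k"
    using assms by simp
  also have "(copy C A \<otimes> ident C B) \<cdot> pair p k = pair (pair p p) k"
    using assms by (simp add: det_def)
  finally show ?thesis using assms by simp
qed

end

section \<open>The category of lists of variables\<close>

locale variable_markov_category = markov_category C
  for C :: "('o, 'a, 'z) mcat_scheme" (structure) +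
  fixes \<theta> :: "'v \<Rightarrow> 'o"
  assumes theta_obj [simp]: "\<theta> x \<in> obj C"
begin

abbreviation "T \<equiv> tprod C \<theta>"
abbreviation "\<alpha> \<equiv> tprod_append C \<theta>"
abbreviation "\<alpha>' xs ys \<equiv> inv_arr C (tprod_append C \<theta> xs ys)"

lemma tprod_obj [simp]: "T xs \<in> obj C"
  by (induction xs) simp_all

lemma append_iso_simps [simp]:
  "\<alpha> xs ys \<in> arr C" "src C (\<alpha> xs ys) = T xs \<otimes>\<^sub>o T ys" "tgt C (\<alpha> xs ys) = T (xs @ ys)"
  by (induction xs) simp_all

lemma iso_append_iso [simp]: "iso C (\<alpha> xs ys)"
  by (induction xs) (simp_all add: iso_cmp iso_tarr)

lemma det_append_iso [simp]: "det (\<alpha> xs ys)"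
  by (induction xs) (simp_all add: det_cmp det_tarr)

lemma append_inv_simps [simp]:
  "\<alpha>' xs ys \<in> arr C" "src C (\<alpha>' xs ys) = T (xs @ ys)" "tgt C (\<alpha>' xs ys) = T xs \<otimes>\<^sub>o T ys"
  "\<alpha>' xs ys \<cdot> \<alpha> xs ys = ident C (T xs \<otimes>\<^sub>o T ys)" "\<alpha> xs ys \<cdot> \<alpha>' xs ys = ident C (T (xs @ ys))"
  "h \<in> arr C \<Longrightarrow> tgt C h = T xs \<otimes>\<^sub>o T ys \<Longrightarrow> \<alpha>' xs ys \<cdot> \<alpha> xs ys \<cdot> h = h"
  "h \<in> arr C \<Longrightarrow> tgt C h = T (xs @ ys) \<Longrightarrow> \<alpha> xs ys \<cdot> \<alpha>' xs ys \<cdot> h = h"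
  "det (\<alpha>' xs ys)"
  by (simp_all add: inv_arr_simps inv_arr_cancel det_inv_arr)

text \<open>The induction peels the head off xs by splitting f into its two projections, which is
  sound for deterministic f by \<open>pair_proj_cmp\<close>.\<close>

lemma append_iso_assoc_det:
  assumes "det f" "g \<in> arr C" "h \<in> arr C" "src C f = src C h" "src C g = src C h"
    "tgt C f = T xs" "tgt C g = T ys" "tgt C h = T zs"
  shows "\<alpha> (xs @ ys) zs \<cdot> pair (\<alpha> xs ys \<cdot> pair f g) h = \<alpha> xs (ys @ zs) \<cdot> pair f (\<alpha> ys zs \<cdot> pair g h)"
  using assms
proof (induction xs arbitrary: f)
  case Nil
  then show ?case by (simp add: det_arr)
next
  case (Cons x xs)
  let ?f1 = "proj1 (\<theta> x) (T xs) \<cdot> f" and ?f2 = "proj2 (\<theta> x) (T xs) \<cdot> f"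
  have f [simp]: "f \<in> arr C" "src C f = src C h" "tgt C f = \<theta> x \<otimes>\<^sub>o T xs"
    using Cons.prems by (auto simp: det_arr)
  have "det ?f2" using Cons.prems by (intro det_cmp) simp_all
  then have IH: "\<alpha> (xs @ ys) zs \<cdot> pair (\<alpha> xs ys \<cdot> pair ?f2 g) h
      = \<alpha> xs (ys @ zs) \<cdot> pair ?f2 (\<alpha> ys zs \<cdot> pair g h)"
    using Cons.prems by (intro Cons.IH) simp_all
  have feq: "f = pair ?f1 ?f2" using Cons.prems by (simp add: pair_proj_cmp)
  have "\<alpha> ((x # xs) @ ys) zs \<cdot> pair (\<alpha> (x # xs) ys \<cdot> pair (pair ?f1 ?f2) g) h
      = \<alpha> (x # xs) (ys @ zs) \<cdot> pair (pair ?f1 ?f2) (\<alpha> ys zs \<cdot> pair g h)"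
    using Cons.prems IH by simp
  then show ?case by (simp only: feq[symmetric])
qed

text \<open>The deterministic case is applied to the three projections out of the product of A, B
  and D. Their pairing is the identity, so an equation between the canonical isomorphisms themselves
  results, and this may be precomposed with any pairing.\<close>

lemma append_iso_assoc:
  assumes "f \<in> arr C" "g \<in> arr C" "h \<in> arr C" "src C f = src C h" "src C g = src C h"
    "tgt C f = T xs" "tgt C g = T ys" "tgt C h = T zs"
  shows "\<alpha> (xs @ ys) zs \<cdot> pair (\<alpha> xs ys \<cdot> pair f g) h = \<alpha> xs (ys @ zs) \<cdot> pair f (\<alpha> ys zs \<cdot> pair g h)"
proof -
  let ?A = "T xs" and ?B = "T ys" and ?D = "T zs"
  let ?r1 = "proj1 (?A \<otimes>\<^sub>o ?B) ?D" and ?r2 = "proj2 (?A \<otimes>\<^sub>o ?B) ?D"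
  let ?p = "proj1 ?A ?B \<cdot> ?r1" and ?q = "proj2 ?A ?B \<cdot> ?r1"
  let ?E = "\<alpha> (xs @ ys) zs \<cdot> (\<alpha> xs ys \<otimes> ident C ?D)"
  let ?E' = "\<alpha> xs (ys @ zs) \<cdot> (ident C ?A \<otimes> \<alpha> ys zs) \<cdot> assoc C ?A ?B ?D"
  have id: "pair (pair ?p ?q) ?r2 = ident C ((?A \<otimes>\<^sub>o ?B) \<otimes>\<^sub>o ?D)"
    by (simp add: pair_proj_cmp)
  have "?E = ?E \<cdot> pair (pair ?p ?q) ?r2" unfolding id by simp
  also have "\<dots> = \<alpha> (xs @ ys) zs \<cdot> pair (\<alpha> xs ys \<cdot> pair ?p ?q) ?r2" by simp
  also have "\<dots> = \<alpha> xs (ys @ zs) \<cdot> pair ?p (\<alpha> ys zs \<cdot> pair ?q ?r2)"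
    by (rule append_iso_assoc_det) (simp_all add: det_cmp)
  also have "\<dots> = ?E' \<cdot> pair (pair ?p ?q) ?r2" by simp
  also have "\<dots> = ?E'" unfolding id by simp
  finally have "?E \<cdot> pair (pair f g) h = ?E' \<cdot> pair (pair f g) h" by simp
  then show ?thesis using assms by simp
qed

lemma append_iso_Nil_det:
  assumes "det f" "g \<in> arr C" "src C f = src C g" "tgt C f = T xs" "tgt C g = tunit C"
  shows "\<alpha> xs [] \<cdot> pair f g = f"
  using assms
proof (induction xs arbitrary: f)
  case Nil
  then have "f \<in> arr C" by (simp add: det_arr)
  then show ?case using Nil to_tunit_eq_del[of f] to_tunit_eq_del[of g] by simp
next
  case (Cons x xs)
  let ?f1 = "proj1 (\<theta> x) (T xs) \<cdot> f" and ?f2 = "proj2 (\<theta> x) (T xs) \<cdot> f"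
  have f [simp]: "f \<in> arr C" "src C f = src C g" "tgt C f = \<theta> x \<otimes>\<^sub>o T xs"
    using Cons.prems by (auto simp: det_arr)
  have "det ?f2" using Cons.prems by (intro det_cmp) simp_all
  then have IH: "\<alpha> xs [] \<cdot> pair ?f2 g = ?f2"
    using Cons.prems by (intro Cons.IH) simp_all
  have feq: "f = pair ?f1 ?f2" using Cons.prems by (simp add: pair_proj_cmp)
  have "\<alpha> (x # xs) [] \<cdot> pair (pair ?f1 ?f2) g = pair ?f1 ?f2"
    using Cons.prems IH by simp
  then show ?case by (simp only: feq[symmetric])
qed

lemma append_iso_Nil: "\<alpha> xs [] = proj1 (T xs) (tunit C)"
  using append_iso_Nil_det[of "proj1 (T xs) (tunit C)" "proj2 (T xs) (tunit C)" xs] by simp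

section \<open>Arrows of the list category, computed on their underlying morphisms\<close>

abbreviation "D \<equiv> list_cat C \<theta>"

abbreviation dcmp (infixr "\<bullet>" 60) where "g \<bullet> f \<equiv> cmp D g f"
abbreviation dtarr (infixr "\<odot>" 70) where "f \<odot> g \<equiv> tarr D f g"

definition dpair ("\<langle>_, _\<rangle>") where
  "\<langle>f, g\<rangle> = (f \<odot> g) \<bullet> copy D (src D f)"

abbreviation "pi1 xs ys \<equiv> ident D xs \<odot> del D ys"
abbreviation "pi2 xs ys \<equiv> del D xs \<odot> ident D ys"

text \<open>\<open>fst (snd p)\<close> is the morphism of C carried by the triple p. Determinism is
  tested there, and the laws of pairings are likewise transported one by one from C through the
  triple form.\<close>

definition ddet where
  "ddet p \<longleftrightarrow> p \<in> arr D \<and> det (fst (snd p))"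

lemma list_cat_triple:
  "src D (xs, f, ys) = xs" "tgt D (xs, f, ys) = ys"
  "(xs, f, ys) \<in> arr D \<longleftrightarrow> f \<in> arr C \<and> src C f = T xs \<and> tgt C f = T ys"
  "(ys', g, zs) \<bullet> (xs, f, ys) = (xs, g \<cdot> f, zs)"
  "(xs, f, ys) \<odot> (us, g, vs) = (xs @ us, \<alpha> ys vs \<cdot> (f \<otimes> g) \<cdot> \<alpha>' xs us, ys @ vs)"
  "ident D xs = (xs, ident C (T xs), xs)"
  "copy D xs = (xs, \<alpha> xs xs \<cdot> copy C (T xs), xs @ xs)"
  "del D xs = (xs, del C (T xs), [])"
  "swap D xs ys = (xs @ ys, \<alpha> ys xs \<cdot> swap C (T xs) (T ys) \<cdot> \<alpha>' xs ys, ys @ xs)"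
  by (simp_all add: list_cat_def hom_def)

lemma dpair_triple:
  assumes "f \<in> arr C" "g \<in> arr C" "src C f = T xs" "src C g = T xs" "tgt C f = T ys" "tgt C g = T zs"
  shows "\<langle>(xs, f, ys), (xs, g, zs)\<rangle> = (xs, \<alpha> ys zs \<cdot> pair f g, ys @ zs)"
  using assms by (simp add: dpair_def list_cat_triple pair_def)

lemma pi1_triple: "pi1 xs ys = (xs @ ys, proj1 (T xs) (T ys) \<cdot> \<alpha>' xs ys, xs)"
  by (simp add: list_cat_triple append_iso_Nil tarr_cmp_cmp proj1_def)

lemma pi2_triple: "pi2 xs ys = (xs @ ys, proj2 (T xs) (T ys) \<cdot> \<alpha>' xs ys, ys)"
  by (simp add: list_cat_triple proj2_def)

lemma ddet_triple: "ddet (xs, f, ys) \<longleftrightarrow> det f \<and> src C f = T xs \<and> tgt C f = T ys"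
  by (auto simp: ddet_def list_cat_triple det_arr)

lemmas triple_simps = list_cat_triple dpair_triple pi1_triple pi2_triple ddet_triple

lemma list_cat_src_tgt [simp]:
  "src D (g \<bullet> f) = src D f" "tgt D (g \<bullet> f) = tgt D g"
  "src D (f \<odot> g) = src D f @ src D g" "tgt D (f \<odot> g) = tgt D f @ tgt D g"
  "src D (ident D xs) = xs" "tgt D (ident D xs) = xs"
  "src D (copy D xs) = xs" "tgt D (copy D xs) = xs @ xs"
  "src D (del D xs) = xs" "tgt D (del D xs) = []"
  "src D (swap D xs ys) = xs @ ys" "tgt D (swap D xs ys) = ys @ xs"
  "src D \<langle>f, g\<rangle> = src D f" "tgt D \<langle>f, g\<rangle> = tgt D f @ tgt D g"
  by (cases f; cases g; simp add: triple_simps dpair_def)+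

lemma list_cat_arr [simp]:
  "f \<in> arr D \<Longrightarrow> g \<in> arr D \<Longrightarrow> src D g = tgt D f \<Longrightarrow> g \<bullet> f \<in> arr D"
  "f \<in> arr D \<Longrightarrow> g \<in> arr D \<Longrightarrow> f \<odot> g \<in> arr D"
  "f \<in> arr D \<Longrightarrow> g \<in> arr D \<Longrightarrow> src D f = src D g \<Longrightarrow> \<langle>f, g\<rangle> \<in> arr D"
  "ident D xs \<in> arr D" "copy D xs \<in> arr D" "del D xs \<in> arr D" "swap D xs ys \<in> arr D"
  by (cases f; cases g; simp add: triple_simps)+

lemma dcmp_ident [simp]:
  "f \<in> arr D \<Longrightarrow> src D f = xs \<Longrightarrow> f \<bullet> ident D xs = f"
  "f \<in> arr D \<Longrightarrow> tgt D f = xs \<Longrightarrow> ident D xs \<bullet> f = f"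
  by (cases f; simp add: triple_simps)+

lemma dcmp_assoc [simp]:
  "f \<in> arr D \<Longrightarrow> g \<in> arr D \<Longrightarrow> h \<in> arr D \<Longrightarrow> src D g = tgt D f \<Longrightarrow> src D h = tgt D g \<Longrightarrow>
    (h \<bullet> g) \<bullet> f = h \<bullet> g \<bullet> f"
  by (cases f; cases g; cases h; simp add: triple_simps)

text \<open>Strict associativity of pairing: the canonical isomorphisms absorb the associator of C
  by \<open>append_iso_assoc\<close>. From here on the non-strictness of C is invisible in nested
  pairings.\<close>

lemma dpair_dpair [simp]:
  "f \<in> arr D \<Longrightarrow> g \<in> arr D \<Longrightarrow> h \<in> arr D \<Longrightarrow> src D f = src D h \<Longrightarrow> src D g = src D h \<Longrightarrow>
    \<langle>\<langle>f, g\<rangle>, h\<rangle> = \<langle>f, \<langle>g, h\<rangle>\<rangle>"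
  by (cases f; cases g; cases h; simp add: triple_simps append_iso_assoc)

lemma dpair_unit [simp]:
  "f \<in> arr D \<Longrightarrow> g \<in> arr D \<Longrightarrow> src D f = src D g \<Longrightarrow> tgt D f = [] \<Longrightarrow> \<langle>f, g\<rangle> = g"
  "f \<in> arr D \<Longrightarrow> g \<in> arr D \<Longrightarrow> src D f = src D g \<Longrightarrow> tgt D g = [] \<Longrightarrow> \<langle>f, g\<rangle> = f"
  by (cases f; cases g; simp add: triple_simps append_iso_Nil)+

lemma eq_del_if_tgt_Nil: "f \<in> arr D \<Longrightarrow> tgt D f = [] \<Longrightarrow> f = del D (src D f)"
  by (cases f; simp add: triple_simps; metis to_tunit_eq_del)

lemma dtarr_dpair [simp]:
  "f \<in> arr D \<Longrightarrow> g \<in> arr D \<Longrightarrow> h \<in> arr D \<Longrightarrow> k \<in> arr D \<Longrightarrow> src D f = src D g \<Longrightarrow>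
    src D h = tgt D f \<Longrightarrow> src D k = tgt D g \<Longrightarrow> (h \<odot> k) \<bullet> \<langle>f, g\<rangle> = \<langle>h \<bullet> f, k \<bullet> g\<rangle>"
  by (cases f; cases g; cases h; cases k; simp add: triple_simps)

lemma dpair_pi [simp]: "\<langle>pi1 xs ys, pi2 xs ys\<rangle> = ident D (xs @ ys)"
proof -
  have "pair (proj1 (T xs) (T ys) \<cdot> \<alpha>' xs ys) (proj2 (T xs) (T ys) \<cdot> \<alpha>' xs ys) = \<alpha>' xs ys"
    by (rule pair_proj_cmp) simp_all
  then show ?thesis by (simp only: pi1_triple pi2_triple) (simp add: triple_simps)
qed

lemma ddet_pi [simp]: "ddet (pi1 xs ys)" "ddet (pi2 xs ys)"
  unfolding pi1_triple pi2_triple by (simp_all add: ddet_triple det_cmp)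

lemma ddet_ident [simp]: "ddet (ident D xs)"
  and ddet_del [simp]: "ddet (del D xs)"
  by (simp_all add: triple_simps)

lemma ddet_dcmp: "ddet p \<Longrightarrow> ddet q \<Longrightarrow> src D q = tgt D p \<Longrightarrow> ddet (q \<bullet> p)"
  by (cases p; cases q; simp add: triple_simps det_cmp det_arr)

lemma ddet_dpair: "ddet p \<Longrightarrow> ddet q \<Longrightarrow> src D p = src D q \<Longrightarrow> ddet \<langle>p, q\<rangle>"
  by (cases p; cases q; simp add: triple_simps det_cmp det_pair det_arr)

lemma dpair_dcmp_ddet:
  "ddet p \<Longrightarrow> f \<in> arr D \<Longrightarrow> g \<in> arr D \<Longrightarrow> src D f = tgt D p \<Longrightarrow> src D g = tgt D p \<Longrightarrow>
    \<langle>f, g\<rangle> \<bullet> p = \<langle>f \<bullet> p, g \<bullet> p\<rangle>"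
  by (cases p; cases f; cases g; simp add: triple_simps det_arr pair_cmp_det)

lemma pi_dpair [simp]:
  assumes "f \<in> arr D" "g \<in> arr D" "src D f = src D g" "tgt D f = xs" "tgt D g = ys"
  shows "pi1 xs ys \<bullet> \<langle>f, g\<rangle> = f" "pi2 xs ys \<bullet> \<langle>f, g\<rangle> = g"
  using assms by simp_all

text \<open>Transport of \<open>pair_proj1_cmp_pair\<close>. The canonical isomorphism is
  deterministic, so it passes inside the pairing and cancels the inverse contained in
  \<open>pi1\<close> before that lemma applies.\<close>

lemma dpair_pi1_dcmp_dpair:
  assumes "ddet p" "k \<in> arr D" "src D p = src D k" "q \<in> arr D" "tgt D p = xs" "tgt D k = ys"
    "src D q = xs @ ys"
  shows "\<langle>pi1 xs ys, q\<rangle> \<bullet> \<langle>p, k\<rangle> = \<langle>p, q \<bullet> \<langle>p, k\<rangle>\<rangle>"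
proof -
  obtain zs p' where p: "p = (zs, p', xs)" using assms by (cases p) (simp add: triple_simps)
  obtain k' where k: "k = (zs, k', ys)" using assms p by (cases k) (simp add: triple_simps)
  obtain q' us where q: "q = (xs @ ys, q', us)" using assms by (cases q) (simp add: triple_simps)
  note [simp] = det_arr
  have C: "det p'" "src C p' = T zs" "tgt C p' = T xs" "k' \<in> arr C" "src C k' = T zs" "tgt C k' = T ys"
    "q' \<in> arr C" "src C q' = T (xs @ ys)" "tgt C q' = T us"
    using assms by (auto simp: p k q triple_simps)
  have "pair (proj1 (T xs) (T ys) \<cdot> \<alpha>' xs ys) q' \<cdot> \<alpha> xs ys \<cdot> pair p' k'
      = pair (proj1 (T xs) (T ys)) (q' \<cdot> \<alpha> xs ys) \<cdot> pair p' k'"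
  proof -
    have "pair (proj1 (T xs) (T ys) \<cdot> \<alpha>' xs ys) q' \<cdot> \<alpha> xs ys \<cdot> pair p' k'
      = (pair (proj1 (T xs) (T ys) \<cdot> \<alpha>' xs ys) q' \<cdot> \<alpha> xs ys) \<cdot> pair p' k'"
      using C by simp
    also have "pair (proj1 (T xs) (T ys) \<cdot> \<alpha>' xs ys) q' \<cdot> \<alpha> xs ys
      = pair (proj1 (T xs) (T ys)) (q' \<cdot> \<alpha> xs ys)"
      using C by (simp add: pair_cmp_det)
    finally show ?thesis .
  qed
  also have "\<dots> = pair p' ((q' \<cdot> \<alpha> xs ys) \<cdot> pair p' k')"
    by (rule pair_proj1_cmp_pair) (use C in simp_all)
  finally show ?thesis
    unfolding p k q pi1_triple using C by (simp add: triple_simps)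
qed

lemma dtarr_eq_dpair:
  assumes "f \<in> arr D" "g \<in> arr D"
  shows "f \<odot> g = \<langle>f \<bullet> pi1 (src D f) (src D g), g \<bullet> pi2 (src D f) (src D g)\<rangle>"
proof -
  have "(f \<odot> g) \<bullet> \<langle>pi1 (src D f) (src D g), pi2 (src D f) (src D g)\<rangle>
     = \<langle>f \<bullet> pi1 (src D f) (src D g), g \<bullet> pi2 (src D f) (src D g)\<rangle>"
    by (rule dtarr_dpair) (use assms in simp_all)
  then show ?thesis using assms by simp
qed

lemma copy_eq_dpair: "copy D xs = \<langle>ident D xs, ident D xs\<rangle>"
  by (simp add: triple_simps copy_eq_pair)

lemma swap_dpair [simp]:
  assumes "f \<in> arr D" "g \<in> arr D" "src D f = src D g" "tgt D f = xs" "tgt D g = ys"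
  shows "swap D xs ys \<bullet> \<langle>f, g\<rangle> = \<langle>g, f\<rangle>"
  using assms by (cases f; cases g; simp add: triple_simps)

text \<open>The assumption on C concerns binary products; the canonical isomorphism for
  \<open>xs @ ys\<close> turns it into a statement about concatenated lists.\<close>

lemma conditional_distribution:
  assumes "has_conditional_distributions C" "s \<in> arr D" "src D s = []" "tgt D s = xs @ ys"
  obtains k where "k \<in> arr D" "src D k = xs" "tgt D k = ys" "s = \<langle>ident D xs, k\<rangle> \<bullet> pi1 xs ys \<bullet> s"
proof -
  obtain s' where s: "s = ([], s', xs @ ys)" using assms by (cases s) (simp add: triple_simps)
  have s' [simp]: "s' \<in> arr C" "src C s' = tunit C" "tgt C s' = T (xs @ ys)"
    using assms by (auto simp: s triple_simps)
  have "\<alpha>' xs ys \<cdot> s' \<in> hom C (tunit C) (T xs \<otimes>\<^sub>o T ys)"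
    by (simp add: hom_iff)
  then obtain k where k: "k \<in> hom C (T xs) (T ys)"
    "\<alpha>' xs ys \<cdot> s' = (ident C (T xs) \<otimes> k) \<cdot> copy C (T xs)
       \<cdot> (runit C (T xs) \<cdot> (ident C (T xs) \<otimes> del C (T ys))) \<cdot> \<alpha>' xs ys \<cdot> s'"
    using assms(1) unfolding has_conditional_distributions_def by (meson tprod_obj)
  have [simp]: "k \<in> arr C" "src C k = T xs" "tgt C k = T ys" using k(1) by (auto simp: hom_iff)
  have "\<alpha>' xs ys \<cdot> s' = pair (ident C (T xs)) k \<cdot> proj1 (T xs) (T ys) \<cdot> \<alpha>' xs ys \<cdot> s'"
    using k(2) by (simp add: pair_def proj1_def)
  then have "\<alpha> xs ys \<cdot> \<alpha>' xs ys \<cdot> s'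
      = \<alpha> xs ys \<cdot> pair (ident C (T xs)) k \<cdot> proj1 (T xs) (T ys) \<cdot> \<alpha>' xs ys \<cdot> s'"
    by simp
  then have "s = \<langle>ident D xs, (xs, k, ys)\<rangle> \<bullet> pi1 xs ys \<bullet> s"
    unfolding s pi1_triple by (simp add: triple_simps)
  then show ?thesis by (intro that[of "(xs, k, ys)"]) (simp_all add: triple_simps)
qed

section \<open>Wirings\<close>

lemma pi_unit [simp]: "pi1 xs [] = ident D xs" "pi2 [] ys = ident D ys"
  using dpair_pi[of xs "[]"] dpair_pi[of "[]" ys] by (simp_all del: dpair_pi)

text \<open>With the identity written as a triple pairing, an equation between arrows out of a
  triple concatenation can be checked by evaluating both sides on that pairing.\<close>

lemma split_append3:
  obtains p q r where "p \<in> arr D" "q \<in> arr D" "r \<in> arr D"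
    "src D p = xs @ ys @ zs" "src D q = xs @ ys @ zs" "src D r = xs @ ys @ zs"
    "tgt D p = xs" "tgt D q = ys" "tgt D r = zs" "ident D (xs @ ys @ zs) = \<langle>p, \<langle>q, r\<rangle>\<rangle>"
proof -
  have "\<langle>pi1 ys zs, pi2 ys zs\<rangle> \<bullet> pi2 xs (ys @ zs) = pi2 xs (ys @ zs)"
    by simp
  then have "\<langle>pi1 ys zs \<bullet> pi2 xs (ys @ zs), pi2 ys zs \<bullet> pi2 xs (ys @ zs)\<rangle> = pi2 xs (ys @ zs)"
    by (simp add: dpair_dcmp_ddet del: dpair_pi)
  then have "\<langle>pi1 xs (ys @ zs), \<langle>pi1 ys zs \<bullet> pi2 xs (ys @ zs), pi2 ys zs \<bullet> pi2 xs (ys @ zs)\<rangle>\<rangle>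
      = ident D (xs @ ys @ zs)"
    by simp
  from this[symmetric] show ?thesis by (rule that[rotated -1]) simp_all
qed

lemma pi_append:
  "pi1 xs ys \<bullet> pi1 (xs @ ys) zs = pi1 xs (ys @ zs)"
  "pi2 ys zs \<bullet> pi2 xs (ys @ zs) = pi2 (xs @ ys) zs"
  "pi1 ys zs \<bullet> pi2 xs (ys @ zs) = pi2 xs ys \<bullet> pi1 (xs @ ys) zs"
proof -
  obtain p q r where pqr: "p \<in> arr D" "q \<in> arr D" "r \<in> arr D"
    "src D p = xs @ ys @ zs" "src D q = xs @ ys @ zs" "src D r = xs @ ys @ zs"
    "tgt D p = xs" "tgt D q = ys" "tgt D r = zs" "ident D (xs @ ys @ zs) = \<langle>p, \<langle>q, r\<rangle>\<rangle>"
    by (rule split_append3)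
  have assoc: "\<langle>p, \<langle>q, r\<rangle>\<rangle> = \<langle>\<langle>p, q\<rangle>, r\<rangle>" using pqr by simp
  have eqI: "f = g" if "f \<in> arr D" "g \<in> arr D" "src D f = xs @ ys @ zs" "src D g = xs @ ys @ zs"
    "f \<bullet> \<langle>p, \<langle>q, r\<rangle>\<rangle> = g \<bullet> \<langle>p, \<langle>q, r\<rangle>\<rangle>" for f g
    using that unfolding pqr(10)[symmetric] by simp
  have 1: "pi1 xs (ys @ zs) \<bullet> \<langle>p, \<langle>q, r\<rangle>\<rangle> = p" "pi2 xs (ys @ zs) \<bullet> \<langle>p, \<langle>q, r\<rangle>\<rangle> = \<langle>q, r\<rangle>"
    by (rule pi_dpair; use pqr in simp)+
  have 2: "pi1 (xs @ ys) zs \<bullet> \<langle>p, \<langle>q, r\<rangle>\<rangle> = \<langle>p, q\<rangle>" "pi2 (xs @ ys) zs \<bullet> \<langle>p, \<langle>q, r\<rangle>\<rangle> = r"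
    unfolding assoc by (rule pi_dpair; use pqr in simp)+
  have 3: "pi1 xs ys \<bullet> \<langle>p, q\<rangle> = p" "pi2 xs ys \<bullet> \<langle>p, q\<rangle> = q" "pi1 ys zs \<bullet> \<langle>q, r\<rangle> = q" "pi2 ys zs \<bullet> \<langle>q, r\<rangle> = r"
    by (rule pi_dpair; use pqr in simp)+
  have cmp: "(h \<bullet> g) \<bullet> \<langle>p, \<langle>q, r\<rangle>\<rangle> = h \<bullet> g \<bullet> \<langle>p, \<langle>q, r\<rangle>\<rangle>"
    if "g \<in> arr D" "h \<in> arr D" "src D g = xs @ ys @ zs" "src D h = tgt D g" for g h
    using that pqr by (intro dcmp_assoc) simp_all
  show "pi1 xs ys \<bullet> pi1 (xs @ ys) zs = pi1 xs (ys @ zs)"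
    by (rule eqI, simp, simp, simp, simp, subst cmp, simp, simp, simp, simp, simp only: 1 2 3)
  show "pi2 ys zs \<bullet> pi2 xs (ys @ zs) = pi2 (xs @ ys) zs"
    by (rule eqI, simp, simp, simp, simp, subst cmp, simp, simp, simp, simp, simp only: 1 2 3)
  show "pi1 ys zs \<bullet> pi2 xs (ys @ zs) = pi2 xs ys \<bullet> pi1 (xs @ ys) zs"
    by (rule eqI, simp, simp, simp, simp, subst cmp, simp, simp, simp, simp,
        subst cmp, simp, simp, simp, simp, simp only: 1 2 3)
qed

text \<open>The projection onto the first occurrence of a name. The value on the empty list is a
  dummy; every lemma about it assumes that the name occurs.\<close>

primrec dproj :: "'v list \<Rightarrow> 'v \<Rightarrow> 'v list \<times> 'a \<times> 'v list" where
  "dproj [] y = undefined"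
| "dproj (x # xs) y = (if x = y then pi1 [x] xs else dproj xs y \<bullet> pi2 [x] xs)"

lemma dproj_simps [simp]:
  assumes "y \<in> set xs"
  shows "dproj xs y \<in> arr D" "src D (dproj xs y) = xs" "tgt D (dproj xs y) = [y]" "ddet (dproj xs y)"
  using assms by (induction xs) (auto simp: ddet_dcmp)

lemma dproj_append_left:
  assumes "y \<in> set xs"
  shows "dproj (xs @ ys) y = dproj xs y \<bullet> pi1 xs ys"
  using assms
proof (induction xs)
  case (Cons x xs)
  show ?case
  proof (cases "x = y")
    case True
    then show ?thesis using pi_append(1)[of "[x]" xs ys] by simp
  next
    case False
    then show ?thesis using Cons pi_append(3)[of xs ys "[x]"] by simp
  qed
qed simp

lemma dproj_append_right:
  assumes "y \<notin> set xs" "y \<in> set ys"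
  shows "dproj (xs @ ys) y = dproj ys y \<bullet> pi2 xs ys"
  using assms
proof (induction xs)
  case (Cons x xs)
  then show ?case using pi_append(2)[of xs ys "[x]"] by auto
qed simp

text \<open>
  The wiring \<open>xs \<rightarrow> ys\<close> that selects, copies and discards variables by name; repetitions in \<open>ys\<close>
  stand for copies.
\<close>

primrec sel :: "'v list \<Rightarrow> 'v list \<Rightarrow> 'v list \<times> 'a \<times> 'v list" where
  "sel xs [] = del D xs"
| "sel xs (y # ys) = \<langle>dproj xs y, sel xs ys\<rangle>"

lemma sel_simps [simp]:
  assumes "set ys \<subseteq> set xs"
  shows "sel xs ys \<in> arr D" "src D (sel xs ys) = xs" "tgt D (sel xs ys) = ys" "ddet (sel xs ys)"
  using assms by (induction ys) (auto simp: ddet_dpair)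

declare sel.simps(2) [simp del]

lemma sel_append:
  assumes "set ys \<subseteq> set xs" "set zs \<subseteq> set xs"
  shows "sel xs (ys @ zs) = \<langle>sel xs ys, sel xs zs\<rangle>"
  using assms by (induction ys) (simp_all add: sel.simps(2))

lemma sel_append_left:
  assumes "set zs \<subseteq> set xs"
  shows "sel (xs @ ys) zs = sel xs zs \<bullet> pi1 xs ys"
  using assms
proof (induction zs)
  case Nil
  then show ?case using eq_del_if_tgt_Nil[of "del D xs \<bullet> pi1 xs ys"] by simp
qed (simp add: sel.simps(2) dproj_append_left dpair_dcmp_ddet)

text \<open>Disjointness matters because \<open>dproj\<close> reads the first occurrence: a name
  that also occurs in xs would be taken from there.\<close>

lemma sel_append_right:
  assumes "set zs \<subseteq> set ys" "set zs \<inter> set xs = {}"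
  shows "sel (xs @ ys) zs = sel ys zs \<bullet> pi2 xs ys"
  using assms
proof (induction zs)
  case Nil
  then show ?case using eq_del_if_tgt_Nil[of "del D ys \<bullet> pi2 xs ys"] by simp
qed (simp add: sel.simps(2) dproj_append_right dpair_dcmp_ddet)

text \<open>With a repeated name, both positions would read its first occurrence; distinctness
  excludes this.\<close>

lemma sel_self [simp]: "distinct xs \<Longrightarrow> sel xs xs = ident D xs"
proof (induction xs)
  case Nil
  then show ?case using eq_del_if_tgt_Nil[of "ident D []"] by simp
next
  case (Cons x xs)
  then have "sel (x # xs) xs = pi2 [x] xs"
    using sel_append_right[of xs xs "[x]"] by simp
  then show ?case using dpair_pi[of "[x]" xs] by (simp add: sel.simps(2))
qed

text \<open>Repetitions of a name in ys are copies of one variable of xs, so it is harmless that the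
  outer projection reads the first of them.\<close>

lemma dproj_sel:
  assumes "y \<in> set ys" "set ys \<subseteq> set xs"
  shows "dproj ys y \<bullet> sel xs ys = dproj xs y"
  using assms by (induction ys) (auto simp: sel.simps(2))

lemma sel_sel [simp]:
  assumes "set zs \<subseteq> set ys" "set ys \<subseteq> set xs"
  shows "sel ys zs \<bullet> sel xs ys = sel xs zs"
  using assms
proof (induction zs)
  case Nil
  then show ?case using eq_del_if_tgt_Nil[of "del D ys \<bullet> sel xs ys"] by simp
next
  case (Cons z zs)
  then have "set zs \<subseteq> set xs" by auto
  then show ?case using Cons by (simp add: sel.simps(2) dpair_dcmp_ddet dproj_sel)
qed

lemma sel_sel_dcmp [simp]:
  assumes "set zs \<subseteq> set ys" "set ys \<subseteq> set xs" "f \<in> arr D" "tgt D f = xs"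
  shows "sel ys zs \<bullet> sel xs ys \<bullet> f = sel xs zs \<bullet> f"
proof -
  have "set zs \<subseteq> set xs" using assms by auto
  then have "(sel ys zs \<bullet> sel xs ys) \<bullet> f = sel ys zs \<bullet> sel xs ys \<bullet> f"
    using assms by (intro dcmp_assoc) simp_all
  then show ?thesis by (simp only: sel_sel[OF assms(1,2)])
qed

lemma sel_dtarr_sel:
  assumes "set us \<subseteq> set xs" "set vs \<subseteq> set ys" "set vs \<inter> set xs = {}"
  shows "sel xs us \<odot> sel ys vs = sel (xs @ ys) (us @ vs)"
proof -
  have "sel (xs @ ys) (us @ vs) = \<langle>sel (xs @ ys) us, sel (xs @ ys) vs\<rangle>"
    using assms by (intro sel_append) auto
  then show ?thesis
    using assms by (subst dtarr_eq_dpair) (simp_all add: sel_append_left sel_append_right)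
qed

lemma swap_eq_sel:
  assumes "distinct (xs @ ys)"
  shows "swap D xs ys = sel (xs @ ys) (ys @ xs)"
proof -
  have "sel (xs @ ys) (ys @ xs) = \<langle>sel (xs @ ys) ys, sel (xs @ ys) xs\<rangle>"
    by (intro sel_append) auto
  also have "\<dots> = swap D xs ys \<bullet> \<langle>sel (xs @ ys) xs, sel (xs @ ys) ys\<rangle>"
    by simp
  also have "\<langle>sel (xs @ ys) xs, sel (xs @ ys) ys\<rangle> = sel (xs @ ys) (xs @ ys)"
    by (intro sel_append[symmetric]) auto
  finally show ?thesis using assms by (simp del: distinct_append)
qed

lemma copy_eq_sel: "distinct xs \<Longrightarrow> copy D xs = sel xs (xs @ xs)"
  by (simp add: sel_append copy_eq_dpair)

text \<open>Each round of \<open>rewire\<close> is a tensor of selections, hence one selection by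
  \<open>sel_dtarr_sel\<close>, and it composes with the recursive call by \<open>sel_sel\<close>.
  All rewirings thereby become comparable by names alone.\<close>

lemma rewire_eq_sel:
  assumes "distinct xs" "distinct ys" "set xs = set ys"
  shows "rewire D xs ys = sel xs ys"
  using assms
proof (induction ys arbitrary: xs)
  case Nil
  then show ?case using sel_self[of xs] by simp
next
  case (Cons y ys)
  \<comment> \<open>\<open>as\<close> and \<open>bs\<close> repeat the local definitions inside
    \<open>rewire\<close>, so that its equation can be folded; \<open>as @ bs\<close> is xs without
    y.\<close>
  define as where "as = takeWhile (\<lambda>x. x \<noteq> y) xs"
  define bs where "bs = tl (dropWhile (\<lambda>x. x \<noteq> y) xs)"
  have "y \<in> set xs" using Cons.prems(3) by simp
  then obtain us vs where us: "xs = us @ y # vs" "y \<notin> set us" by (meson split_list_first)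
  then have "takeWhile (\<lambda>x. x \<noteq> y) xs = us" "dropWhile (\<lambda>x. x \<noteq> y) xs = y # vs"
    by (auto simp: takeWhile_append dropWhile_append)
  then have xs: "xs = as @ y # bs" using us by (simp add: as_def bs_def)
  have dist: "distinct as" "distinct bs" "y \<notin> set as" "y \<notin> set bs" "set as \<inter> set bs = {}"
    using Cons.prems by (auto simp: xs)
  have sets: "set ys = set as \<union> set bs" using Cons.prems dist by (auto simp: xs)
  have "rewire D xs (y # ys)
      = (ident D [y] \<odot> rewire D (as @ bs) ys) \<bullet> (swap D as [y] \<odot> ident D bs)"
    by (simp add: Let_def as_def bs_def)
  also have "\<dots> = sel ([y] @ as @ bs) ([y] @ ys) \<bullet> sel xs ([y] @ as @ bs)"
  proof -
    have "rewire D (as @ bs) ys = sel (as @ bs) ys"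
      using Cons.prems dist sets by (intro Cons.IH) auto
    moreover have "sel [y] [y] \<odot> sel (as @ bs) ys = sel ([y] @ as @ bs) ([y] @ ys)"
      using dist sets by (intro sel_dtarr_sel) auto
    moreover have "swap D as [y] = sel (as @ [y]) ([y] @ as)"
      using dist by (intro swap_eq_sel) auto
    moreover have "sel (as @ [y]) ([y] @ as) \<odot> sel bs bs = sel ((as @ [y]) @ bs) (([y] @ as) @ bs)"
      using dist by (intro sel_dtarr_sel) auto
    ultimately show ?thesis using dist by (simp add: xs)
  qed
  also have "\<dots> = sel xs ([y] @ ys)"
    using sets by (intro sel_sel) (auto simp: xs)
  finally show ?case by simp
qed

end

section \<open>Kernels\<close>

locale sorted_variable_markov_category = variable_markov_category C \<theta>
  for C :: "('o, 'a, 'z) mcat_scheme" (structure) and \<theta> :: "'v::linorder \<Rightarrow> 'o"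
begin

declare le_supI1 [simp] le_supI2 [simp]

definition kernel_part where
  "kernel_part X Y k \<longleftrightarrow> finite X \<and> finite Y \<and> X \<subseteq> Y \<and> k \<in> arr D \<and> src D k = \<lfloor>X\<rfloor>\<^sub>v \<and> tgt D k = \<lfloor>Y - X\<rfloor>\<^sub>v"

lemma kernel_partD:
  assumes "kernel_part X Y k"
  shows "finite X" "finite Y" "X \<subseteq> Y" "k \<in> arr D" "src D k = \<lfloor>X\<rfloor>\<^sub>v" "tgt D k = \<lfloor>Y - X\<rfloor>\<^sub>v"
    "X \<union> (Y - X) = Y"
  using assms by (auto simp: kernel_part_def)

lemma mk_kernel_eq_sel:
  assumes "kernel_part X Y k"
  shows "mk_kernel D X Y k = sel (\<lfloor>X\<rfloor>\<^sub>v @ \<lfloor>Y - X\<rfloor>\<^sub>v) \<lfloor>Y\<rfloor>\<^sub>v \<bullet> \<langle>ident D \<lfloor>X\<rfloor>\<^sub>v, k\<rangle>"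
proof -
  have "rewire D (\<lfloor>X\<rfloor>\<^sub>v @ \<lfloor>Y - X\<rfloor>\<^sub>v) \<lfloor>Y\<rfloor>\<^sub>v = sel (\<lfloor>X\<rfloor>\<^sub>v @ \<lfloor>Y - X\<rfloor>\<^sub>v) \<lfloor>Y\<rfloor>\<^sub>v"
    using kernel_partD[OF assms] by (intro rewire_eq_sel) auto
  then show ?thesis by (simp add: mk_kernel_def dpair_def)
qed

lemma mk_kernel_simps:
  assumes "kernel_part X Y k"
  shows "mk_kernel D X Y k \<in> arr D" "src D (mk_kernel D X Y k) = \<lfloor>X\<rfloor>\<^sub>v"
    "tgt D (mk_kernel D X Y k) = \<lfloor>Y\<rfloor>\<^sub>v" "kdom D (mk_kernel D X Y k) = X" "kcod D (mk_kernel D X Y k) = Y"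
  using kernel_partD[OF assms] by (simp_all add: mk_kernel_eq_sel[OF assms] kdom_def kcod_def)

text \<open>Names in X are read from the copied input and names in Y - X from k; the sorting done at
  the end of the kernel is absorbed by \<open>sel_sel_dcmp\<close>.\<close>

lemma sel_mk_kernel:
  assumes "kernel_part X Y k" "set zs \<subseteq> X" "set vs \<subseteq> Y - X"
  shows "sel \<lfloor>Y\<rfloor>\<^sub>v (zs @ vs) \<bullet> mk_kernel D X Y k = \<langle>sel \<lfloor>X\<rfloor>\<^sub>v zs, sel \<lfloor>Y - X\<rfloor>\<^sub>v vs \<bullet> k\<rangle>"
proof -
  have "set (zs @ vs) \<subseteq> Y" using kernel_partD(3)[OF assms(1)] assms(2,3) by auto
  note [simp] = kernel_partD[OF assms(1)]
  have "sel \<lfloor>Y\<rfloor>\<^sub>v (zs @ vs) \<bullet> mk_kernel D X Y k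
      = sel (\<lfloor>X\<rfloor>\<^sub>v @ \<lfloor>Y - X\<rfloor>\<^sub>v) (zs @ vs) \<bullet> \<langle>ident D \<lfloor>X\<rfloor>\<^sub>v, k\<rangle>"
    unfolding mk_kernel_eq_sel[OF assms(1)]
    by (rule sel_sel_dcmp) (use \<open>set (zs @ vs) \<subseteq> Y\<close> in simp_all)
  also have "sel (\<lfloor>X\<rfloor>\<^sub>v @ \<lfloor>Y - X\<rfloor>\<^sub>v) (zs @ vs) = sel \<lfloor>X\<rfloor>\<^sub>v zs \<odot> sel \<lfloor>Y - X\<rfloor>\<^sub>v vs"
    by (rule sel_dtarr_sel[symmetric]) (use assms in auto)
  also have "(sel \<lfloor>X\<rfloor>\<^sub>v zs \<odot> sel \<lfloor>Y - X\<rfloor>\<^sub>v vs) \<bullet> \<langle>ident D \<lfloor>X\<rfloor>\<^sub>v, k\<rangle>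
      = \<langle>sel \<lfloor>X\<rfloor>\<^sub>v zs, sel \<lfloor>Y - X\<rfloor>\<^sub>v vs \<bullet> k\<rangle>"
    using assms by simp
  finally show ?thesis .
qed

lemma sel_mk_kernel_old:
  assumes "kernel_part X Y k" "set zs \<subseteq> X"
  shows "sel \<lfloor>Y\<rfloor>\<^sub>v zs \<bullet> mk_kernel D X Y k = sel \<lfloor>X\<rfloor>\<^sub>v zs"
  using sel_mk_kernel[OF assms, of "[]"] kernel_partD[OF assms(1)] assms(2) by simp

lemma sel_mk_kernel_new:
  assumes "kernel_part X Y k" "set vs \<subseteq> Y - X"
  shows "sel \<lfloor>Y\<rfloor>\<^sub>v vs \<bullet> mk_kernel D X Y k = sel \<lfloor>Y - X\<rfloor>\<^sub>v vs \<bullet> k"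
  using sel_mk_kernel[OF assms(1) _ assms(2), of "[]"] kernel_partD[OF assms(1)] assms(2) by simp

text \<open>
  This depends on the shape of a kernel: in a general Markov category a morphism with a deterministic
  marginal need not be a pairing with that marginal.
\<close>

lemma dpair_sel_mk_kernel:
  assumes "kernel_part X Y k" "set zs \<subseteq> X" "q \<in> arr D" "src D q = \<lfloor>Y\<rfloor>\<^sub>v"
  shows "\<langle>sel \<lfloor>Y\<rfloor>\<^sub>v zs, q\<rangle> \<bullet> mk_kernel D X Y k = \<langle>sel \<lfloor>X\<rfloor>\<^sub>v zs, q \<bullet> mk_kernel D X Y k\<rangle>"
proof -
  note [simp] = kernel_partD[OF assms(1)] assms(2-4)
  let ?p = "sel (\<lfloor>X\<rfloor>\<^sub>v @ \<lfloor>Y - X\<rfloor>\<^sub>v) \<lfloor>Y\<rfloor>\<^sub>v" and ?j = "\<langle>ident D \<lfloor>X\<rfloor>\<^sub>v, k\<rangle>"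
  let ?pi1 = "pi1 \<lfloor>X\<rfloor>\<^sub>v \<lfloor>Y - X\<rfloor>\<^sub>v"
  have [simp]: "set zs \<subseteq> Y" using assms(2) kernel_partD(3)[OF assms(1)] by blast
  have "\<langle>sel \<lfloor>Y\<rfloor>\<^sub>v zs, q\<rangle> \<bullet> mk_kernel D X Y k = (\<langle>sel \<lfloor>Y\<rfloor>\<^sub>v zs, q\<rangle> \<bullet> ?p) \<bullet> ?j"
    by (simp add: mk_kernel_eq_sel[OF assms(1)])
  also have "\<langle>sel \<lfloor>Y\<rfloor>\<^sub>v zs, q\<rangle> \<bullet> ?p = \<langle>sel (\<lfloor>X\<rfloor>\<^sub>v @ \<lfloor>Y - X\<rfloor>\<^sub>v) zs, q \<bullet> ?p\<rangle>"
    by (subst dpair_dcmp_ddet) simp_all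
  also have "\<dots> = (sel \<lfloor>X\<rfloor>\<^sub>v zs \<odot> ident D (tgt D q)) \<bullet> \<langle>?pi1, q \<bullet> ?p\<rangle>"
    by (simp add: sel_append_left)
  also have "\<dots> \<bullet> ?j = (sel \<lfloor>X\<rfloor>\<^sub>v zs \<odot> ident D (tgt D q)) \<bullet> (\<langle>?pi1, q \<bullet> ?p\<rangle> \<bullet> ?j)"
    by (rule dcmp_assoc) simp_all
  also have "\<langle>?pi1, q \<bullet> ?p\<rangle> \<bullet> ?j = \<langle>ident D \<lfloor>X\<rfloor>\<^sub>v, (q \<bullet> ?p) \<bullet> ?j\<rangle>"
    by (rule dpair_pi1_dcmp_dpair) simp_all
  also have "(sel \<lfloor>X\<rfloor>\<^sub>v zs \<odot> ident D (tgt D q)) \<bullet> \<dots> = \<langle>sel \<lfloor>X\<rfloor>\<^sub>v zs, q \<bullet> mk_kernel D X Y k\<rangle>"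
    by (simp add: mk_kernel_eq_sel[OF assms(1)])
  finally show ?thesis .
qed

lemma nontrivial_part_mk_kernel:
  assumes "kernel_part X Y k"
  shows "nontrivial_part D (mk_kernel D X Y k) = k"
proof -
  note [simp] = kernel_partD[OF assms] mk_kernel_simps[OF assms]
  have part: "l = sel \<lfloor>Y\<rfloor>\<^sub>v \<lfloor>Y - X\<rfloor>\<^sub>v \<bullet> mk_kernel D X Y l"
    if "l \<in> arr D" "src D l = \<lfloor>X\<rfloor>\<^sub>v" "tgt D l = \<lfloor>Y - X\<rfloor>\<^sub>v" for l
    using that sel_mk_kernel_new[of X Y l "\<lfloor>Y - X\<rfloor>\<^sub>v"] by (simp add: kernel_part_def)
  show ?thesis
    unfolding nontrivial_part_def
  proof (rule the_equality, goal_cases)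
    case 1
    then show ?case by (simp add: hom_def)
  next
    case (2 l)
    then have "l \<in> arr D" "src D l = \<lfloor>X\<rfloor>\<^sub>v" "tgt D l = \<lfloor>Y - X\<rfloor>\<^sub>v"
      and eq: "mk_kernel D X Y k = mk_kernel D X Y l"
      by (simp_all add: hom_def)
    then have "l = sel \<lfloor>Y\<rfloor>\<^sub>v \<lfloor>Y - X\<rfloor>\<^sub>v \<bullet> mk_kernel D X Y l" by (intro part)
    also have "\<dots> = sel \<lfloor>Y\<rfloor>\<^sub>v \<lfloor>Y - X\<rfloor>\<^sub>v \<bullet> mk_kernel D X Y k" by (simp only: eq)
    also have "\<dots> = k" by (rule part[symmetric]) simp_all
    finally show ?case .
  qed
qed

lemma kernel_mk_kernel: "kernel_part X Y k \<Longrightarrow> kernel D X Y (mk_kernel D X Y k)"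
  unfolding kernel_def kernel_part_def hom_def by blast

lemma kernel_obtain:
  assumes "kernel D X Y f"
  obtains k where "kernel_part X Y k" "f = mk_kernel D X Y k"
  using assms by (auto simp: kernel_def kernel_part_def hom_def)

lemma is_kernel_mk_kernel: "kernel_part X Y k \<Longrightarrow> is_kernel D (mk_kernel D X Y k)"
  by (simp add: is_kernel_def mk_kernel_simps kernel_mk_kernel)

lemma is_kernel_obtain:
  assumes "is_kernel D f"
  obtains k where "kernel_part (kdom D f) (kcod D f) k" "f = mk_kernel D (kdom D f) (kcod D f) k"
  using assms unfolding is_kernel_def by (rule kernel_obtain)

lemma kernel_part_del: "finite Z \<Longrightarrow> kernel_part Z Z (del D \<lfloor>Z\<rfloor>\<^sub>v)"
  by (simp add: kernel_part_def)

lemma ident_eq_mk_kernel: "finite Z \<Longrightarrow> ident D \<lfloor>Z\<rfloor>\<^sub>v = mk_kernel D Z Z (del D \<lfloor>Z\<rfloor>\<^sub>v)"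
  by (simp add: mk_kernel_eq_sel[OF kernel_part_del])

text \<open>The nontrivial part is the marginal of the composite on Z - X. Knowing the marginals on
  X and on Z - X would not suffice; that the composite is the pairing of its input with this
  marginal follows by applying \<open>dpair_sel_mk_kernel\<close> once to each kernel.\<close>

lemma kernel_cmp:
  assumes "kernel_part X Y k" "kernel_part Y Z l"
  shows "is_kernel D (mk_kernel D Y Z l \<bullet> mk_kernel D X Y k)"
proof -
  note [simp] = kernel_partD[OF assms(1)] kernel_partD[OF assms(2)]
    mk_kernel_simps[OF assms(1)] mk_kernel_simps[OF assms(2)]
  let ?F = "mk_kernel D Y Z l \<bullet> mk_kernel D X Y k"
  let ?q = "sel \<lfloor>Z\<rfloor>\<^sub>v \<lfloor>Z - X\<rfloor>\<^sub>v"
  have [simp]: "X \<subseteq> Z" using kernel_partD(3)[OF assms(1)] kernel_partD(3)[OF assms(2)] by blast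
  then have [simp]: "X \<union> Z = Z" by blast
  have m: "kernel_part X Z (?q \<bullet> ?F)" by (simp add: kernel_part_def)
  have 1: "\<langle>sel \<lfloor>Z\<rfloor>\<^sub>v \<lfloor>X\<rfloor>\<^sub>v, ?q\<rangle> \<bullet> mk_kernel D Y Z l = \<langle>sel \<lfloor>Y\<rfloor>\<^sub>v \<lfloor>X\<rfloor>\<^sub>v, ?q \<bullet> mk_kernel D Y Z l\<rangle>"
    by (rule dpair_sel_mk_kernel[OF assms(2)]) simp_all
  have 2: "\<langle>sel \<lfloor>Y\<rfloor>\<^sub>v \<lfloor>X\<rfloor>\<^sub>v, ?q \<bullet> mk_kernel D Y Z l\<rangle> \<bullet> mk_kernel D X Y k
      = \<langle>sel \<lfloor>X\<rfloor>\<^sub>v \<lfloor>X\<rfloor>\<^sub>v, (?q \<bullet> mk_kernel D Y Z l) \<bullet> mk_kernel D X Y k\<rangle>"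
    by (rule dpair_sel_mk_kernel[OF assms(1)]) simp_all
  have 3: "\<langle>sel \<lfloor>Z\<rfloor>\<^sub>v \<lfloor>X\<rfloor>\<^sub>v, ?q\<rangle> \<bullet> ?F
      = (\<langle>sel \<lfloor>Z\<rfloor>\<^sub>v \<lfloor>X\<rfloor>\<^sub>v, ?q\<rangle> \<bullet> mk_kernel D Y Z l) \<bullet> mk_kernel D X Y k"
    by (rule dcmp_assoc[symmetric]) simp_all
  have 4: "sel \<lfloor>Z\<rfloor>\<^sub>v (\<lfloor>X\<rfloor>\<^sub>v @ \<lfloor>Z - X\<rfloor>\<^sub>v) = \<langle>sel \<lfloor>Z\<rfloor>\<^sub>v \<lfloor>X\<rfloor>\<^sub>v, ?q\<rangle>"
    by (rule sel_append) simp_all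
  have "?F = sel (\<lfloor>X\<rfloor>\<^sub>v @ \<lfloor>Z - X\<rfloor>\<^sub>v) \<lfloor>Z\<rfloor>\<^sub>v \<bullet> sel \<lfloor>Z\<rfloor>\<^sub>v (\<lfloor>X\<rfloor>\<^sub>v @ \<lfloor>Z - X\<rfloor>\<^sub>v) \<bullet> ?F"
    by simp
  also have "\<dots> = sel (\<lfloor>X\<rfloor>\<^sub>v @ \<lfloor>Z - X\<rfloor>\<^sub>v) \<lfloor>Z\<rfloor>\<^sub>v \<bullet> \<langle>ident D \<lfloor>X\<rfloor>\<^sub>v, ?q \<bullet> ?F\<rangle>"
    unfolding 4 3 1 2 by simp
  finally have "?F = mk_kernel D X Z (?q \<bullet> ?F)" by (simp only: mk_kernel_eq_sel[OF m])
  then show ?thesis using is_kernel_mk_kernel[OF m] by simp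
qed

section \<open>Parallel sums, subkernels and satisfaction\<close>

lemma copy_shared_eq_sel:
  assumes [simp]: "finite X" "finite U"
  shows "copy_shared D X U = \<langle>sel \<lfloor>X \<union> U\<rfloor>\<^sub>v \<lfloor>X\<rfloor>\<^sub>v, sel \<lfloor>X \<union> U\<rfloor>\<^sub>v \<lfloor>U\<rfloor>\<^sub>v\<rangle>"
proof -
  let ?a = "\<lfloor>X - U\<rfloor>\<^sub>v" and ?b = "\<lfloor>X \<inter> U\<rfloor>\<^sub>v" and ?c = "\<lfloor>U - X\<rfloor>\<^sub>v" and ?t = "\<lfloor>X \<union> U\<rfloor>\<^sub>v"
  have r: "rewire D (?a @ ?b) \<lfloor>X\<rfloor>\<^sub>v = sel (?a @ ?b) \<lfloor>X\<rfloor>\<^sub>v"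
    "rewire D (?b @ ?c) \<lfloor>U\<rfloor>\<^sub>v = sel (?b @ ?c) \<lfloor>U\<rfloor>\<^sub>v"
    "rewire D ?t (?a @ ?b @ ?c) = sel ?t (?a @ ?b @ ?c)"
    by (rule rewire_eq_sel; auto)+
  have "ident D ?a \<odot> copy D ?b \<odot> ident D ?c = sel ?a ?a \<odot> sel ?b (?b @ ?b) \<odot> sel ?c ?c"
    by (simp add: copy_eq_sel)
  also have "sel ?b (?b @ ?b) \<odot> sel ?c ?c = sel (?b @ ?c) ((?b @ ?b) @ ?c)"
    by (rule sel_dtarr_sel) auto
  also have "sel ?a ?a \<odot> \<dots> = sel (?a @ ?b @ ?c) (?a @ (?b @ ?b) @ ?c)"
    by (rule sel_dtarr_sel) auto
  finally have c: "ident D ?a \<odot> copy D ?b \<odot> ident D ?c = sel (?a @ ?b @ ?c) ((?a @ ?b) @ ?b @ ?c)"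
    by simp
  have "copy_shared D X U = (sel (?a @ ?b) \<lfloor>X\<rfloor>\<^sub>v \<odot> sel (?b @ ?c) \<lfloor>U\<rfloor>\<^sub>v)
      \<bullet> sel (?a @ ?b @ ?c) ((?a @ ?b) @ ?b @ ?c) \<bullet> sel ?t (?a @ ?b @ ?c)"
    unfolding copy_shared_def r c ..
  also have "sel (?a @ ?b @ ?c) ((?a @ ?b) @ ?b @ ?c) \<bullet> sel ?t (?a @ ?b @ ?c) = sel ?t ((?a @ ?b) @ ?b @ ?c)"
    by (rule sel_sel) auto
  \<comment> \<open>The shared names now occur twice in the target list, so the wiring splits into
    one selection for each kernel.\<close>
  also have "\<dots> = \<langle>sel ?t (?a @ ?b), sel ?t (?b @ ?c)\<rangle>"
    by (rule sel_append) auto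
  also have "(sel (?a @ ?b) \<lfloor>X\<rfloor>\<^sub>v \<odot> sel (?b @ ?c) \<lfloor>U\<rfloor>\<^sub>v) \<bullet> \<dots>
      = \<langle>sel (?a @ ?b) \<lfloor>X\<rfloor>\<^sub>v \<bullet> sel ?t (?a @ ?b), sel (?b @ ?c) \<lfloor>U\<rfloor>\<^sub>v \<bullet> sel ?t (?b @ ?c)\<rangle>"
  proof -
    have "set \<lfloor>X\<rfloor>\<^sub>v \<subseteq> set (?a @ ?b)" "set \<lfloor>U\<rfloor>\<^sub>v \<subseteq> set (?b @ ?c)" "set (?a @ ?b) \<subseteq> set ?t" "set (?b @ ?c) \<subseteq> set ?t"
      by auto
    then show ?thesis by (intro dtarr_dpair) (simp_all del: set_append)
  qed
  also have "sel (?a @ ?b) \<lfloor>X\<rfloor>\<^sub>v \<bullet> sel ?t (?a @ ?b) = sel ?t \<lfloor>X\<rfloor>\<^sub>v" by (rule sel_sel) auto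
  also have "sel (?b @ ?c) \<lfloor>U\<rfloor>\<^sub>v \<bullet> sel ?t (?b @ ?c) = sel ?t \<lfloor>U\<rfloor>\<^sub>v" by (rule sel_sel) auto
  finally show ?thesis .
qed

text \<open>The nontrivial part built in \<open>par\<close>, with the copying wiring already
  expanded into two selections.\<close>

definition par_part where
  "par_part X Y k U V l = sel (\<lfloor>Y - X\<rfloor>\<^sub>v @ \<lfloor>V - U\<rfloor>\<^sub>v) \<lfloor>(Y \<union> V) - (X \<union> U)\<rfloor>\<^sub>v
     \<bullet> \<langle>k \<bullet> sel \<lfloor>X \<union> U\<rfloor>\<^sub>v \<lfloor>X\<rfloor>\<^sub>v, l \<bullet> sel \<lfloor>X \<union> U\<rfloor>\<^sub>v \<lfloor>U\<rfloor>\<^sub>v\<rangle>"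

lemma kernel_part_par_part:
  assumes "kernel_part X Y k" "kernel_part U V l"
  shows "kernel_part (X \<union> U) (Y \<union> V) (par_part X Y k U V l)"
proof -
  note [simp] = kernel_partD[OF assms(1)] kernel_partD[OF assms(2)]
  have "(Y \<union> V) - (X \<union> U) \<subseteq> (Y - X) \<union> (V - U)" by auto
  then show ?thesis by (simp add: kernel_part_def par_part_def)
qed

lemma par_mk_kernel:
  assumes "kernel_part X Y k" "kernel_part U V l" "X \<inter> U = Y \<inter> V"
  shows "par D (mk_kernel D X Y k) (mk_kernel D U V l)
    = mk_kernel D (X \<union> U) (Y \<union> V) (par_part X Y k U V l)"
proof -
  note k = kernel_partD[OF assms(1)] and l = kernel_partD[OF assms(2)]
  \<comment> \<open>Definedness of the parallel sum enters here: a new output of one kernel is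
    neither an input nor an output of the other, so the rewiring is between duplicate-free lists
    with the same names.\<close>
  have "(Y - X) \<inter> (V - U) = {}" "(Y - X) \<union> (V - U) = (Y \<union> V) - (X \<union> U)"
    using k(3) l(3) assms(3) by blast+
  then have rewire: "rewire D (\<lfloor>Y - X\<rfloor>\<^sub>v @ \<lfloor>V - U\<rfloor>\<^sub>v) \<lfloor>(Y \<union> V) - (X \<union> U)\<rfloor>\<^sub>v
      = sel (\<lfloor>Y - X\<rfloor>\<^sub>v @ \<lfloor>V - U\<rfloor>\<^sub>v) \<lfloor>(Y \<union> V) - (X \<union> U)\<rfloor>\<^sub>v"
    using k(2) l(2) by (intro rewire_eq_sel) simp_all
  have "(k \<odot> l) \<bullet> copy_shared D X U = \<langle>k \<bullet> sel \<lfloor>X \<union> U\<rfloor>\<^sub>v \<lfloor>X\<rfloor>\<^sub>v, l \<bullet> sel \<lfloor>X \<union> U\<rfloor>\<^sub>v \<lfloor>U\<rfloor>\<^sub>v\<rangle>"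
    unfolding copy_shared_eq_sel[OF k(1) l(1)] using k l by (intro dtarr_dpair) simp_all
  then show ?thesis
    unfolding par_def Let_def mk_kernel_simps[OF assms(1)] mk_kernel_simps[OF assms(2)]
      nontrivial_part_mk_kernel[OF assms(1)] nontrivial_part_mk_kernel[OF assms(2)] rewire par_part_def
    by simp
qed

lemma sel_par:
  assumes "kernel_part X Y k" "kernel_part U V l" "X \<inter> U = Y \<inter> V"
    "set zs \<subseteq> X \<union> U" "set xs \<subseteq> Y - X" "set ys \<subseteq> V - U"
  shows "sel \<lfloor>Y \<union> V\<rfloor>\<^sub>v (zs @ xs @ ys) \<bullet> mk_kernel D (X \<union> U) (Y \<union> V) (par_part X Y k U V l)
    = \<langle>sel \<lfloor>X \<union> U\<rfloor>\<^sub>v zs, \<langle>sel \<lfloor>Y - X\<rfloor>\<^sub>v xs \<bullet> k \<bullet> sel \<lfloor>X \<union> U\<rfloor>\<^sub>v \<lfloor>X\<rfloor>\<^sub>v,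
        sel \<lfloor>V - U\<rfloor>\<^sub>v ys \<bullet> l \<bullet> sel \<lfloor>X \<union> U\<rfloor>\<^sub>v \<lfloor>U\<rfloor>\<^sub>v\<rangle>\<rangle>"
proof -
  note k = kernel_partD[OF assms(1)] and l = kernel_partD[OF assms(2)]
  have new: "set (xs @ ys) \<subseteq> (Y \<union> V) - (X \<union> U)" and disj: "set ys \<inter> set \<lfloor>Y - X\<rfloor>\<^sub>v = {}"
    using assms(3,5,6) k(2,3) l(3) by auto
  note [simp] = k l
  let ?A = "\<lfloor>Y - X\<rfloor>\<^sub>v" and ?B = "\<lfloor>V - U\<rfloor>\<^sub>v" and ?K = "\<lfloor>(Y \<union> V) - (X \<union> U)\<rfloor>\<^sub>v"
  let ?j = "\<langle>k \<bullet> sel \<lfloor>X \<union> U\<rfloor>\<^sub>v \<lfloor>X\<rfloor>\<^sub>v, l \<bullet> sel \<lfloor>X \<union> U\<rfloor>\<^sub>v \<lfloor>U\<rfloor>\<^sub>v\<rangle>"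
  have "sel ?K (xs @ ys) \<bullet> par_part X Y k U V l = sel (?A @ ?B) (xs @ ys) \<bullet> ?j"
    unfolding par_part_def by (rule sel_sel_dcmp) (use new in auto)
  also have "sel (?A @ ?B) (xs @ ys) = sel ?A xs \<odot> sel ?B ys"
    by (rule sel_dtarr_sel[symmetric]) (use assms(5,6) disj in simp_all)
  also have "\<dots> \<bullet> ?j = \<langle>sel ?A xs \<bullet> k \<bullet> sel \<lfloor>X \<union> U\<rfloor>\<^sub>v \<lfloor>X\<rfloor>\<^sub>v, sel ?B ys \<bullet> l \<bullet> sel \<lfloor>X \<union> U\<rfloor>\<^sub>v \<lfloor>U\<rfloor>\<^sub>v\<rangle>"
    using assms(5,6) by simp
  finally show ?thesis
    using sel_mk_kernel[OF kernel_part_par_part[OF assms(1,2)] assms(4) new] by simp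
qed

text \<open>With \<open>ys = []\<close> in \<open>sel_par\<close>, the component containing l ends
  in the empty list and drops out of the pairing; what remains is the first kernel after a
  restriction of the inputs.\<close>

lemma sel_par_left:
  assumes "kernel_part X Y k" "kernel_part U V l" "X \<inter> U = Y \<inter> V"
  shows "sel \<lfloor>Y \<union> V\<rfloor>\<^sub>v \<lfloor>Y\<rfloor>\<^sub>v \<bullet> mk_kernel D (X \<union> U) (Y \<union> V) (par_part X Y k U V l)
    = mk_kernel D X Y k \<bullet> sel \<lfloor>X \<union> U\<rfloor>\<^sub>v \<lfloor>X\<rfloor>\<^sub>v"
proof -
  note k = kernel_partD[OF assms(1)] and l = kernel_partD[OF assms(2)]
  note [simp] = k l
  let ?F = "mk_kernel D (X \<union> U) (Y \<union> V) (par_part X Y k U V l)"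
  let ?s = "sel \<lfloor>X \<union> U\<rfloor>\<^sub>v \<lfloor>X\<rfloor>\<^sub>v"
  have "sel \<lfloor>Y \<union> V\<rfloor>\<^sub>v \<lfloor>Y\<rfloor>\<^sub>v \<bullet> ?F
      = sel (\<lfloor>X\<rfloor>\<^sub>v @ \<lfloor>Y - X\<rfloor>\<^sub>v) \<lfloor>Y\<rfloor>\<^sub>v \<bullet> sel \<lfloor>Y \<union> V\<rfloor>\<^sub>v (\<lfloor>X\<rfloor>\<^sub>v @ \<lfloor>Y - X\<rfloor>\<^sub>v @ []) \<bullet> ?F"
    using mk_kernel_simps[OF kernel_part_par_part[OF assms(1,2)]] by simp
  also have "sel \<lfloor>Y \<union> V\<rfloor>\<^sub>v (\<lfloor>X\<rfloor>\<^sub>v @ \<lfloor>Y - X\<rfloor>\<^sub>v @ []) \<bullet> ?F = \<langle>?s, k \<bullet> ?s\<rangle>"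
    by (subst sel_par[OF assms]) simp_all
  also have "\<dots> = \<langle>ident D \<lfloor>X\<rfloor>\<^sub>v, k\<rangle> \<bullet> ?s"
    by (subst dpair_dcmp_ddet) simp_all
  finally show ?thesis by (simp add: mk_kernel_eq_sel[OF assms(1)])
qed

text \<open>The extending kernel h preserves its inputs, so the outputs of d can be read before h
  acts; \<open>sel_par_left\<close> then removes the added identity on Z. The result is an equation
  between c and d in which neither Z nor h occurs.\<close>

lemma subkernelD:
  assumes "is_kernel D d" "subkernel D d c"
  shows "is_kernel D c" "kdom D d \<subseteq> kdom D c" "kcod D d \<subseteq> kcod D c" "kcod D d \<inter> kdom D c = kdom D d"
    "sel \<lfloor>kcod D c\<rfloor>\<^sub>v \<lfloor>kcod D d\<rfloor>\<^sub>v \<bullet> c = d \<bullet> sel \<lfloor>kdom D c\<rfloor>\<^sub>v \<lfloor>kdom D d\<rfloor>\<^sub>v"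
proof -
  obtain X Y k where k: "kernel_part X Y k" "d = mk_kernel D X Y k"
    using assms(1) by (rule is_kernel_obtain)
  obtain Z h where Zh: "finite Z" "is_kernel D h" "par_defined D d (ident D \<lfloor>Z\<rfloor>\<^sub>v)"
    "seq_defined D (par D d (ident D \<lfloor>Z\<rfloor>\<^sub>v)) h" "c = seq D (par D d (ident D \<lfloor>Z\<rfloor>\<^sub>v)) h"
    using assms(2) unfolding subkernel_def by blast
  obtain M N l where l: "kernel_part M N l" "h = mk_kernel D M N l"
    using Zh(2) by (rule is_kernel_obtain)
  note z = kernel_part_del[OF Zh(1)]
  have XZ: "X \<inter> Z = Y \<inter> Z"
    using Zh(3) unfolding par_defined_def ident_eq_mk_kernel[OF Zh(1)] k(2)
    by (simp add: mk_kernel_simps[OF k(1)] mk_kernel_simps[OF z])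
  define m where "m = par_part X Y k Z Z (del D \<lfloor>Z\<rfloor>\<^sub>v)"
  have m: "kernel_part (X \<union> Z) (Y \<union> Z) m"
    unfolding m_def by (rule kernel_part_par_part[OF k(1) z])
  have par: "par D d (ident D \<lfloor>Z\<rfloor>\<^sub>v) = mk_kernel D (X \<union> Z) (Y \<union> Z) m"
    unfolding ident_eq_mk_kernel[OF Zh(1)] k(2) m_def by (rule par_mk_kernel[OF k(1) z XZ])
  \<comment> \<open>Composability compares sorted lists; as the sets are finite, equality of the
    lists gives equality of the sets.\<close>
  have "\<lfloor>Y \<union> Z\<rfloor>\<^sub>v = \<lfloor>M\<rfloor>\<^sub>v"
    using Zh(4) unfolding seq_defined_def par l(2) mk_kernel_simps[OF m] mk_kernel_simps[OF l(1)] .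
  then have "set \<lfloor>Y \<union> Z\<rfloor>\<^sub>v = set \<lfloor>M\<rfloor>\<^sub>v" by simp
  then have M: "M = Y \<union> Z" using kernel_partD(1)[OF l(1)] kernel_partD(2)[OF m] by simp
  note l' = l(1)[unfolded M]
  have c: "c = mk_kernel D (Y \<union> Z) N l \<bullet> mk_kernel D (X \<union> Z) (Y \<union> Z) m"
    unfolding Zh(5) seq_def par l(2) M ..
  have dom: "kdom D d = X" "kcod D d = Y" "kdom D c = X \<union> Z" "kcod D c = N"
    using kernel_partD(1)[OF m] kernel_partD(2)[OF k(1)] kernel_partD(2)[OF l']
    by (simp_all add: k(2) mk_kernel_simps[OF k(1)] c kdom_def kcod_def
        mk_kernel_simps(2)[OF m] mk_kernel_simps(3)[OF l'])
  show "is_kernel D c" unfolding c by (rule kernel_cmp[OF m l'])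
  show "kdom D d \<subseteq> kdom D c" "kcod D d \<inter> kdom D c = kdom D d"
    \<comment> \<open>Since Y meets Z only inside X, an output of d that is an input of c is already
      an input of d.\<close>
    unfolding dom using XZ kernel_partD(3)[OF k(1)] by blast+
  have YN: "Y \<subseteq> N" using kernel_partD(3)[OF l'] by blast
  then show "kcod D d \<subseteq> kcod D c" unfolding dom .
  have "sel \<lfloor>N\<rfloor>\<^sub>v \<lfloor>Y\<rfloor>\<^sub>v \<bullet> c
      = (sel \<lfloor>N\<rfloor>\<^sub>v \<lfloor>Y\<rfloor>\<^sub>v \<bullet> mk_kernel D (Y \<union> Z) N l) \<bullet> mk_kernel D (X \<union> Z) (Y \<union> Z) m"
    unfolding c using YN kernel_partD(2)[OF k(1)] kernel_partD(2)[OF l']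
    by (intro dcmp_assoc[symmetric]) (simp_all add: mk_kernel_simps[OF m] mk_kernel_simps[OF l'])
  also have "sel \<lfloor>N\<rfloor>\<^sub>v \<lfloor>Y\<rfloor>\<^sub>v \<bullet> mk_kernel D (Y \<union> Z) N l = sel \<lfloor>Y \<union> Z\<rfloor>\<^sub>v \<lfloor>Y\<rfloor>\<^sub>v"
    using kernel_partD(2)[OF k(1)] by (intro sel_mk_kernel_old[OF l']) simp
  also have "\<dots> \<bullet> mk_kernel D (X \<union> Z) (Y \<union> Z) m = mk_kernel D X Y k \<bullet> sel \<lfloor>X \<union> Z\<rfloor>\<^sub>v \<lfloor>X\<rfloor>\<^sub>v"
    unfolding m_def by (rule sel_par_left[OF k(1) z XZ])
  finally show "sel \<lfloor>kcod D c\<rfloor>\<^sub>v \<lfloor>kcod D d\<rfloor>\<^sub>v \<bullet> c = d \<bullet> sel \<lfloor>kdom D c\<rfloor>\<^sub>v \<lfloor>kdom D d\<rfloor>\<^sub>v"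
    unfolding dom by (simp only: k(2))
qed

lemma mk_kernel_empty:
  assumes "kernel_part {} V s"
  shows "mk_kernel D {} V s = s"
  using kernel_partD[OF assms] by (simp add: mk_kernel_eq_sel[OF assms])

lemma par_part_ident:
  assumes "kernel_part X Y k" "finite Z" "X \<inter> Z = Y \<inter> Z"
  shows "par_part X Y k Z Z (del D \<lfloor>Z\<rfloor>\<^sub>v) = k \<bullet> sel \<lfloor>X \<union> Z\<rfloor>\<^sub>v \<lfloor>X\<rfloor>\<^sub>v"
proof -
  have eq: "(Y \<union> Z) - (X \<union> Z) = Y - X" using assms(3) by blast
  show ?thesis using kernel_partD[OF assms(1)] assms(2) unfolding par_part_def eq by simp
qed

text \<open>No variables are added, and the extending kernel is the identity on the outputs.\<close>

lemma subkernel_refl: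
  assumes "is_kernel D b"
  shows "subkernel D b b"
proof -
  obtain X Y k where k: "kernel_part X Y k" "b = mk_kernel D X Y k"
    using assms by (rule is_kernel_obtain)
  have "finite {}" by simp
  note z = kernel_part_del[OF this] and i = ident_eq_mk_kernel[OF this]
  have par: "par D b (ident D \<lfloor>{}\<rfloor>\<^sub>v) = b"
    unfolding i k(2) using par_mk_kernel[OF k(1) z] par_part_ident[OF k(1), of "{}"] kernel_partD[OF k(1)]
    by simp
  have pd: "par_defined D b (ident D \<lfloor>{}\<rfloor>\<^sub>v)"
    unfolding par_defined_def i mk_kernel_simps[OF z] by simp
  show ?thesis
    unfolding subkernel_def
  proof (intro exI conjI)
    show "is_kernel D (ident D \<lfloor>Y\<rfloor>\<^sub>v)"
      using kernel_partD(2)[OF k(1)] by (simp add: ident_eq_mk_kernel is_kernel_mk_kernel kernel_part_del)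
    show "seq_defined D (par D b (ident D \<lfloor>{}\<rfloor>\<^sub>v)) (ident D \<lfloor>Y\<rfloor>\<^sub>v)"
      unfolding par seq_defined_def by (simp add: k(2) mk_kernel_simps[OF k(1)])
    show "b = seq D (par D b (ident D \<lfloor>{}\<rfloor>\<^sub>v)) (ident D \<lfloor>Y\<rfloor>\<^sub>v)"
      unfolding par seq_def by (simp add: k(2) mk_kernel_simps[OF k(1)])
  qed (use pd in simp_all)
qed

lemma sat_Dep_mk_kernel:
  assumes "kernel_part S R k" "T' \<subseteq> R"
  shows "sat D (mk_kernel D S R k) (S \<triangleright> T')"
  unfolding sat.simps(1)
proof (intro exI conjI)
  show "subkernel D (mk_kernel D S R k) (mk_kernel D S R k)"
    by (rule subkernel_refl[OF is_kernel_mk_kernel[OF assms(1)]])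
qed (use assms in \<open>simp_all add: is_kernel_mk_kernel mk_kernel_simps\<close>)

text \<open>The morphism g is the marginal on X of the subkernel that witnesses the dependency, so
  it generates X from S alone even if c has further inputs. As X avoids S, \<open>subkernelD\<close>
  also shows that X consists of new outputs of c.\<close>

lemma sat_Dep_factor:
  assumes "sat D c (S \<triangleright> X)" "X \<inter> S = {}"
  obtains g where "is_kernel D c" "S \<subseteq> kdom D c" "X \<subseteq> kcod D c - kdom D c"
    "g \<in> arr D" "src D g = \<lfloor>S\<rfloor>\<^sub>v" "tgt D g = \<lfloor>X\<rfloor>\<^sub>v"
    "sel \<lfloor>kcod D c\<rfloor>\<^sub>v \<lfloor>X\<rfloor>\<^sub>v \<bullet> c = g \<bullet> sel \<lfloor>kdom D c\<rfloor>\<^sub>v \<lfloor>S\<rfloor>\<^sub>v"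
proof -
  obtain b where b: "is_kernel D b" "subkernel D b c" "kdom D b = S" "X \<subseteq> kcod D b"
    using assms(1) by auto
  note sub = subkernelD[OF b(1,2)]
  obtain k where k: "kernel_part S (kcod D b) k" "b = mk_kernel D S (kcod D b) k"
    using is_kernel_obtain[OF b(1)] b(3) by metis
  obtain l where l: "kernel_part (kdom D c) (kcod D c) l" "c = mk_kernel D (kdom D c) (kcod D c) l"
    using is_kernel_obtain[OF sub(1)] by metis
  have b': "b \<in> arr D" "src D b = \<lfloor>S\<rfloor>\<^sub>v" "tgt D b = \<lfloor>kcod D b\<rfloor>\<^sub>v"
    using mk_kernel_simps[OF k(1)] k(2) by simp_all
  have c': "c \<in> arr D" "tgt D c = \<lfloor>kcod D c\<rfloor>\<^sub>v"
    using mk_kernel_simps[OF l(1)] l(2) by simp_all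
  have fin: "finite (kcod D b)" "finite (kcod D c)" "finite X" "finite S" "finite (kdom D c)"
    using kernel_partD[OF k(1)] kernel_partD[OF l(1)] b(4) by (auto intro: finite_subset)
  have SD: "S \<subseteq> kdom D c" using sub(2) b(3) by simp
  have "sel \<lfloor>kcod D c\<rfloor>\<^sub>v \<lfloor>X\<rfloor>\<^sub>v \<bullet> c = sel \<lfloor>kcod D b\<rfloor>\<^sub>v \<lfloor>X\<rfloor>\<^sub>v \<bullet> sel \<lfloor>kcod D c\<rfloor>\<^sub>v \<lfloor>kcod D b\<rfloor>\<^sub>v \<bullet> c"
    using fin b(4) sub(3) c' by (intro sel_sel_dcmp[symmetric]) simp_all
  also have "\<dots> = (sel \<lfloor>kcod D b\<rfloor>\<^sub>v \<lfloor>X\<rfloor>\<^sub>v \<bullet> b) \<bullet> sel \<lfloor>kdom D c\<rfloor>\<^sub>v \<lfloor>S\<rfloor>\<^sub>v"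
    unfolding sub(5) b(3) using fin b(4) b' SD by (intro dcmp_assoc[symmetric]) simp_all
  finally show ?thesis
    using fin b(4) b' SD sub(1,3,4) b(3) assms(2)
    by (intro that[of "sel \<lfloor>kcod D b\<rfloor>\<^sub>v \<lfloor>X\<rfloor>\<^sub>v \<bullet> b"]) auto
qed

section \<open>Conditional independence\<close>

lemma copy3_dpair:
  assumes "g1 \<in> arr D" "g2 \<in> arr D" "src D g1 = ws" "src D g2 = ws"
  shows "(ident D ws \<odot> g1 \<odot> g2) \<bullet> copy3 D ws = \<langle>ident D ws, \<langle>g1, g2\<rangle>\<rangle>"
  using assms by (simp add: copy3_def copy_eq_dpair)

lemma dtarr_dcmp_dtarr:
  assumes "f \<in> arr D" "g \<in> arr D" "h \<in> arr D" "k \<in> arr D" "src D h = tgt D f" "src D k = tgt D g"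
  shows "(h \<odot> k) \<bullet> (f \<odot> g) = (h \<bullet> f) \<odot> (k \<bullet> g)"
proof -
  have "(h \<odot> k) \<bullet> (f \<odot> g) = (h \<odot> k) \<bullet> \<langle>f \<bullet> pi1 (src D f) (src D g), g \<bullet> pi2 (src D f) (src D g)\<rangle>"
    by (simp only: dtarr_eq_dpair[OF assms(1,2)])
  also have "\<dots> = \<langle>(h \<bullet> f) \<bullet> pi1 (src D f) (src D g), (k \<bullet> g) \<bullet> pi2 (src D f) (src D g)\<rangle>"
    using assms by simp
  also have "\<dots> = (h \<bullet> f) \<odot> (k \<bullet> g)"
    using dtarr_eq_dpair[of "h \<bullet> f" "k \<bullet> g"] assms by simp
  finally show ?thesis .
qed

text \<open>
  Superset independence is the case where \<open>l\<close> is trivial, Markov independence the case where \<open>Z\<close> is empty.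
\<close>

lemma sat_seq_starI:
  assumes c1: "kernel_part W R1 k1" and c2: "kernel_part W R2 k2" and "R1 \<inter> R2 = W"
    and "X \<subseteq> R1" "Y \<subseteq> R2" "finite Z" and WZ: "(R1 \<union> R2) \<inter> Z \<subseteq> W"
    and l: "kernel_part (R1 \<union> R2 \<union> Z) V l"
    and s: "s \<in> arr D" "src D s = []" "tgt D s = \<lfloor>W \<union> Z\<rfloor>\<^sub>v"
    and f: "f = mk_kernel D (R1 \<union> R2 \<union> Z) V l
      \<bullet> sel (\<lfloor>W \<union> Z\<rfloor>\<^sub>v @ \<lfloor>R1 - W\<rfloor>\<^sub>v @ \<lfloor>R2 - W\<rfloor>\<^sub>v) \<lfloor>R1 \<union> R2 \<union> Z\<rfloor>\<^sub>v
      \<bullet> \<langle>ident D \<lfloor>W \<union> Z\<rfloor>\<^sub>v, \<langle>k1, k2\<rangle> \<bullet> sel \<lfloor>W \<union> Z\<rfloor>\<^sub>v \<lfloor>W\<rfloor>\<^sub>v\<rangle> \<bullet> s"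
  shows "sat D f (({} \<triangleright> W) \<^bold>; ((W \<triangleright> X) \<^bold>* (W \<triangleright> Y)))"
proof -
  note d1 = kernel_partD[OF c1] and d2 = kernel_partD[OF c2]
  let ?R = "R1 \<union> R2" and ?A = "\<lfloor>R1 - W\<rfloor>\<^sub>v" and ?B = "\<lfloor>R2 - W\<rfloor>\<^sub>v"
  let ?c1 = "mk_kernel D W R1 k1" and ?c2 = "mk_kernel D W R2 k2"
  define kp where "kp = sel (?A @ ?B) \<lfloor>?R - W\<rfloor>\<^sub>v \<bullet> \<langle>k1, k2\<rangle>"
  have kp_eq: "par_part W R1 k1 W R2 k2 = kp"
    using d1 d2 by (simp add: par_part_def kp_def)
  have kp: "kernel_part W ?R kp"
    using kernel_part_par_part[OF c1 c2] by (simp add: kp_eq)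
  have R: "W \<inter> W = R1 \<inter> R2" using assms(3) by simp
  have par: "par D ?c1 ?c2 = mk_kernel D W ?R kp"
    using par_mk_kernel[OF c1 c2 R] by (simp add: kp_eq)
  note z = kernel_part_del[OF \<open>finite Z\<close>] and i = ident_eq_mk_kernel[OF \<open>finite Z\<close>]
  \<comment> \<open>Z holds variables produced by s that bypass both kernels. They meet the outputs
    of the kernels only in W, so the identity on Z may be added in parallel.\<close>
  have RZ: "W \<inter> Z = ?R \<inter> Z" using WZ d1(3) d2(3) by blast
  define kz where "kz = kp \<bullet> sel \<lfloor>W \<union> Z\<rfloor>\<^sub>v \<lfloor>W\<rfloor>\<^sub>v"
  have kz_eq: "par_part W ?R kp Z Z (del D \<lfloor>Z\<rfloor>\<^sub>v) = kz"
    unfolding kz_def by (rule par_part_ident[OF kp \<open>finite Z\<close> RZ])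
  have kz: "kernel_part (W \<union> Z) (?R \<union> Z) kz"
    using kernel_part_par_part[OF kp z] by (simp add: kz_eq)
  have parz: "par D (par D ?c1 ?c2) (ident D \<lfloor>Z\<rfloor>\<^sub>v) = mk_kernel D (W \<union> Z) (?R \<union> Z) kz"
    unfolding par i using par_mk_kernel[OF kp z RZ] by (simp only: kz_eq)
  \<comment> \<open>The cut for the sequential conjunction: s is the first kernel and
    \<open>b2\<close> the rest, written so that it visibly extends the parallel sum by Z and then by
    the kernel of l.\<close>
  define b2 where "b2 = mk_kernel D (?R \<union> Z) V l \<bullet> mk_kernel D (W \<union> Z) (?R \<union> Z) kz"
  have s': "kernel_part {} (W \<union> Z) s"
    using s d1(1) \<open>finite Z\<close> by (simp add: kernel_part_def)
  have sub: "subkernel D (par D ?c1 ?c2) b2"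
    unfolding subkernel_def
  proof (intro exI conjI)
    show "is_kernel D (mk_kernel D (?R \<union> Z) V l)" by (rule is_kernel_mk_kernel[OF l])
    show "par_defined D (par D ?c1 ?c2) (ident D \<lfloor>Z\<rfloor>\<^sub>v)"
      unfolding par_defined_def par i mk_kernel_simps[OF kp] mk_kernel_simps[OF z] by (rule RZ)
    show "seq_defined D (par D (par D ?c1 ?c2) (ident D \<lfloor>Z\<rfloor>\<^sub>v)) (mk_kernel D (?R \<union> Z) V l)"
      unfolding seq_defined_def parz mk_kernel_simps[OF kz] mk_kernel_simps[OF l] ..
    show "b2 = seq D (par D (par D ?c1 ?c2) (ident D \<lfloor>Z\<rfloor>\<^sub>v)) (mk_kernel D (?R \<union> Z) V l)"
      unfolding parz seq_def b2_def ..
  qed fact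
  have star: "sat D b2 ((W \<triangleright> X) \<^bold>* (W \<triangleright> Y))"
    unfolding sat.simps(2)
  proof (intro exI conjI)
    show "par_defined D ?c1 ?c2"
      unfolding par_defined_def mk_kernel_simps[OF c1] mk_kernel_simps[OF c2] by (rule R)
  qed (use sub c1 c2 assms(4,5) in \<open>simp_all only: is_kernel_mk_kernel sat_Dep_mk_kernel\<close>)
  let ?j = "\<langle>ident D \<lfloor>W \<union> Z\<rfloor>\<^sub>v, \<langle>k1, k2\<rangle> \<bullet> sel \<lfloor>W \<union> Z\<rfloor>\<^sub>v \<lfloor>W\<rfloor>\<^sub>v\<rangle>"
  have new: "(?R \<union> Z) - (W \<union> Z) = ?R - W" using RZ by blast
  have "finite ?R" "finite (W \<union> Z)" "finite (R1 - W)" "finite (R2 - W)" "finite (?R - W)" "finite (?R \<union> Z)"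
    using d1(1,2) d2(2) \<open>finite Z\<close> by simp_all
  note set = this[THEN set_sorted_list_of_set]
  have AB: "set \<lfloor>?R - W\<rfloor>\<^sub>v \<subseteq> set (?A @ ?B)" "set \<lfloor>?R - W\<rfloor>\<^sub>v \<inter> set \<lfloor>W \<union> Z\<rfloor>\<^sub>v = {}"
    "set \<lfloor>?R \<union> Z\<rfloor>\<^sub>v \<subseteq> set (\<lfloor>W \<union> Z\<rfloor>\<^sub>v @ \<lfloor>?R - W\<rfloor>\<^sub>v)"
    "set (\<lfloor>W \<union> Z\<rfloor>\<^sub>v @ \<lfloor>?R - W\<rfloor>\<^sub>v) \<subseteq> set (\<lfloor>W \<union> Z\<rfloor>\<^sub>v @ ?A @ ?B)"
    unfolding set_append set using WZ by blast+
  have W: "set \<lfloor>W\<rfloor>\<^sub>v \<subseteq> set \<lfloor>W \<union> Z\<rfloor>\<^sub>v" using d1(1) \<open>finite Z\<close> by simp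
  have j: "?j \<in> arr D" "tgt D ?j = \<lfloor>W \<union> Z\<rfloor>\<^sub>v @ ?A @ ?B"
    using d1(4-6) d2(4-6) W by simp_all
  have sel: "set \<lfloor>?R \<union> Z\<rfloor>\<^sub>v \<subseteq> set (\<lfloor>W \<union> Z\<rfloor>\<^sub>v @ ?A @ ?B)"
    using AB(3,4) by (rule subset_trans)
  \<comment> \<open>It remains to recognise the wiring in the hypothesis on f as the parallel sum
    enlarged by the identity on Z. By \<open>new\<close>, this identity contributes no new
    outputs.\<close>
  have "mk_kernel D (W \<union> Z) (?R \<union> Z) kz
      = sel (\<lfloor>W \<union> Z\<rfloor>\<^sub>v @ \<lfloor>?R - W\<rfloor>\<^sub>v) \<lfloor>?R \<union> Z\<rfloor>\<^sub>v \<bullet> \<langle>ident D \<lfloor>W \<union> Z\<rfloor>\<^sub>v, kz\<rangle>"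
    unfolding mk_kernel_eq_sel[OF kz] new ..
  also have "\<langle>ident D \<lfloor>W \<union> Z\<rfloor>\<^sub>v, kz\<rangle>
      = (sel \<lfloor>W \<union> Z\<rfloor>\<^sub>v \<lfloor>W \<union> Z\<rfloor>\<^sub>v \<odot> sel (?A @ ?B) \<lfloor>?R - W\<rfloor>\<^sub>v) \<bullet> ?j"
    using d1(4-6) d2(4-6) AB(1) W by (simp add: kz_def kp_def del: set_append)
  also have "sel \<lfloor>W \<union> Z\<rfloor>\<^sub>v \<lfloor>W \<union> Z\<rfloor>\<^sub>v \<odot> sel (?A @ ?B) \<lfloor>?R - W\<rfloor>\<^sub>v
      = sel (\<lfloor>W \<union> Z\<rfloor>\<^sub>v @ ?A @ ?B) (\<lfloor>W \<union> Z\<rfloor>\<^sub>v @ \<lfloor>?R - W\<rfloor>\<^sub>v)"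
    by (rule sel_dtarr_sel) (use AB in simp_all)
  also have "sel (\<lfloor>W \<union> Z\<rfloor>\<^sub>v @ \<lfloor>?R - W\<rfloor>\<^sub>v) \<lfloor>?R \<union> Z\<rfloor>\<^sub>v
      \<bullet> sel (\<lfloor>W \<union> Z\<rfloor>\<^sub>v @ ?A @ ?B) (\<lfloor>W \<union> Z\<rfloor>\<^sub>v @ \<lfloor>?R - W\<rfloor>\<^sub>v) \<bullet> ?j
      = sel (\<lfloor>W \<union> Z\<rfloor>\<^sub>v @ ?A @ ?B) \<lfloor>?R \<union> Z\<rfloor>\<^sub>v \<bullet> ?j"
    by (rule sel_sel_dcmp[OF AB(3,4) j])
  finally have mk: "mk_kernel D (W \<union> Z) (?R \<union> Z) kz = sel (\<lfloor>W \<union> Z\<rfloor>\<^sub>v @ ?A @ ?B) \<lfloor>?R \<union> Z\<rfloor>\<^sub>v \<bullet> ?j" .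
  have "f = mk_kernel D (?R \<union> Z) V l \<bullet> (sel (\<lfloor>W \<union> Z\<rfloor>\<^sub>v @ ?A @ ?B) \<lfloor>?R \<union> Z\<rfloor>\<^sub>v \<bullet> ?j) \<bullet> s"
    unfolding f using s sel j d1(4-6) d2(4-6) W by (subst dcmp_assoc) (simp_all del: set_append)
  then have "f = mk_kernel D (?R \<union> Z) V l \<bullet> mk_kernel D (W \<union> Z) (?R \<union> Z) kz \<bullet> s"
    by (simp only: mk)
  then have f': "f = b2 \<bullet> s"
    using s mk_kernel_simps[OF kz] mk_kernel_simps[OF l] by (simp add: b2_def)
  have "is_kernel D s" using is_kernel_mk_kernel[OF s'] by (simp add: mk_kernel_empty[OF s'])
  moreover have "is_kernel D b2" unfolding b2_def by (rule kernel_cmp[OF kz l])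
  moreover have "seq_defined D s b2"
    by (simp add: seq_defined_def s b2_def mk_kernel_simps[OF kz])
  moreover have "sat D s ({} \<triangleright> W)"
    using sat_Dep_mk_kernel[OF s', of W] by (simp add: mk_kernel_empty[OF s'])
  ultimately show ?thesis
    unfolding sat.simps(3) seq_def using star f' by blast
qed

section \<open>The implications for a fixed state on disjoint sets of variables\<close>

context
  fixes W X Y U V :: "'v set" and f :: "'v list \<times> 'a \<times> 'v list"
  assumes fin: "finite W" "finite X" "finite Y" "finite U"
    and disj: "W \<inter> X = {}" "W \<inter> Y = {}" "W \<inter> U = {}" "X \<inter> Y = {}" "X \<inter> U = {}" "Y \<inter> U = {}"
    and V: "V = W \<union> X \<union> Y \<union> U"
    and f: "f \<in> arr D" "src D f = []" "tgt D f = \<lfloor>V\<rfloor>\<^sub>v"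
begin

abbreviation (input) "ws \<equiv> \<lfloor>W\<rfloor>\<^sub>v"
abbreviation (input) "xs \<equiv> \<lfloor>X\<rfloor>\<^sub>v"
abbreviation (input) "ys \<equiv> \<lfloor>Y\<rfloor>\<^sub>v"
abbreviation (input) "us \<equiv> \<lfloor>U\<rfloor>\<^sub>v"

lemma set_vars: "set ws = W" "set xs = X" "set ys = Y" "set us = U" "set \<lfloor>V\<rfloor>\<^sub>v = V" "finite V"
  using fin by (simp_all add: V)

lemma set_arranged: "set (ws @ xs @ ys @ us) = V" "set (ws @ xs @ ys) \<subseteq> V"
  "set (ws @ xs @ ys) \<subseteq> set (ws @ xs @ ys @ us)"
  by (auto simp: set_vars V)

lemma arrange_eq_sel: "arrange D W X Y U f = sel \<lfloor>V\<rfloor>\<^sub>v (ws @ xs @ ys @ us) \<bullet> f"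
proof -
  have "distinct (ws @ xs @ ys @ us)" using disj by (auto simp: set_vars)
  then have "rewire D \<lfloor>V\<rfloor>\<^sub>v (ws @ xs @ ys @ us) = sel \<lfloor>V\<rfloor>\<^sub>v (ws @ xs @ ys @ us)"
    by (intro rewire_eq_sel) (simp_all add: set_arranged set_vars del: set_append distinct_append)
  then show ?thesis by (simp add: arrange_def V)
qed

lemma arrange_simps:
  "arrange D W X Y U f \<in> arr D" "src D (arrange D W X Y U f) = []"
  "tgt D (arrange D W X Y U f) = ws @ xs @ ys @ us"
  unfolding arrange_eq_sel using f set_arranged set_vars by (simp_all del: set_append)

lemma sel_arrange:
  assumes "set zs \<subseteq> V"
  shows "sel (ws @ xs @ ys @ us) zs \<bullet> arrange D W X Y U f = sel \<lfloor>V\<rfloor>\<^sub>v zs \<bullet> f"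
  unfolding arrange_eq_sel
  by (rule sel_sel_dcmp) (use assms f in \<open>simp_all only: set_arranged set_vars subset_refl\<close>)

lemma f_eq_sel_arrange: "f = sel (ws @ xs @ ys @ us) \<lfloor>V\<rfloor>\<^sub>v \<bullet> arrange D W X Y U f"
  using sel_arrange[of "\<lfloor>V\<rfloor>\<^sub>v"] f by (simp add: set_vars)

lemma discard_eq_sel: "ident D (ws @ xs @ ys) \<odot> del D us = sel (ws @ xs @ ys @ us) (ws @ xs @ ys)"
proof -
  have "distinct (ws @ xs @ ys)" using disj by (auto simp: set_vars)
  then show ?thesis
    using sel_dtarr_sel[of "ws @ xs @ ys" "ws @ xs @ ys" "[]" us]
    by (simp del: distinct_append set_append)
qed

text \<open>Arranging the outputs and discarding U is a single selection applied to f, and the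
  triple copy of W followed by \<open>g1\<close> and \<open>g2\<close> is a nested pairing. In this
  form no rewiring and no explicit copy is left.\<close>

lemma displays_markov_ci_iff:
  "displays_markov_ci D W X Y U f \<longleftrightarrow>
     (\<exists>s0 g1 g2. s0 \<in> arr D \<and> src D s0 = [] \<and> tgt D s0 = ws \<and> g1 \<in> arr D \<and> src D g1 = ws \<and> tgt D g1 = xs
        \<and> g2 \<in> arr D \<and> src D g2 = ws \<and> tgt D g2 = ys
        \<and> sel \<lfloor>V\<rfloor>\<^sub>v (ws @ xs @ ys) \<bullet> f = \<langle>ident D ws, \<langle>g1, g2\<rangle>\<rangle> \<bullet> s0)"
proof -
  have eq: "(ident D ws \<odot> g1 \<odot> g2) \<bullet> copy3 D ws \<bullet> s0 = \<langle>ident D ws, \<langle>g1, g2\<rangle>\<rangle> \<bullet> s0"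
    if "s0 \<in> arr D" "tgt D s0 = ws" "g1 \<in> arr D" "src D g1 = ws" "g2 \<in> arr D" "src D g2 = ws" for s0 g1 g2
  proof -
    have "(ident D ws \<odot> g1 \<odot> g2) \<bullet> copy3 D ws \<bullet> s0 = ((ident D ws \<odot> g1 \<odot> g2) \<bullet> copy3 D ws) \<bullet> s0"
      using that by (intro dcmp_assoc[symmetric]) (simp_all add: copy3_def)
    then show ?thesis using that by (simp only: copy3_dpair)
  qed
  show ?thesis (is "_ \<longleftrightarrow> ?rhs")
  proof
    assume "displays_markov_ci D W X Y U f"
    then have "markov_ci D ws xs ys us (arrange D W X Y U f)" unfolding displays_markov_ci_def .
    then have "\<exists>s0 \<in> hom D [] ws. \<exists>g1 \<in> hom D ws xs. \<exists>g2 \<in> hom D ws ys.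
        (ident D (ws @ xs @ ys) \<odot> del D us) \<bullet> arrange D W X Y U f
          = (ident D ws \<odot> g1 \<odot> g2) \<bullet> copy3 D ws \<bullet> s0"
      unfolding markov_ci_def by (rule conjunct2)
    then have "\<exists>s0 \<in> hom D [] ws. \<exists>g1 \<in> hom D ws xs. \<exists>g2 \<in> hom D ws ys.
        sel \<lfloor>V\<rfloor>\<^sub>v (ws @ xs @ ys) \<bullet> f = (ident D ws \<odot> g1 \<odot> g2) \<bullet> copy3 D ws \<bullet> s0"
      unfolding discard_eq_sel sel_arrange[OF set_arranged(2)] .
    then obtain s0 g1 g2 where h: "s0 \<in> hom D [] ws" "g1 \<in> hom D ws xs" "g2 \<in> hom D ws ys"
      and *: "sel \<lfloor>V\<rfloor>\<^sub>v (ws @ xs @ ys) \<bullet> f = (ident D ws \<odot> g1 \<odot> g2) \<bullet> copy3 D ws \<bullet> s0"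
      by (elim bexE) (rule that)
    from h have h': "s0 \<in> arr D" "src D s0 = []" "tgt D s0 = ws"
      "g1 \<in> arr D" "src D g1 = ws" "tgt D g1 = xs" "g2 \<in> arr D" "src D g2 = ws" "tgt D g2 = ys"
      by (simp_all add: hom_def)
    note *[unfolded eq[OF h'(1,3,4,5,7,8)]]
    with h' show ?rhs by (intro exI conjI)
  next
    assume ?rhs
    then obtain s0 g1 g2 where h: "s0 \<in> arr D" "src D s0 = []" "tgt D s0 = ws"
      "g1 \<in> arr D" "src D g1 = ws" "tgt D g1 = xs" "g2 \<in> arr D" "src D g2 = ws" "tgt D g2 = ys"
      and *: "sel \<lfloor>V\<rfloor>\<^sub>v (ws @ xs @ ys) \<bullet> f = \<langle>ident D ws, \<langle>g1, g2\<rangle>\<rangle> \<bullet> s0"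
      by (elim exE conjE) (rule that)
    from h have "s0 \<in> hom D [] ws" "g1 \<in> hom D ws xs" "g2 \<in> hom D ws ys"
      by (simp_all add: hom_def)
    moreover note *[folded eq[OF h(1,3,4,5,7,8)]]
    moreover have "arrange D W X Y U f \<in> hom D [] (ws @ xs @ ys @ us)"
      using arrange_simps by (simp add: hom_def)
    ultimately show "displays_markov_ci D W X Y U f"
      unfolding displays_markov_ci_def markov_ci_def discard_eq_sel sel_arrange[OF set_arranged(2)]
      by (intro conjI bexI)
  qed
qed

text \<open>The two dependencies supply \<open>g1\<close> and \<open>g2\<close>; the state on W is
  the marginal of \<open>b1\<close>. Inside the parallel sum, selecting W, X and Y yields the
  pairing of \<open>g1\<close> and \<open>g2\<close> over W; \<open>subkernelD\<close> carries this
  over to \<open>b2\<close>, and composing with \<open>b1\<close> gives f.\<close>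

lemma sat_imp_displays_markov_ci:
  assumes "sat D f (({} \<triangleright> W) \<^bold>; ((W \<triangleright> X) \<^bold>* (W \<triangleright> Y)))"
  shows "displays_markov_ci D W X Y U f"
proof -
  obtain b1 b2 where b: "is_kernel D b1" "is_kernel D b2" "tgt D b1 = src D b2" "b2 \<bullet> b1 = f"
    "sat D b1 ({} \<triangleright> W)" and star: "sat D b2 ((W \<triangleright> X) \<^bold>* (W \<triangleright> Y))"
    using assms unfolding sat.simps(3) seq_defined_def seq_def by blast
  obtain c1 c2 where c: "is_kernel D c1" "is_kernel D c2" "par_defined D c1 c2"
    "subkernel D (par D c1 c2) b2" "sat D c1 (W \<triangleright> X)" "sat D c2 (W \<triangleright> Y)"
    using star unfolding sat.simps(2) by blast
  obtain g1 where g1: "W \<subseteq> kdom D c1" "X \<subseteq> kcod D c1 - kdom D c1" "g1 \<in> arr D" "src D g1 = ws" "tgt D g1 = xs"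
    "sel \<lfloor>kcod D c1\<rfloor>\<^sub>v xs \<bullet> c1 = g1 \<bullet> sel \<lfloor>kdom D c1\<rfloor>\<^sub>v ws"
    using sat_Dep_factor[OF c(5)] disj by (metis Int_commute)
  obtain g2 where g2: "W \<subseteq> kdom D c2" "Y \<subseteq> kcod D c2 - kdom D c2" "g2 \<in> arr D" "src D g2 = ws" "tgt D g2 = ys"
    "sel \<lfloor>kcod D c2\<rfloor>\<^sub>v ys \<bullet> c2 = g2 \<bullet> sel \<lfloor>kdom D c2\<rfloor>\<^sub>v ws"
    using sat_Dep_factor[OF c(6)] disj by (metis Int_commute)
  \<comment> \<open>The domains \<open>S1\<close> and \<open>S2\<close> may be larger than W, since
    a dependency constrains only a subkernel; \<open>g1\<close> and \<open>g2\<close> nevertheless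
    read W alone.\<close>
  define S1 R1 S2 R2 where SR: "S1 = kdom D c1" "R1 = kcod D c1" "S2 = kdom D c2" "R2 = kcod D c2"
  obtain k1 where k1: "kernel_part S1 R1 k1" "c1 = mk_kernel D S1 R1 k1"
    using is_kernel_obtain[OF c(1)] unfolding SR by metis
  obtain k2 where k2: "kernel_part S2 R2 k2" "c2 = mk_kernel D S2 R2 k2"
    using is_kernel_obtain[OF c(2)] unfolding SR by metis
  note g1 = g1[folded SR] and g2 = g2[folded SR]
  have par_def: "S1 \<inter> S2 = R1 \<inter> R2" using c(3) by (simp add: par_defined_def SR)
  define p where "p = par_part S1 R1 k1 S2 R2 k2"
  have p: "kernel_part (S1 \<union> S2) (R1 \<union> R2) p" unfolding p_def by (rule kernel_part_par_part[OF k1(1) k2(1)])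
  have par: "par D c1 c2 = mk_kernel D (S1 \<union> S2) (R1 \<union> R2) p"
    unfolding k1(2) k2(2) p_def by (rule par_mk_kernel[OF k1(1) k2(1) par_def])
  note fins = kernel_partD(1,2)[OF k1(1)] kernel_partD(1,2)[OF k2(1)]
  let ?S = "S1 \<union> S2" and ?R = "R1 \<union> R2"
  let ?t = "sel \<lfloor>?S\<rfloor>\<^sub>v ws" and ?G = "\<langle>ident D ws, \<langle>g1, g2\<rangle>\<rangle>"
  have k1s: "sel \<lfloor>R1 - S1\<rfloor>\<^sub>v xs \<bullet> k1 \<bullet> sel \<lfloor>?S\<rfloor>\<^sub>v \<lfloor>S1\<rfloor>\<^sub>v = g1 \<bullet> ?t"
  proof -
    have "sel \<lfloor>R1 - S1\<rfloor>\<^sub>v xs \<bullet> k1 = g1 \<bullet> sel \<lfloor>S1\<rfloor>\<^sub>v ws"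
      using sel_mk_kernel_new[OF k1(1), of xs] g1(2,6) unfolding k1(2)[symmetric] set_vars by simp
    then have "(sel \<lfloor>R1 - S1\<rfloor>\<^sub>v xs \<bullet> k1) \<bullet> sel \<lfloor>?S\<rfloor>\<^sub>v \<lfloor>S1\<rfloor>\<^sub>v = (g1 \<bullet> sel \<lfloor>S1\<rfloor>\<^sub>v ws) \<bullet> sel \<lfloor>?S\<rfloor>\<^sub>v \<lfloor>S1\<rfloor>\<^sub>v"
      by simp
    then show ?thesis using g1(1-5) fins kernel_partD(4-6)[OF k1(1)] by (simp add: set_vars)
  qed
  have k2s: "sel \<lfloor>R2 - S2\<rfloor>\<^sub>v ys \<bullet> k2 \<bullet> sel \<lfloor>?S\<rfloor>\<^sub>v \<lfloor>S2\<rfloor>\<^sub>v = g2 \<bullet> ?t"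
  proof -
    have "sel \<lfloor>R2 - S2\<rfloor>\<^sub>v ys \<bullet> k2 = g2 \<bullet> sel \<lfloor>S2\<rfloor>\<^sub>v ws"
      using sel_mk_kernel_new[OF k2(1), of ys] g2(2,6) unfolding k2(2)[symmetric] set_vars by simp
    then have "(sel \<lfloor>R2 - S2\<rfloor>\<^sub>v ys \<bullet> k2) \<bullet> sel \<lfloor>?S\<rfloor>\<^sub>v \<lfloor>S2\<rfloor>\<^sub>v = (g2 \<bullet> sel \<lfloor>S2\<rfloor>\<^sub>v ws) \<bullet> sel \<lfloor>?S\<rfloor>\<^sub>v \<lfloor>S2\<rfloor>\<^sub>v"
      by simp
    then show ?thesis using g2(1-5) fins kernel_partD(4-6)[OF k2(1)] by (simp add: set_vars)
  qed
  have t: "?t \<in> arr D" "src D ?t = \<lfloor>?S\<rfloor>\<^sub>v" "tgt D ?t = ws" "ddet ?t"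
    using g1(1) fins by (simp_all add: set_vars)
  have "sel \<lfloor>?R\<rfloor>\<^sub>v (ws @ xs @ ys) \<bullet> par D c1 c2 = \<langle>?t, \<langle>g1 \<bullet> ?t, g2 \<bullet> ?t\<rangle>\<rangle>"
    unfolding par p_def k1s[symmetric] k2s[symmetric]
    by (rule sel_par[OF k1(1) k2(1) par_def]) (use g1(1,2) g2(2) in \<open>simp_all add: set_vars\<close>)
  also have "\<dots> = ?G \<bullet> ?t"
    using g1(3-5) g2(3-5) t by (simp add: dpair_dcmp_ddet)
  finally have marg: "sel \<lfloor>?R\<rfloor>\<^sub>v (ws @ xs @ ys) \<bullet> par D c1 c2 = ?G \<bullet> ?t" .
  have "is_kernel D (par D c1 c2)" unfolding par by (rule is_kernel_mk_kernel[OF p])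
  note sub = subkernelD[OF this c(4), unfolded par mk_kernel_simps[OF p], folded par]
  obtain l where l: "kernel_part (kdom D b2) (kcod D b2) l" "b2 = mk_kernel D (kdom D b2) (kcod D b2) l"
    using is_kernel_obtain[OF b(2)] by metis
  have b2: "b2 \<in> arr D" "src D b2 = \<lfloor>kdom D b2\<rfloor>\<^sub>v" "tgt D b2 = \<lfloor>kcod D b2\<rfloor>\<^sub>v"
    using mk_kernel_simps[OF l(1)] l(2) by simp_all
  have "kcod D b2 = set (tgt D f)" using b(4) by (auto simp: kcod_def)
  then have cod: "kcod D b2 = V" using f set_vars by simp
  obtain j where j: "kernel_part (kdom D b1) (kcod D b1) j" "b1 = mk_kernel D (kdom D b1) (kcod D b1) j"
    using is_kernel_obtain[OF b(1)] by metis
  have b1: "b1 \<in> arr D" "tgt D b1 = \<lfloor>kdom D b2\<rfloor>\<^sub>v" "src D b1 = []"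
    using mk_kernel_simps[OF j(1)] j(2) b(3,4) b2 f by auto
  have findom: "finite (kdom D b2)" using kernel_partD(1)[OF l(1)] .
  let ?d = "sel \<lfloor>kdom D b2\<rfloor>\<^sub>v \<lfloor>?S\<rfloor>\<^sub>v" and ?w = "sel \<lfloor>kdom D b2\<rfloor>\<^sub>v ws"
  have R: "set (ws @ xs @ ys) \<subseteq> set \<lfloor>?R\<rfloor>\<^sub>v" "set \<lfloor>?R\<rfloor>\<^sub>v \<subseteq> set \<lfloor>V\<rfloor>\<^sub>v"
    "set \<lfloor>?S\<rfloor>\<^sub>v \<subseteq> set \<lfloor>kdom D b2\<rfloor>\<^sub>v" "set ws \<subseteq> set \<lfloor>?S\<rfloor>\<^sub>v" "set ws \<subseteq> set \<lfloor>kdom D b2\<rfloor>\<^sub>v"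
    using g1(1,2) g2(2) kernel_partD(3)[OF k1(1)] sub(2,3) fins findom
    unfolding cod by (auto simp: set_vars)
  have pa: "par D c1 c2 \<in> arr D" "src D (par D c1 c2) = \<lfloor>?S\<rfloor>\<^sub>v" "tgt D (par D c1 c2) = \<lfloor>?R\<rfloor>\<^sub>v"
    unfolding par by (simp_all only: mk_kernel_simps[OF p])
  have G: "?G \<in> arr D" "src D ?G = ws" using g1(3-5) g2(3-5) by simp_all
  \<comment> \<open>The selection is factored through the outputs of the parallel sum, because that
    is the marginal of \<open>b2\<close> which \<open>subkernelD\<close> describes.\<close>
  have "sel \<lfloor>V\<rfloor>\<^sub>v (ws @ xs @ ys) \<bullet> b2 = sel \<lfloor>?R\<rfloor>\<^sub>v (ws @ xs @ ys) \<bullet> sel \<lfloor>V\<rfloor>\<^sub>v \<lfloor>?R\<rfloor>\<^sub>v \<bullet> b2"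
    by (rule sel_sel_dcmp[symmetric, OF R(1,2)]) (simp_all add: b2 cod)
  also have "\<dots> = sel \<lfloor>?R\<rfloor>\<^sub>v (ws @ xs @ ys) \<bullet> par D c1 c2 \<bullet> ?d"
    using sub(5) unfolding cod by simp
  also have "\<dots> = (sel \<lfloor>?R\<rfloor>\<^sub>v (ws @ xs @ ys) \<bullet> par D c1 c2) \<bullet> ?d"
    using R pa by (intro dcmp_assoc[symmetric]) (simp_all del: set_append)
  also have "\<dots> = (?G \<bullet> ?t) \<bullet> ?d" by (simp only: marg)
  also have "\<dots> = ?G \<bullet> ?t \<bullet> ?d"
    using R t G by (intro dcmp_assoc) (simp_all del: set_append)
  also have "?t \<bullet> ?d = ?w" by (rule sel_sel[OF R(4,3)])
  finally have *: "sel \<lfloor>V\<rfloor>\<^sub>v (ws @ xs @ ys) \<bullet> b2 = ?G \<bullet> ?w" .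
  have "sel \<lfloor>V\<rfloor>\<^sub>v (ws @ xs @ ys) \<bullet> f = (sel \<lfloor>V\<rfloor>\<^sub>v (ws @ xs @ ys) \<bullet> b2) \<bullet> b1"
    unfolding b(4)[symmetric] using b1 b2 cod set_arranged(2) set_vars
    by (intro dcmp_assoc[symmetric]) (simp_all del: set_append)
  also have "\<dots> = ?G \<bullet> ?w \<bullet> b1"
    unfolding * using G R(5) b1 by (intro dcmp_assoc) simp_all
  finally show ?thesis
    unfolding displays_markov_ci_iff using g1(3-5) g2(3-5) R(5) b1
    by (intro exI[of _ "?w \<bullet> b1"] exI[of _ g1] exI[of _ g2]) simp
qed

lemma displays_markov_ci_imp_sat:
  assumes cond: "has_conditional_distributions C" and "displays_markov_ci D W X Y U f"
  shows "sat D f (({} \<triangleright> W) \<^bold>; ((W \<triangleright> X) \<^bold>* (W \<triangleright> Y)))"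
proof -
  let ?wxy = "ws @ xs @ ys" and ?s = "arrange D W X Y U f"
  obtain s0 g1 g2 where s0: "s0 \<in> arr D" "src D s0 = []" "tgt D s0 = ws"
    and g1: "g1 \<in> arr D" "src D g1 = ws" "tgt D g1 = xs"
    and g2: "g2 \<in> arr D" "src D g2 = ws" "tgt D g2 = ys"
    and marg: "sel \<lfloor>V\<rfloor>\<^sub>v ?wxy \<bullet> f = \<langle>ident D ws, \<langle>g1, g2\<rangle>\<rangle> \<bullet> s0"
    using assms(2) unfolding displays_markov_ci_iff by (elim exE conjE) (rule that)
  define m where "m = sel \<lfloor>V\<rfloor>\<^sub>v ?wxy \<bullet> f"
  \<comment> \<open>This is a conditional distribution of U given W, X and Y; up to reordering of
    its inputs it becomes the nontrivial part of the extending kernel.\<close>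
  obtain k where k: "k \<in> arr D" "src D k = ?wxy" "tgt D k = us"
    and "?s = \<langle>ident D ?wxy, k\<rangle> \<bullet> pi1 ?wxy us \<bullet> ?s"
    using conditional_distribution[OF cond arrange_simps(1,2), of ?wxy us] arrange_simps(3)
    by (metis append_assoc)
  then have s: "?s = \<langle>ident D ?wxy, k\<rangle> \<bullet> m"
    unfolding m_def discard_eq_sel sel_arrange[OF set_arranged(2)] by simp
  have m: "m \<in> arr D" "tgt D m = ?wxy"
    unfolding m_def using f set_arranged(2) set_vars by (simp_all del: set_append)
  define M where "M = W \<union> X \<union> Y"
  have sets: "(W \<union> X) \<union> (W \<union> Y) \<union> {} = M" "W \<union> {} = W" "(W \<union> X) - W = X" "(W \<union> Y) - W = Y" "V - M = U"
    "M \<subseteq> V" "set ?wxy = M" "finite M"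
    using disj fin unfolding M_def V by (auto simp: set_vars)
  have dist: "distinct ?wxy" "distinct us" using disj by (auto simp: set_vars)
  have setM: "set \<lfloor>M\<rfloor>\<^sub>v = M" using sets by simp
  \<comment> \<open>Kernels read sorted lists, while k reads W, X, Y in sequence: \<open>?h\<close>
    sorts, and the selection inside \<open>?l\<close> undoes this.\<close>
  let ?l = "k \<bullet> sel \<lfloor>M\<rfloor>\<^sub>v ?wxy" and ?h = "sel ?wxy \<lfloor>M\<rfloor>\<^sub>v"
  have selM: "sel \<lfloor>M\<rfloor>\<^sub>v ?wxy \<in> arr D" "src D (sel \<lfloor>M\<rfloor>\<^sub>v ?wxy) = \<lfloor>M\<rfloor>\<^sub>v" "tgt D (sel \<lfloor>M\<rfloor>\<^sub>v ?wxy) = ?wxy"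
    "?h \<in> arr D" "src D ?h = ?wxy" "tgt D ?h = \<lfloor>M\<rfloor>\<^sub>v" "ddet ?h"
    by (simp_all add: sets(7) setM del: set_append)
  have l: "kernel_part M V ?l"
    unfolding kernel_part_def sets using selM k set_vars sets by simp
  have "\<langle>ident D \<lfloor>M\<rfloor>\<^sub>v, ?l\<rangle> \<bullet> ?h \<bullet> m = (\<langle>ident D \<lfloor>M\<rfloor>\<^sub>v, ?l\<rangle> \<bullet> ?h) \<bullet> m"
    using selM k m by (intro dcmp_assoc[symmetric]) simp_all
  \<comment> \<open>\<open>?h\<close> is a wiring and hence deterministic, so it distributes over
    the pairing although k need not be deterministic.\<close>
  also have "\<langle>ident D \<lfloor>M\<rfloor>\<^sub>v, ?l\<rangle> \<bullet> ?h = \<langle>?h, k\<rangle>"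
  proof -
    have "\<langle>ident D \<lfloor>M\<rfloor>\<^sub>v, ?l\<rangle> \<bullet> ?h = \<langle>ident D \<lfloor>M\<rfloor>\<^sub>v \<bullet> ?h, ?l \<bullet> ?h\<rangle>"
      using selM k by (intro dpair_dcmp_ddet) simp_all
    also have "?l \<bullet> ?h = k \<bullet> sel \<lfloor>M\<rfloor>\<^sub>v ?wxy \<bullet> ?h"
      using selM k by (intro dcmp_assoc) simp_all
    also have "sel \<lfloor>M\<rfloor>\<^sub>v ?wxy \<bullet> ?h = sel ?wxy ?wxy"
      by (rule sel_sel) (simp_all only: sets(7) setM subset_refl)
    also have "k \<bullet> sel ?wxy ?wxy = k" unfolding sel_self[OF dist(1)] using k by simp
    also have "ident D \<lfloor>M\<rfloor>\<^sub>v \<bullet> ?h = ?h" using selM by simp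
    finally show ?thesis .
  qed
  also have "\<dots> = (?h \<odot> sel us us) \<bullet> \<langle>ident D ?wxy, k\<rangle>"
    unfolding sel_self[OF dist(2)] using selM k by simp
  also have "?h \<odot> sel us us = sel (?wxy @ us) (\<lfloor>M\<rfloor>\<^sub>v @ us)"
    by (rule sel_dtarr_sel) (use disj in \<open>auto simp: set_vars fin M_def\<close>)
  also have "(sel (?wxy @ us) (\<lfloor>M\<rfloor>\<^sub>v @ us) \<bullet> \<langle>ident D ?wxy, k\<rangle>) \<bullet> m
      = sel (?wxy @ us) (\<lfloor>M\<rfloor>\<^sub>v @ us) \<bullet> \<langle>ident D ?wxy, k\<rangle> \<bullet> m"
    using k m by (intro dcmp_assoc) (simp_all add: set_vars fin M_def)
  also have "\<dots> = sel (ws @ xs @ ys @ us) (\<lfloor>M\<rfloor>\<^sub>v @ us) \<bullet> ?s"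
    unfolding s by simp
  finally have 1: "\<langle>ident D \<lfloor>M\<rfloor>\<^sub>v, ?l\<rangle> \<bullet> ?h \<bullet> m = sel (ws @ xs @ ys @ us) (\<lfloor>M\<rfloor>\<^sub>v @ us) \<bullet> ?s" .
  have "mk_kernel D M V ?l \<bullet> ?h \<bullet> m = sel (\<lfloor>M\<rfloor>\<^sub>v @ us) \<lfloor>V\<rfloor>\<^sub>v \<bullet> \<langle>ident D \<lfloor>M\<rfloor>\<^sub>v, ?l\<rangle> \<bullet> ?h \<bullet> m"
    unfolding mk_kernel_eq_sel[OF l] sets using selM k m
    by (intro dcmp_assoc) (auto simp: set_vars fin M_def V)
  also have "\<dots> = sel (\<lfloor>M\<rfloor>\<^sub>v @ us) \<lfloor>V\<rfloor>\<^sub>v \<bullet> sel (ws @ xs @ ys @ us) (\<lfloor>M\<rfloor>\<^sub>v @ us) \<bullet> ?s"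
    unfolding 1 ..
  also have "\<dots> = sel (ws @ xs @ ys @ us) \<lfloor>V\<rfloor>\<^sub>v \<bullet> ?s"
    by (rule sel_sel_dcmp) (use arrange_simps in \<open>auto simp: set_vars fin M_def V\<close>)
  also have "\<dots> = f" by (rule f_eq_sel_arrange[symmetric])
  finally have f_eq: "f = mk_kernel D M V ?l \<bullet> ?h \<bullet> m" by simp
  show ?thesis
  proof (rule sat_seq_starI[of W "W \<union> X" g1 "W \<union> Y" g2 X Y "{}" V ?l s0], unfold sets)
    show "kernel_part W (W \<union> X) g1" "kernel_part W (W \<union> Y) g2"
      unfolding kernel_part_def sets using g1 g2 fin by simp_all
    have "sel ws ws = ident D ws" by (rule sel_self) simp
    then show "f = mk_kernel D M V ?l \<bullet> ?h \<bullet> \<langle>ident D ws, \<langle>g1, g2\<rangle> \<bullet> sel ws ws\<rangle> \<bullet> s0"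
      using f_eq g1 g2 unfolding m_def marg by simp
    show "(W \<union> X) \<inter> (W \<union> Y) = W" using disj by blast
  qed (use l s0 in simp_all)
qed

text \<open>The given factorisation already has the required form up to reordering:
  \<open>s0\<close> becomes the first kernel with \<open>us0\<close> as bypassing variables, and
  \<open>g1\<close>, \<open>g2\<close> become kernels from W that also output their shares of U.
  These shares are disjoint, so the two kernels have only W in common.\<close>

lemma displays_superset_ci_imp_sat:
  assumes "displays_superset_ci D W X Y U f"
  shows "sat D f (({} \<triangleright> W) \<^bold>; ((W \<triangleright> X) \<^bold>* (W \<triangleright> Y)))"
proof -
  obtain us0 us1 us2 s0 g1 g2 where dist: "distinct (us0 @ us1 @ us2)" and U: "set (us0 @ us1 @ us2) = set us"
    and h: "s0 \<in> hom D [] (ws @ us0)" "g1 \<in> hom D ws (xs @ us1)" "g2 \<in> hom D ws (ys @ us2)"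
    and s: "arrange D W X Y U f = rewire D (ws @ (xs @ us1) @ (ys @ us2) @ us0) (ws @ xs @ ys @ us)
                \<bullet> ((ident D ws \<odot> g1 \<odot> g2) \<odot> ident D us0) \<bullet> (copy3 D ws \<odot> ident D us0) \<bullet> s0"
    using assms unfolding displays_superset_ci_def superset_ci_def
    by (elim exE conjE bexE) (rule that)
  have s0: "s0 \<in> arr D" "src D s0 = []" "tgt D s0 = ws @ us0"
    and g1: "g1 \<in> arr D" "src D g1 = ws" "tgt D g1 = xs @ us1"
    and g2: "g2 \<in> arr D" "src D g2 = ws" "tgt D g2 = ys @ us2"
    using h by (simp_all add: hom_def)
  let ?gs = "xs @ us1 @ ys @ us2" and ?G = "\<langle>g1, g2\<rangle>"
  let ?p1 = "pi1 ws us0" and ?p2 = "pi2 ws us0"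
  define U0 U1 U2 where U012: "U0 = set us0" "U1 = set us1" "U2 = set us2"
  have U_eq: "U = U0 \<union> U1 \<union> U2" using U by (auto simp: set_vars U012)
  have disjU: "U0 \<inter> U1 = {}" "U0 \<inter> U2 = {}" "U1 \<inter> U2 = {}" using dist by (auto simp: U012)
  have finU: "finite U0" "finite U1" "finite U2" by (simp_all add: U012)
  have dists: "distinct (ws @ (xs @ us1) @ (ys @ us2) @ us0)" "distinct (ws @ xs @ ys @ us)" "distinct ws"
    "distinct (us0 @ ?gs)"
    using dist disj disjU unfolding U_eq by (auto simp: set_vars U012)
  have setL: "set (ws @ (xs @ us1) @ (ys @ us2) @ us0) = V" "set (ws @ ?gs @ us0) = V" "set (ws @ us0 @ ?gs) = V"
    using U_eq by (auto simp: V set_vars U012)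
  have G: "?G \<in> arr D" "src D ?G = ws" "tgt D ?G = ?gs" using g1 g2 by simp_all
  have p: "?p1 \<in> arr D" "src D ?p1 = ws @ us0" "tgt D ?p1 = ws" "?p2 \<in> arr D" "src D ?p2 = ws @ us0" "tgt D ?p2 = us0"
    by simp_all
  let ?J = "\<langle>ident D (ws @ us0), ?G \<bullet> ?p1\<rangle>"
  have "((ident D ws \<odot> g1 \<odot> g2) \<odot> ident D us0) \<bullet> (copy3 D ws \<odot> ident D us0)
      = \<langle>ident D ws, ?G\<rangle> \<odot> ident D us0"
  proof -
    have "((ident D ws \<odot> g1 \<odot> g2) \<odot> ident D us0) \<bullet> (copy3 D ws \<odot> ident D us0)
        = ((ident D ws \<odot> g1 \<odot> g2) \<bullet> copy3 D ws) \<odot> (ident D us0 \<bullet> ident D us0)"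
      using g1 g2 by (intro dtarr_dcmp_dtarr) (simp_all add: copy3_def)
    also have "(ident D ws \<odot> g1 \<odot> g2) \<bullet> copy3 D ws = \<langle>ident D ws, ?G\<rangle>"
      using g1 g2 by (intro copy3_dpair)
    also have "ident D us0 \<bullet> ident D us0 = ident D us0" by simp
    finally show ?thesis .
  qed
  also have "\<dots> = \<langle>\<langle>ident D ws, ?G\<rangle> \<bullet> ?p1, ident D us0 \<bullet> ?p2\<rangle>"
    using dtarr_eq_dpair[of "\<langle>ident D ws, ?G\<rangle>" "ident D us0"] G by simp
  also have "\<langle>ident D ws, ?G\<rangle> \<bullet> ?p1 = \<langle>?p1, ?G \<bullet> ?p1\<rangle>"
    using dpair_dcmp_ddet[of ?p1 "ident D ws" ?G] G by simp
  also have "\<langle>\<langle>?p1, ?G \<bullet> ?p1\<rangle>, ident D us0 \<bullet> ?p2\<rangle> = \<langle>?p1, \<langle>?G \<bullet> ?p1, ?p2\<rangle>\<rangle>"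
    using G by simp
  \<comment> \<open>Moving \<open>us0\<close> next to \<open>ws\<close> turns the first two
    components into the identity on the output of \<open>s0\<close>, the shape that
    \<open>sat_seq_starI\<close> asks for.\<close>
  also have "\<dots> = (ident D ws \<odot> swap D us0 ?gs) \<bullet> \<langle>?p1, \<langle>?p2, ?G \<bullet> ?p1\<rangle>\<rangle>"
  proof -
    have "swap D us0 ?gs \<bullet> \<langle>?p2, ?G \<bullet> ?p1\<rangle> = \<langle>?G \<bullet> ?p1, ?p2\<rangle>"
      by (rule swap_dpair) (use G in simp_all)
    moreover have "(ident D ws \<odot> swap D us0 ?gs) \<bullet> \<langle>?p1, \<langle>?p2, ?G \<bullet> ?p1\<rangle>\<rangle>
        = \<langle>ident D ws \<bullet> ?p1, swap D us0 ?gs \<bullet> \<langle>?p2, ?G \<bullet> ?p1\<rangle>\<rangle>"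
      by (rule dtarr_dpair) (use G in simp_all)
    ultimately show ?thesis by simp
  qed
  also have "\<langle>?p1, \<langle>?p2, ?G \<bullet> ?p1\<rangle>\<rangle> = ?J"
    unfolding dpair_pi[symmetric] by (rule dpair_dpair[symmetric]) (use G in simp_all)
  also have "ident D ws \<odot> swap D us0 ?gs = sel ws ws \<odot> sel (us0 @ ?gs) (?gs @ us0)"
    using dists by (simp only: swap_eq_sel sel_self)
  also have "\<dots> = sel (ws @ us0 @ ?gs) (ws @ ?gs @ us0)"
    by (rule sel_dtarr_sel) (use dists in auto)
  finally have wiring: "((ident D ws \<odot> g1 \<odot> g2) \<odot> ident D us0) \<bullet> (copy3 D ws \<odot> ident D us0)
      = sel (ws @ us0 @ ?gs) (ws @ ?gs @ us0) \<bullet> ?J" .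
  have J: "?J \<in> arr D" "src D ?J = ws @ us0" "tgt D ?J = ws @ us0 @ ?gs" using G by simp_all
  have rw: "rewire D (ws @ (xs @ us1) @ (ys @ us2) @ us0) (ws @ xs @ ys @ us)
      = sel (ws @ ?gs @ us0) (ws @ xs @ ys @ us)"
    using rewire_eq_sel[OF dists(1,2)] setL set_arranged by simp
  have Js: "?J \<bullet> s0 \<in> arr D" "tgt D (?J \<bullet> s0) = ws @ us0 @ ?gs" using J s0 by simp_all
  have "arrange D W X Y U f = sel (ws @ ?gs @ us0) (ws @ xs @ ys @ us)
      \<bullet> (((ident D ws \<odot> g1 \<odot> g2) \<odot> ident D us0) \<bullet> (copy3 D ws \<odot> ident D us0)) \<bullet> s0"
    unfolding s rw using g1 g2 s0 by (subst dcmp_assoc) (simp_all add: copy3_def)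
  also have "\<dots> = sel (ws @ ?gs @ us0) (ws @ xs @ ys @ us) \<bullet> sel (ws @ us0 @ ?gs) (ws @ ?gs @ us0) \<bullet> ?J \<bullet> s0"
    unfolding wiring by (subst dcmp_assoc) (use J s0 setL in \<open>simp_all del: set_append\<close>)
  also have "\<dots> = sel (ws @ us0 @ ?gs) (ws @ xs @ ys @ us) \<bullet> ?J \<bullet> s0"
    by (rule sel_sel_dcmp) (use Js in \<open>simp_all only: setL set_arranged subset_refl\<close>)
  finally have arr: "arrange D W X Y U f = sel (ws @ us0 @ ?gs) (ws @ xs @ ys @ us) \<bullet> ?J \<bullet> s0" .
  have f_eq: "f = sel (ws @ us0 @ ?gs) \<lfloor>V\<rfloor>\<^sub>v \<bullet> ?J \<bullet> s0"
    by (subst f_eq_sel_arrange, unfold arr, rule sel_sel_dcmp)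
      (use Js in \<open>simp_all only: setL set_arranged set_vars subset_refl\<close>)

  \<comment> \<open>Outputs of kernels are sorted lists of sets, so each of \<open>s0\<close>,
    \<open>g1\<close> and \<open>g2\<close> is now followed by a sorting wiring; the rest of the
    proof checks that these wirings cancel.\<close>
  let ?R1 = "W \<union> X \<union> U1" and ?R2 = "W \<union> Y \<union> U2"
  let ?A = "\<lfloor>X \<union> U1\<rfloor>\<^sub>v" and ?B = "\<lfloor>Y \<union> U2\<rfloor>\<^sub>v" and ?Q = "\<lfloor>W \<union> U0\<rfloor>\<^sub>v"
  let ?k1 = "sel (xs @ us1) ?A \<bullet> g1" and ?k2 = "sel (ys @ us2) ?B \<bullet> g2"
  let ?s = "sel (ws @ us0) ?Q \<bullet> s0"
  have sets: "?R1 - W = X \<union> U1" "?R2 - W = Y \<union> U2" "?R1 \<union> ?R2 \<union> U0 = V"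
    using disj unfolding V U_eq by auto
  have setA: "set ?A = set (xs @ us1)" "set ?B = set (ys @ us2)" "set ?Q = set (ws @ us0)" "set ws \<subseteq> set ?Q"
    using fin finU by (simp_all add: U012)
  have A: "sel (xs @ us1) ?A \<in> arr D" "src D (sel (xs @ us1) ?A) = xs @ us1" "tgt D (sel (xs @ us1) ?A) = ?A"
    "sel (ys @ us2) ?B \<in> arr D" "src D (sel (ys @ us2) ?B) = ys @ us2" "tgt D (sel (ys @ us2) ?B) = ?B"
    "sel (ws @ us0) ?Q \<in> arr D" "src D (sel (ws @ us0) ?Q) = ws @ us0" "tgt D (sel (ws @ us0) ?Q) = ?Q"
    "ddet (sel (ws @ us0) ?Q)"
    "sel ?Q ws \<in> arr D" "src D (sel ?Q ws) = ?Q" "tgt D (sel ?Q ws) = ws"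
    using setA by (simp_all del: set_append set_sorted_list_of_set)
  have k1: "kernel_part W ?R1 ?k1" and k2: "kernel_part W ?R2 ?k2"
    unfolding kernel_part_def sets using fin finU g1 g2 A by simp_all
  let ?K = "\<langle>?k1, ?k2\<rangle>"
  have K: "?K \<in> arr D" "src D ?K = ws" "tgt D ?K = ?A @ ?B" using A g1 g2 by simp_all
  have Keq: "?K = sel ?gs (?A @ ?B) \<bullet> ?G"
  proof -
    have "?K = (sel (xs @ us1) ?A \<odot> sel (ys @ us2) ?B) \<bullet> ?G" using A g1 g2 by simp
    also have "sel (xs @ us1) ?A \<odot> sel (ys @ us2) ?B = sel ((xs @ us1) @ ys @ us2) (?A @ ?B)"
      by (rule sel_dtarr_sel) (use setA dists(4) in auto)
    finally show ?thesis by simp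
  qed
  have selK: "set (?A @ ?B) \<subseteq> set ?gs" using setA by auto
  have "\<langle>ident D ?Q, ?K \<bullet> sel ?Q ws\<rangle> \<bullet> ?s = (\<langle>ident D ?Q, ?K \<bullet> sel ?Q ws\<rangle> \<bullet> sel (ws @ us0) ?Q) \<bullet> s0"
    using A K s0 by (intro dcmp_assoc[symmetric]) simp_all
  also have "\<langle>ident D ?Q, ?K \<bullet> sel ?Q ws\<rangle> \<bullet> sel (ws @ us0) ?Q
      = \<langle>ident D ?Q \<bullet> sel (ws @ us0) ?Q, (?K \<bullet> sel ?Q ws) \<bullet> sel (ws @ us0) ?Q\<rangle>"
    using A K by (intro dpair_dcmp_ddet) simp_all
  also have "ident D ?Q \<bullet> sel (ws @ us0) ?Q = sel (ws @ us0) ?Q" using A by simp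
  also have "(?K \<bullet> sel ?Q ws) \<bullet> sel (ws @ us0) ?Q = ?K \<bullet> sel ?Q ws \<bullet> sel (ws @ us0) ?Q"
    using A K by (intro dcmp_assoc) simp_all
  also have "sel ?Q ws \<bullet> sel (ws @ us0) ?Q = sel (ws @ us0) ws"
    by (rule sel_sel) (use setA in simp_all)
  also have "sel (ws @ us0) ws = ?p1"
    using sel_append_left[of ws ws us0] dists(3) by simp
  also have "?K \<bullet> ?p1 = sel ?gs (?A @ ?B) \<bullet> ?G \<bullet> ?p1"
    unfolding Keq using selK G p by (intro dcmp_assoc) (simp_all del: set_append)
  also have "\<langle>sel (ws @ us0) ?Q, sel ?gs (?A @ ?B) \<bullet> ?G \<bullet> ?p1\<rangle> = (sel (ws @ us0) ?Q \<odot> sel ?gs (?A @ ?B)) \<bullet> ?J"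
  proof -
    have "(sel (ws @ us0) ?Q \<odot> sel ?gs (?A @ ?B)) \<bullet> ?J
        = \<langle>sel (ws @ us0) ?Q \<bullet> ident D (ws @ us0), sel ?gs (?A @ ?B) \<bullet> ?G \<bullet> ?p1\<rangle>"
      using A selK G p by (intro dtarr_dpair) (simp_all del: set_append)
    then show ?thesis using A by simp
  qed
  also have "sel (ws @ us0) ?Q \<odot> sel ?gs (?A @ ?B) = sel ((ws @ us0) @ ?gs) (?Q @ ?A @ ?B)"
    by (rule sel_dtarr_sel) (use setA dists in auto)
  also have "\<dots> = sel (ws @ us0 @ ?gs) (?Q @ ?A @ ?B)" by simp
  also have "(sel (ws @ us0 @ ?gs) (?Q @ ?A @ ?B) \<bullet> ?J) \<bullet> s0 = sel (ws @ us0 @ ?gs) (?Q @ ?A @ ?B) \<bullet> ?J \<bullet> s0"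
    by (rule dcmp_assoc) (use J s0 setA in auto)
  finally have 1: "\<langle>ident D ?Q, ?K \<bullet> sel ?Q ws\<rangle> \<bullet> ?s = sel (ws @ us0 @ ?gs) (?Q @ ?A @ ?B) \<bullet> ?J \<bullet> s0" .
  have setQ: "set (?Q @ ?A @ ?B) = V" using setL(3) setA by auto
  \<comment> \<open>The identity on V in the shape of a kernel: there are no new outputs, so its
    nontrivial part is \<open>del\<close>.\<close>
  have "mk_kernel D V V (del D \<lfloor>V\<rfloor>\<^sub>v) \<bullet> sel (?Q @ ?A @ ?B) \<lfloor>V\<rfloor>\<^sub>v \<bullet> \<langle>ident D ?Q, ?K \<bullet> sel ?Q ws\<rangle> \<bullet> ?s
      = ident D \<lfloor>V\<rfloor>\<^sub>v \<bullet> sel (?Q @ ?A @ ?B) \<lfloor>V\<rfloor>\<^sub>v \<bullet> sel (ws @ us0 @ ?gs) (?Q @ ?A @ ?B) \<bullet> ?J \<bullet> s0"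
    unfolding 1 ident_eq_mk_kernel[OF set_vars(6)] ..
  also have "sel (?Q @ ?A @ ?B) \<lfloor>V\<rfloor>\<^sub>v \<bullet> sel (ws @ us0 @ ?gs) (?Q @ ?A @ ?B) \<bullet> ?J \<bullet> s0
      = sel (ws @ us0 @ ?gs) \<lfloor>V\<rfloor>\<^sub>v \<bullet> ?J \<bullet> s0"
    by (rule sel_sel_dcmp) (use Js in \<open>simp_all only: setQ setL set_vars subset_refl\<close>)
  also have "\<dots> = f" by (rule f_eq[symmetric])
  also have "ident D \<lfloor>V\<rfloor>\<^sub>v \<bullet> f = f" using f by simp
  finally have f_eq': "f = mk_kernel D V V (del D \<lfloor>V\<rfloor>\<^sub>v) \<bullet> sel (?Q @ ?A @ ?B) \<lfloor>V\<rfloor>\<^sub>v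
      \<bullet> \<langle>ident D ?Q, ?K \<bullet> sel ?Q ws\<rangle> \<bullet> ?s" by (rule sym)
  show ?thesis
  proof (rule sat_seq_starI[of W ?R1 ?k1 ?R2 ?k2 X Y U0 V "del D \<lfloor>V\<rfloor>\<^sub>v" ?s], unfold sets)
    show "kernel_part V V (del D \<lfloor>V\<rfloor>\<^sub>v)" by (rule kernel_part_del[OF set_vars(6)])
    show "?R1 \<inter> ?R2 = W" "(?R1 \<union> ?R2) \<inter> U0 \<subseteq> W" using disj disjU unfolding U_eq by blast+
    show "?s \<in> arr D" "src D ?s = []" "tgt D ?s = ?Q" using A s0 by simp_all
  qed (use k1 k2 f_eq' finU in \<open>simp_all only:\<close>, auto)
qed

end

end

theorem theorem2:
  fixes C :: "('o, 'a) mcat"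
    and \<theta> :: "'v::{countable, infinite, linorder} \<Rightarrow> 'o"
    and W X Y U :: "'v set"
    and f :: "'v list \<times> 'a \<times> 'v list"
  assumes "markov_category C"
    and "\<And>x. \<theta> x \<in> obj C"
    and "finite W" "finite X" "finite Y" "finite U"
    and "W \<inter> X = {}" "W \<inter> Y = {}" "W \<inter> U = {}" "X \<inter> Y = {}" "X \<inter> U = {}" "Y \<inter> U = {}"
    and "kernel (list_cat C \<theta>) {} (W \<union> X \<union> Y \<union> U) f"
  shows "(has_conditional_distributions C \<longrightarrow>
            (displays_markov_ci (list_cat C \<theta>) W X Y U f \<longleftrightarrow>
             sat (list_cat C \<theta>) f (({} \<triangleright> W) \<^bold>; ((W \<triangleright> X) \<^bold>* (W \<triangleright> Y)))))
       \<and> (sat (list_cat C \<theta>) f (({} \<triangleright> W) \<^bold>; ((W \<triangleright> X) \<^bold>* (W \<triangleright> Y))) \<longrightarrow>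
             displays_markov_ci (list_cat C \<theta>) W X Y U f)
       \<and> (displays_superset_ci (list_cat C \<theta>) W X Y U f \<longrightarrow>
             sat (list_cat C \<theta>) f (({} \<triangleright> W) \<^bold>; ((W \<triangleright> X) \<^bold>* (W \<triangleright> Y))))"
proof -
  interpret sorted_variable_markov_category C \<theta>
    using assms(1,2)
    by (simp add: sorted_variable_markov_category_def variable_markov_category_def
        variable_markov_category_axioms_def)
  obtain k where k: "kernel_part {} (W \<union> X \<union> Y \<union> U) k" "f = mk_kernel D {} (W \<union> X \<union> Y \<union> U) k"
    using assms(13) by (rule kernel_obtain)
  have "f \<in> arr D" "src D f = []" "tgt D f = \<lfloor>W \<union> X \<union> Y \<union> U\<rfloor>\<^sub>v"
    using mk_kernel_simps[OF k(1)] by (simp_all add: k(2))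
  \<comment> \<open>\<open>refl\<close> discharges the defining equation of \<open>V\<close> and
    thereby instantiates it with the union.\<close>
  note hyps = assms(3-12) refl this
  show ?thesis
    using displays_markov_ci_imp_sat[OF hyps] sat_imp_displays_markov_ci[OF hyps]
      displays_superset_ci_imp_sat[OF hyps] by blast
qed

end
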